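(* Let $m,n\ge 1$ be integers, $\lambda>0$, and let $\mathbf v\in\mathbb C^m$ with $\|\mathbf v\|=1$. For $\sigma>0$ let $H\sim\mathcal{CW}_m(n,\lambda\mathbf v\mathbf v^\dagger+\sigma^2 I_m)$ and let $\ell_1(\sigma)$ be the largest eigenvalue of $H$. Then, with $(m,n,\lambda)$ fixed, as $\sigma\to0$, $$\ell_1(\sigma)=\frac{\lambda+\sigma^2}{2}A+\frac{\sigma^2}{2}B+\frac{\sigma^4}{2(\lambda+\sigma^2)}\,\frac{B\cdot C}{A}+o(\sigma^4),$$ where $A,B,C$ are independent random variables distributed as $A\sim\chi^2_{2n}$, $B\sim\chi^2_{2m-2}$, $C\sim\chi^2_{2n-2}$.
   Context: $\dagger$ denotes conjugate transpose. $\mathcal{CN}(\mu,\Sigma)$ is the circularly symmetric complex Gaussian law with mean $\mu$ and covariance $\mathbb E[(x-\mu)(x-\mu)^\dagger]=\Sigma$. $\mathcal{CW}_m(n,\Sigma)$ is the complex Wishart law, i.e. the law of $\sum_{j=1}^n x_jx_j^\dagger$ with $x_1,\dots,x_n$ i.i.d. $\mathcal{CN}(0,\Sigma)$ in $\mathbb C^m$. $\chi^2_k$ is the (real) chi-squared law with $k$ degrees of freedom, with $\chi^2_0\equiv0$. The displayed equality is a stochastic representation: the matrices $H$ (for all small $\sigma>0$) and the variables $A,B,C$ (which have the stated joint law for each $\sigma$) can be realized on a common probability space so that the equality holds, where $o(\sigma^4)$ denotes a random remainder which, divided by $\sigma^4$, tends to $0$ in probability as $\sigma\to0$. *)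

theory Defs
  imports "HOL-Probability.Probability"
begin

definition self_outer :: "complex ^ 'm \<Rightarrow> complex ^ 'm ^ 'm" where
  "self_outer x = (\<chi> i j. x $ i * cnj (x $ j))"

definition is_eigenvalue :: "complex ^ 'm ^ 'm \<Rightarrow> complex \<Rightarrow> bool" where
  "is_eigenvalue S k \<longleftrightarrow> (\<exists>x. x \<noteq> 0 \<and> S *v x = k *s x)"

text \<open>
  Meant for Hermitian matrices, all of whose eigenvalues are real. An \<open>m\<close>-by-\<open>m\<close> matrix has
  finitely many eigenvalues and a Hermitian one has at least one, so there the maximum exists.
\<close>
definition largest_eigenvalue :: "complex ^ 'm ^ 'm \<Rightarrow> real" where
  "largest_eigenvalue S = Max {l. is_eigenvalue S (complex_of_real l)}"

text \<open>Point masses count as (degenerate) normal laws.\<close>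
definition normal_law :: "real measure \<Rightarrow> bool" where
  "normal_law N \<longleftrightarrow>
     (\<exists>c. N = return borel c) \<or> (\<exists>c s. s > 0 \<and> N = density lborel (normal_density c s))"

text \<open>
  \<open>complex_normal N \<mu> \<Sigma>\<close> says that \<open>N\<close> is the circularly symmetric complex Gaussian law with
  mean \<open>\<mu>\<close> and covariance \<open>\<Sigma>\<close>. The inner product \<open>t \<bullet> x\<close> of \<open>complex ^ 'm\<close> is real-valued, namely
  the real part of the Hermitian product of \<open>t\<close> and \<open>x\<close>; hence \<open>\<lambda>x. t \<bullet> x\<close> ranges over all
  real-linear functionals, and the third conjunct is joint normality of the real and imaginary
  parts of the coordinates.
\<close>
definition complex_normal ::
    "(complex ^ 'm) measure \<Rightarrow> complex ^ 'm \<Rightarrow> complex ^ 'm ^ 'm \<Rightarrow> bool" where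
  "complex_normal N \<mu> \<Sigma> \<longleftrightarrow>
     prob_space N \<and> sets N = sets borel \<and>
     (\<forall>t. normal_law (distr N borel (\<lambda>x. t \<bullet> x))) \<and>
     (\<forall>c. norm c = 1 \<longrightarrow>
        distr N borel (\<lambda>x. c *s (x - \<mu>)) = distr N borel (\<lambda>x. x - \<mu>)) \<and>
     (\<forall>i. integral\<^sup>L N (\<lambda>x. x $ i) = \<mu> $ i) \<and>
     (\<forall>i j. integral\<^sup>L N (\<lambda>x. self_outer (x - \<mu>) $ i $ j) = \<Sigma> $ i $ j)"

text \<open>
  The i.i.d. sample \<open>x\<^sub>1, \<dots>, x\<^sub>n\<close> is the coordinate process on the \<open>n\<close>-fold product of the
  Gaussian law, which is uniquely determined by its mean and covariance.
\<close>
definition complex_wishart ::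
    "(complex ^ 'm ^ 'm) measure \<Rightarrow> nat \<Rightarrow> complex ^ 'm ^ 'm \<Rightarrow> bool" where
  "complex_wishart W n \<Sigma> \<longleftrightarrow>
     (\<exists>N. complex_normal N 0 \<Sigma> \<and>
       W = distr (PiM {..<n} (\<lambda>_. N)) borel (\<lambda>x. \<Sum>j<n. self_outer (x j)))"

definition chi_squared :: "nat \<Rightarrow> real measure" where
  "chi_squared k =
     distr (PiM {..<k} (\<lambda>_. density lborel std_normal_density)) borel (\<lambda>x. \<Sum>i<k. (x i)\<^sup>2)"

lemma chi_squared_0: "chi_squared 0 = return borel 0"
proof -
  interpret P: prob_space "PiM {} (\<lambda>_::nat. density lborel std_normal_density)"
    by (simp add: prob_space_PiM prob_space_normal_density)
  show ?thesis
    unfolding chi_squared_def by (simp add: P.distr_const)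
qed

text \<open>
  Convergence in probability of real random variables to a constant along a filter. Eventual
  measurability is required because \<open>measure M\<close> is \<open>0\<close> on non-measurable sets, which would make
  the limit vacuous.
\<close>
definition tendsto_in_prob ::
    "'a measure \<Rightarrow> ('b \<Rightarrow> 'a \<Rightarrow> real) \<Rightarrow> real \<Rightarrow> 'b filter \<Rightarrow> bool" where
  "tendsto_in_prob M X c F \<longleftrightarrow>
     (\<forall>\<^sub>F s in F. X s \<in> borel_measurable M) \<and>
     (\<forall>e>0. ((\<lambda>s. measure M {\<omega> \<in> space M. \<bar>X s \<omega> - c\<bar> > e}) \<longlongrightarrow> 0) F)"

end

theory Submission
  imports Defs
begin

text \<open>
  Realize the sample as \<open>x\<^sub>j = (s a\<^sub>j v + \<sigma> W\<^sub>j) / \<surd>2\<close> with \<open>s\<^sup>2 = \<lambda> + \<sigma>\<^sup>2\<close>, where \<open>a\<^sub>j\<close> is a complex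
  Gaussian scalar and \<open>W\<^sub>j\<close> an independent Gaussian vector orthogonal to \<open>v\<close>, none of them depending
  on \<open>\<sigma>\<close> and each with unit variance in every real coordinate. Put \<open>\<alpha> = \<Sum> |a\<^sub>j|\<^sup>2\<close>, \<open>g = \<Sum> cnj a\<^sub>j W\<^sub>j\<close> and \<open>S = \<Sum> W\<^sub>j W\<^sub>j\<^sup>*\<close>. A top
  eigenvector \<open>v + y\<close> with eigenvalue \<open>l / 2\<close> satisfies \<open>l = s\<^sup>2 \<alpha> + s \<sigma> g\<^sup>* y\<close> and
  \<open>l y = s \<sigma> g + \<sigma>\<^sup>2 S y\<close>; iterating the second equation in the first expands \<open>l\<close> up to
  \<open>o(\<sigma>\<^sup>4)\<close> in terms of \<open>A = \<alpha>\<close>, \<open>B = |b|\<^sup>2\<close> and \<open>C = b\<^sup>* S b / |b|\<^sup>2 - |b|\<^sup>2\<close>, where \<open>b = g / \<surd>\<alpha>\<close>, for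
  every outcome with \<open>\<alpha> \<noteq> 0\<close>.

  Given the \<open>a\<^sub>j\<close>, \<open>b\<close> is a unit combination of the i.i.d. \<open>W\<^sub>j\<close>. By invariance of the sample under
  unitary mixing, which follows from that of pairs, one may take \<open>b\<close> to be \<open>W\<^sub>0\<close>; then \<open>C\<close> is the sum of
  the squares of the components of the other \<open>W\<^sub>j\<close> along \<open>W\<^sub>0\<close>.
\<close>

section \<open>Hermitian forms and the largest eigenvalue\<close>

text \<open>Two obstacles shape the proof. The weights that form b are functions of the a_j, which
  also determine A; independence of A from (B, C) holds because, given the a_j, the law of (B, C) is
  the same for every unit weight vector. The joint law is therefore computed as an iterated integral
  with the a_j outermost. Secondly, the formula for C fails when b = 0, which for m = 1 happens
  almost surely. The expansion sees C only through the product B C, so C may there be replaced by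
  any variable of the right law, built from spare Gaussian coordinates. The term - |b|^2 in C has
  two matching origins. Analytically, replacing l by s^2 \<alpha> + \<sigma>^2 B in the term s^2
  \<sigma>^2 |g|^2 / l contributes - |b|^4 at order \<sigma>^4, next to b^* S b. Probabilistically,
  once b is rotated to W_0, the summand W_0 W_0^* of S contributes exactly |b|^4 to b^* S b, and the
  two cancel. The factor 1 / sqrt 2 reconciles unit variance per real coordinate, natural for
  chi-squared laws, with a covariance that counts real and imaginary parts together.\<close>

definition herm :: "complex ^ 'm \<Rightarrow> complex ^ 'm \<Rightarrow> complex" where
  "herm x y = (\<Sum>i\<in>UNIV. cnj (x $ i) * y $ i)"

lemma herm_add_right: "herm x (y + z) = herm x y + herm x z"
  by (simp add: herm_def algebra_simps sum.distrib)

lemma herm_add_left: "herm (x + y) z = herm x z + herm y z"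
  by (simp add: herm_def algebra_simps sum.distrib)

lemma herm_diff_right: "herm x (y - z) = herm x y - herm x z"
  by (simp add: herm_def algebra_simps sum_subtractf)

lemma herm_diff_left: "herm (x - y) z = herm x z - herm y z"
  by (simp add: herm_def algebra_simps sum_subtractf)

lemma herm_scale_right: "herm x (c *s y) = c * herm x y"
  by (simp add: herm_def sum_distrib_left algebra_simps)

lemma herm_scale_left: "herm (c *s x) y = cnj c * herm x y"
  by (simp add: herm_def sum_distrib_left algebra_simps)

lemma herm_zero [simp]: "herm 0 y = 0" "herm x 0 = 0"
  by (simp_all add: herm_def)

lemma herm_sum_right: "herm x (\<Sum>j\<in>J. f j) = (\<Sum>j\<in>J. herm x (f j))"
  by (induction J rule: infinite_finite_induct) (simp_all add: herm_add_right)

lemma herm_sum_left: "herm (\<Sum>j\<in>J. f j) x = (\<Sum>j\<in>J. herm (f j) x)"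
  by (induction J rule: infinite_finite_induct) (simp_all add: herm_add_left)

lemma cnj_herm: "cnj (herm x y) = herm y x"
  by (simp add: herm_def algebra_simps)

lemma Re_herm: "Re (herm x y) = x \<bullet> y"
  by (simp add: herm_def inner_vec_def inner_complex_def)

lemma herm_self: "herm x x = complex_of_real ((norm x)\<^sup>2)"
proof (rule complex_eqI)
  show "Re (herm x x) = Re (complex_of_real ((norm x)\<^sup>2))"
    by (simp add: Re_herm power2_norm_eq_inner)
  have "cnj (herm x x) = herm x x" by (rule cnj_herm)
  then show "Im (herm x x) = Im (complex_of_real ((norm x)\<^sup>2))"
    by (simp add: complex_eq_iff)
qed

lemma of_real_scale: "complex_of_real r *s x = r *\<^sub>R x"
  by (simp add: vec_eq_iff scaleR_conv_of_real[where 'a = complex])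

lemma scale_left_sum: "(\<Sum>j\<in>J. c j *s (x::complex^'m)) = (\<Sum>j\<in>J. c j) *s x"
  by (induction J rule: infinite_finite_induct) (simp_all add: vector_sadd_rdistrib)

lemma scale_right_sum: "c *s (\<Sum>j\<in>J. f j) = (\<Sum>j\<in>J. c *s (f j :: complex^'m))"
  by (induction J rule: infinite_finite_induct) (simp_all add: vector_add_ldistrib)

lemma norm_scale: "norm (c *s (x::complex^'m)) = cmod c * norm x"
proof -
  have "complex_of_real ((norm (c *s x))\<^sup>2) = cnj c * c * complex_of_real ((norm x)\<^sup>2)"
    by (simp only: herm_self[symmetric] herm_scale_left herm_scale_right mult_ac)
  also have "\<dots> = complex_of_real ((cmod c * norm x)\<^sup>2)"
    by (simp add: mult.commute[of "cnj c"] complex_norm_square[symmetric] power_mult_distrib)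
  finally have "(norm (c *s x))\<^sup>2 = (cmod c * norm x)\<^sup>2"
    by (simp only: of_real_eq_iff)
  then show ?thesis by (simp add: power2_eq_iff_nonneg)
qed

text \<open>A phase applied to \<open>x\<close> makes the Hermitian product real and nonnegative, so
  that the Cauchy-Schwarz inequality of the real inner product applies.\<close>

lemma norm_herm_le: "cmod (herm x y) \<le> norm x * norm y"
proof (cases "herm x y = 0")
  case False
  define c where "c = sgn (herm x y)"
  have c: "cmod c = 1" using False by (simp add: c_def norm_sgn)
  have "herm (c *s x) y = complex_of_real (cmod (herm x y))"
    using False by (simp add: herm_scale_left c_def sgn_eq complex_norm_square[symmetric]
      mult.commute[of "cnj _"] power2_eq_square)
  then have "cmod (herm x y) = (c *s x) \<bullet> y"
    by (metis Re_herm Re_complex_of_real)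
  also have "\<dots> \<le> norm (c *s x) * norm y" by (rule norm_cauchy_schwarz)
  finally show ?thesis by (simp add: norm_scale c)
qed simp

section \<open>Gram matrices and the variational description of the top eigenvalue\<close>

definition hermitian :: "complex ^ 'm ^ 'm \<Rightarrow> bool" where
  "hermitian S \<longleftrightarrow> (\<forall>x y. herm x (S *v y) = herm (S *v x) y)"

lemma self_outer_mult: "self_outer x *v y = herm x y *s x"
  by (simp add: vec_eq_iff self_outer_def matrix_vector_mult_def herm_def sum_distrib_left
    sum_distrib_right algebra_simps)

lemma sum_matrix_mult: "(\<Sum>j\<in>J. S j) *v (y::complex^'m) = (\<Sum>j\<in>J. S j *v y)"
  by (induction J rule: infinite_finite_induct) (simp_all add: matrix_vector_mult_add_rdistrib)

lemma gram_mult: "(\<Sum>j\<in>J. self_outer (x j)) *v y = (\<Sum>j\<in>J. herm (x j) y *s x j)"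
  by (simp add: sum_matrix_mult self_outer_mult)

lemma hermitian_gram: "hermitian (\<Sum>j\<in>J. self_outer (x j))"
  unfolding hermitian_def
  by (simp add: gram_mult herm_sum_right herm_sum_left herm_scale_left herm_scale_right
      cnj_herm mult.commute)

lemma herm_gram: "herm y ((\<Sum>j\<in>J. self_outer (x j)) *v y)
    = complex_of_real (\<Sum>j\<in>J. (cmod (herm y (x j)))\<^sup>2)"
  by (simp add: gram_mult herm_sum_right herm_scale_right complex_norm_square cnj_herm mult.commute
      del: of_real_power)

lemma matrix_scaleR_mult: "(S *v (c *\<^sub>R x)) = c *\<^sub>R (S *v (x::complex^'m))"
  by (simp add: vec_eq_iff matrix_vector_mult_def scaleR_sum_right)

lemma linear_matrix_mult: "linear ((*v) (S::complex^'m^'m))"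
  by (rule linearI) (simp_all add: matrix_vector_right_distrib matrix_scaleR_mult)

lemma hermitian_inner: "hermitian S \<Longrightarrow> x \<bullet> (S *v y) = (S *v x) \<bullet> y"
  unfolding hermitian_def by (metis Re_herm)

text \<open>Maximize the quadratic form over the unit sphere. At a maximizer \<open>x\<close> the
  form of \<open>T = l - S\<close> is nonnegative and vanishes at \<open>x\<close>; moving from
  \<open>x\<close> against \<open>T x\<close> would make it negative unless
  \<open>T x = 0\<close>.\<close>

lemma hermitian_top_eigenpair:
  fixes S :: "complex ^ 'm ^ 'm"
  assumes S: "hermitian S"
  obtains x l where "norm x = 1" "S *v x = l *\<^sub>R x" "\<And>y. y \<bullet> (S *v y) \<le> l * (norm y)\<^sup>2"
proof -
  let ?q = "\<lambda>y. y \<bullet> (S *v y)"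
  have cont: "continuous_on (sphere 0 1) ?q"
    by (intro continuous_intros linear_continuous_on linear_matrix_mult[unfolded linear_conv_bounded_linear])
  have "norm (axis undefined 1 :: complex^'m) = 1" by (simp add: norm_axis_1)
  then have "sphere 0 1 \<noteq> ({} :: (complex^'m) set)" by (metis dist_0_norm empty_iff mem_sphere)
  from continuous_attains_sup[OF compact_sphere this cont]
  obtain x where x: "norm x = 1" and max: "\<And>y. norm y = 1 \<Longrightarrow> ?q y \<le> ?q x"
    by auto
  define l where "l = ?q x"
  have le: "?q y \<le> l * (norm y)\<^sup>2" for y
  proof (cases "y = 0")
    case False
    have "norm (y /\<^sub>R norm y) = 1" using False by simp
    then have "?q (y /\<^sub>R norm y) \<le> l" unfolding l_def by (rule max)
    then have "?q y / (norm y)\<^sup>2 \<le> l"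
      by (simp add: matrix_scaleR_mult power2_eq_square divide_simps)
    then show ?thesis using False by (simp add: field_simps)
  qed simp
  define T where "T y = l *\<^sub>R y - S *v y" for y
  have Tlin: "T (y + z) = T y + T z" "T (c *\<^sub>R y) = c *\<^sub>R T y" for y z c
    by (simp_all add: T_def matrix_vector_right_distrib matrix_scaleR_mult algebra_simps)
  have Tsym: "y \<bullet> T z = T y \<bullet> z" for y z
    using hermitian_inner[OF S, of y z] by (simp add: T_def inner_diff_left inner_diff_right)
  have Tpos: "y \<bullet> T y \<ge> 0" for y
    using le[of y] by (simp add: T_def inner_diff_right power2_norm_eq_inner)
  have Tx: "x \<bullet> T x = 0"
    using x by (simp add: T_def inner_diff_right l_def power2_norm_eq_inner[symmetric])
  define z where "z = T x"
  have "z \<bullet> z = 0"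
  proof (rule ccontr)
    assume "z \<bullet> z \<noteq> 0"
    then have zz: "z \<bullet> z > 0" by simp
    define d where "d = z \<bullet> T z"
    have d: "d \<ge> 0" unfolding d_def by (rule Tpos)
    \<comment> \<open>The step length is small enough that \<open>t * d\<close> is at most
      \<open>z \<bullet> z\<close>, whereas nonnegativity demands twice that; the \<open>+ 1\<close>
      covers \<open>d = 0\<close>.\<close>
    define t where "t = (z \<bullet> z) / (d + 1)"
    have t: "t > 0" using d zz by (simp add: t_def)
    have "0 \<le> (x - t *\<^sub>R z) \<bullet> T (x - t *\<^sub>R z)" by (rule Tpos)
    also have "\<dots> = (x + (-t) *\<^sub>R z) \<bullet> T (x + (-t) *\<^sub>R z)" by simp
    also have "\<dots> = x \<bullet> T x - 2 * t * (z \<bullet> z) + t\<^sup>2 * d"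
      unfolding Tlin inner_add_left inner_add_right inner_scaleR_left inner_scaleR_right
        Tsym[of x z] d_def z_def[symmetric]
      by (simp add: power2_eq_square algebra_simps)
    also have "\<dots> = t * (t * d - 2 * (z \<bullet> z))" by (simp add: Tx power2_eq_square algebra_simps)
    finally have "t * d \<ge> 2 * (z \<bullet> z)" using t by (simp add: zero_le_mult_iff)
    moreover have "t * d \<le> z \<bullet> z"
      using d zz by (simp add: t_def field_simps)
    ultimately show False using zz by linarith
  qed
  then have eig: "S *v x = l *\<^sub>R x" by (simp add: z_def T_def)
  show thesis by (rule that[OF x eig le])
qed

text \<open>Eigenvectors of distinct real eigenvalues are orthogonal, and a pairwise orthogonal set
  in a Euclidean space is finite. This makes the \<open>Max\<close> in
  \<open>largest_eigenvalue\<close> meaningful.\<close>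

lemma finite_eigenvalues:
  fixes S :: "complex ^ 'm ^ 'm"
  assumes S: "hermitian S"
  shows "finite {l. is_eigenvalue S (complex_of_real l)}" (is "finite ?E")
proof -
  have "\<forall>l\<in>?E. \<exists>x. x \<noteq> 0 \<and> S *v x = l *\<^sub>R x"
    by (simp add: is_eigenvalue_def of_real_scale)
  then obtain f where f: "\<And>l. l \<in> ?E \<Longrightarrow> f l \<noteq> 0 \<and> S *v f l = l *\<^sub>R f l"
    by metis
  have orth: "f k \<bullet> f l = 0" if "k \<in> ?E" "l \<in> ?E" "k \<noteq> l" for k l
    using hermitian_inner[OF S, of "f k" "f l"] f[OF that(1)] f[OF that(2)] that(3) by simp
  have "inj_on f ?E"
    using orth f by (metis (no_types, lifting) inj_onI inner_eq_zero_iff)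
  moreover have "finite (f ` ?E)"
    by (rule pairwise_orthogonal_imp_finite) (use orth in \<open>auto simp: pairwise_def orthogonal_def\<close>)
  ultimately show ?thesis by (simp add: finite_image_iff)
qed

lemma largest_eigenvalue_hermitian:
  fixes S :: "complex ^ 'm ^ 'm"
  assumes S: "hermitian S"
  shows "\<exists>x. norm x = 1 \<and> S *v x = largest_eigenvalue S *\<^sub>R x"
    and "y \<bullet> (S *v y) \<le> largest_eigenvalue S * (norm y)\<^sup>2"
proof -
  obtain x l where x: "norm x = 1" and l: "S *v x = l *\<^sub>R x"
    and le: "\<And>y. y \<bullet> (S *v y) \<le> l * (norm y)\<^sup>2"
    using hermitian_top_eigenpair[OF S] by blast
  have "largest_eigenvalue S = l"
    unfolding largest_eigenvalue_def
  proof (rule Max_eqI[OF finite_eigenvalues[OF S]])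
    show "l \<in> {l. is_eigenvalue S (complex_of_real l)}"
      using x l by (auto simp: is_eigenvalue_def of_real_scale intro!: exI[of _ x])
    fix k assume "k \<in> {l. is_eigenvalue S (complex_of_real l)}"
    then obtain z where "z \<noteq> 0" "S *v z = k *\<^sub>R z"
      by (auto simp: is_eigenvalue_def of_real_scale)
    with le[of z] show "k \<le> l" by (simp add: power2_norm_eq_inner)
  qed
  with x l le show "\<exists>x. norm x = 1 \<and> S *v x = largest_eigenvalue S *\<^sub>R x"
    and "y \<bullet> (S *v y) \<le> largest_eigenvalue S * (norm y)\<^sup>2" by auto
qed

text \<open>Turns a sublevel set of the eigenvalue into a family of conditions that are closed in
  \<open>y\<close>, which is what measurability needs later.\<close>

lemma largest_eigenvalue_le_iff:
  fixes S :: "complex ^ 'm ^ 'm"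
  assumes S: "hermitian S"
  shows "largest_eigenvalue S \<le> c \<longleftrightarrow> (\<forall>y. y \<bullet> (S *v y) \<le> c * (norm y)\<^sup>2)"
proof
  assume "largest_eigenvalue S \<le> c"
  then show "\<forall>y. y \<bullet> (S *v y) \<le> c * (norm y)\<^sup>2"
    using largest_eigenvalue_hermitian(2)[OF S]
    by (meson mult_right_mono order_trans zero_le_power2)
next
  obtain x where "norm x = 1" "S *v x = largest_eigenvalue S *\<^sub>R x"
    using largest_eigenvalue_hermitian(1)[OF S] by blast
  moreover assume "\<forall>y. y \<bullet> (S *v y) \<le> c * (norm y)\<^sup>2"
  ultimately show "largest_eigenvalue S \<le> c"
    by (metis inner_scaleR_right mult.right_neutral one_power2 power2_norm_eq_inner)
qed

section \<open>Expansion of the top eigenvalue\<close>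

lemma self_outer_scaleR: "self_outer (c *\<^sub>R x) = (c\<^sup>2) *\<^sub>R self_outer x"
  by (simp add: self_outer_def vec_eq_iff power2_eq_square)

lemma scaleR_matrix_mult: "(c *\<^sub>R S) *v (x::complex^'m) = c *\<^sub>R (S *v x)"
  by (simp add: vec_eq_iff matrix_vector_mult_def scaleR_sum_right)

text \<open>The two equations are the components of \<open>G *v x = l *\<^sub>R x\<close> along
  \<open>v\<close> and orthogonal to it, after scaling \<open>x\<close> so that its component along
  \<open>v\<close> is \<open>v\<close> itself. \<open>K\<close> is the trace of \<open>S\<close>, a
  convenient bound for its operator norm.\<close>

lemma top_eigenvalue_equations:
  fixes v :: "complex ^ 'm" and a :: "nat \<Rightarrow> complex" and V :: "nat \<Rightarrow> complex ^ 'm"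
    and l s \<sigma> :: real
  assumes v: "norm v = 1" and orth: "\<And>j. j < n \<Longrightarrow> herm v (V j) = 0"
  defines "al \<equiv> \<Sum>j<n. (cmod (a j))\<^sup>2" and "g \<equiv> \<Sum>j<n. cnj (a j) *s V j"
    and "S \<equiv> \<Sum>j<n. self_outer (V j)" and "K \<equiv> \<Sum>j<n. (norm (V j))\<^sup>2"
    and "G \<equiv> \<Sum>j<n. self_outer (complex_of_real s *s (a j *s v) + complex_of_real \<sigma> *s V j)"
  assumes x: "x \<noteq> 0" "G *v x = l *\<^sub>R x" and lK: "\<sigma>\<^sup>2 * K < l"
  obtains y where "complex_of_real l = complex_of_real (s\<^sup>2 * al) + complex_of_real (s * \<sigma>) * herm g y"
    and "l *\<^sub>R y = (s * \<sigma>) *\<^sub>R g + \<sigma>\<^sup>2 *\<^sub>R (S *v y)" 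
    and "\<And>y. norm (S *v y) \<le> K * norm y"
proof -
  have vv: "herm v v = 1" by (simp add: herm_self v)
  have orth': "herm (V j) v = 0" if "j < n" for j
    using orth[OF that] by (metis cnj_herm complex_cnj_zero)
  define X where "X j = complex_of_real s *s (a j *s v) + complex_of_real \<sigma> *s V j" for j
  define \<xi> where "\<xi> = herm v x"
  define y where "y = x - \<xi> *s v"
  have vy: "herm v y = 0" by (simp add: y_def herm_diff_right herm_scale_right vv \<xi>_def)
  have xy: "x = \<xi> *s v + y" by (simp add: y_def)
  have Xx: "herm (X j) x = s * cnj (a j) * \<xi> + \<sigma> * herm (V j) y" if "j < n" for j
    using orth'[OF that] orth[OF that] vy unfolding xy X_def
    by (simp add: herm_add_left herm_add_right herm_scale_left herm_scale_right vv)
  have G: "G *v x = (\<Sum>j<n. herm (X j) x *s X j)"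
    unfolding G_def gram_mult X_def ..
  have al: "complex_of_real al = (\<Sum>j<n. a j * cnj (a j))"
    unfolding al_def by (simp add: complex_norm_square del: of_real_power)
  have gy: "herm g z = (\<Sum>j<n. a j * herm (V j) z)" for z
    unfolding g_def by (simp add: herm_sum_left herm_scale_left)
  have Sy: "S *v z = (\<Sum>j<n. herm (V j) z *s V j)" for z
    unfolding S_def gram_mult ..
  have Sn: "norm (S *v z) \<le> K * norm z" for z
  proof -
    have "norm (S *v z) \<le> (\<Sum>j<n. norm (herm (V j) z *s V j))"
      unfolding Sy by (rule norm_sum)
    also have "\<dots> \<le> (\<Sum>j<n. (norm (V j) * norm z) * norm (V j))"
      unfolding norm_scale by (intro sum_mono mult_right_mono norm_herm_le) auto
    also have "\<dots> = K * norm z"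
      unfolding K_def by (simp add: power2_eq_square sum_distrib_left sum_distrib_right mult_ac)
    finally show ?thesis .
  qed
  have vX: "herm v (X j) = s * a j" if "j < n" for j
    using orth[OF that] by (simp add: X_def herm_add_right herm_scale_right vv)
  have "complex_of_real l * \<xi> = herm v (G *v x)"
    unfolding x(2) \<xi>_def of_real_scale[symmetric] herm_scale_right ..
  also have "\<dots> = (\<Sum>j<n. (s * cnj (a j) * \<xi> + \<sigma> * herm (V j) y) * (s * a j))"
    unfolding G herm_sum_right herm_scale_right by (intro sum.cong refl) (simp add: vX Xx)
  also have "\<dots> = complex_of_real (s\<^sup>2 * al) * \<xi> + complex_of_real (s * \<sigma>) * herm g y"
    unfolding of_real_mult al gy
    by (simp add: sum_distrib_left sum_distrib_right sum.distrib[symmetric] power2_eq_square algebra_simps)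
  finally have E1: "complex_of_real l * \<xi> = complex_of_real (s\<^sup>2 * al) * \<xi> + complex_of_real (s * \<sigma>) * herm g y" .
  have "complex_of_real l *s y = G *v x - herm v (G *v x) *s v"
    unfolding x(2) of_real_scale[symmetric] y_def \<xi>_def herm_scale_right
    by (simp add: vector_ssub_ldistrib vector_smult_assoc)
  also have "\<dots> = (\<Sum>j<n. herm (X j) x *s (X j - herm v (X j) *s v))"
    unfolding G herm_sum_right scale_left_sum[symmetric]
    by (simp add: sum_subtractf herm_scale_right vector_ssub_ldistrib vector_smult_assoc)
  also have "\<dots> = (\<Sum>j<n. (s * cnj (a j) * \<xi> + \<sigma> * herm (V j) y) *s (\<sigma> *s V j))"
  proof (intro sum.cong refl)
    fix j assume "j \<in> {..<n}"
    then have j: "j < n" by simp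
    have "X j - herm v (X j) *s v = \<sigma> *s V j"
      unfolding vX[OF j] by (simp add: X_def vector_smult_assoc)
    then show "herm (X j) x *s (X j - herm v (X j) *s v)
        = (s * cnj (a j) * \<xi> + \<sigma> * herm (V j) y) *s (\<sigma> *s V j)"
      by (simp only: Xx[OF j])
  qed
  also have "\<dots> = complex_of_real (s * \<sigma>) *s (\<xi> *s g) + complex_of_real (\<sigma>\<^sup>2) *s (S *v y)"
    unfolding g_def Sy
    by (simp add: scale_right_sum vector_smult_assoc vector_sadd_rdistrib sum.distrib
        power2_eq_square mult_ac distrib_left)
  finally have E2: "complex_of_real l *s y
      = complex_of_real (s * \<sigma>) *s (\<xi> *s g) + complex_of_real (\<sigma>\<^sup>2) *s (S *v y)" .
  \<comment> \<open>Scaling needs a nonzero component along \<open>v\<close>. An eigenvector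
    orthogonal to \<open>v\<close> would be one of \<open>\<sigma>\<^sup>2 *\<^sub>R S\<close>,
    whose eigenvalues are at most \<open>\<sigma>\<^sup>2 * K < l\<close>.\<close>
  have xi0: "\<xi> \<noteq> 0"
  proof
    assume 0: "\<xi> = 0"
    have "l *\<^sub>R y = \<sigma>\<^sup>2 *\<^sub>R (S *v y)"
      using E2 unfolding 0 of_real_scale by simp
    then have "\<bar>l\<bar> * norm y = \<sigma>\<^sup>2 * norm (S *v y)"
      by (metis abs_power2 norm_scaleR)
    also have "\<dots> \<le> \<sigma>\<^sup>2 * K * norm y"
      using mult_left_mono[OF Sn[of y], of "\<sigma>\<^sup>2"] by simp
    finally have "(l - \<sigma>\<^sup>2 * K) * norm y \<le> 0"
      using mult_right_mono[OF abs_ge_self[of l], of "norm y"] by (simp add: algebra_simps)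
    then have "norm y \<le> 0" using lK by (simp add: mult_le_0_iff)
    with x(1) 0 show False by (simp add: xy)
  qed
  define z where "z = inverse \<xi> *s y"
  have Sz: "S *v z = inverse \<xi> *s (S *v y)"
    unfolding z_def by (simp add: Sy herm_scale_right scale_right_sum vector_smult_assoc)
  show thesis
  proof
    show "complex_of_real l = complex_of_real (s\<^sup>2 * al) + complex_of_real (s * \<sigma>) * herm g z"
      using E1 xi0 unfolding z_def herm_scale_right by (simp add: field_simps)
    have "inverse \<xi> *s (complex_of_real l *s y) = inverse \<xi> *s (complex_of_real (s * \<sigma>) *s (\<xi> *s g) + complex_of_real (\<sigma>\<^sup>2) *s (S *v y))"
      unfolding E2 ..
    then have "complex_of_real l *s (inverse \<xi> *s y)
        = complex_of_real (s * \<sigma>) *s g + complex_of_real (\<sigma>\<^sup>2) *s (inverse \<xi> *s (S *v y))"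
      using xi0 by (simp add: vector_add_ldistrib vector_smult_assoc mult.commute[of "inverse \<xi>"]
          mult.assoc del: of_real_mult of_real_power)
    then show "l *\<^sub>R z = (s * \<sigma>) *\<^sub>R g + \<sigma>\<^sup>2 *\<^sub>R (S *v z)"
      unfolding of_real_scale Sz[symmetric] z_def[symmetric] .
  qed (rule Sn)
qed

text \<open>Pairing the equation for \<open>y\<close> with \<open>g\<close>, once directly and once
  after applying \<open>S\<close>, and substituting into the equation for \<open>l\<close> gives an
  implicit equation for \<open>l\<close> whose only remaining unknown is \<open>e\<close>. The bound
  on \<open>e\<close> carries another factor \<open>\<sigma>\<close>, so its term is of order
  \<open>\<sigma>^6\<close>. The smallness hypothesis keeps the noise below half of the
  signal.\<close>

lemma top_eigenvalue_fixed_point: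
  fixes v :: "complex ^ 'm" and a :: "nat \<Rightarrow> complex" and V :: "nat \<Rightarrow> complex ^ 'm"
    and lam \<sigma> :: real
  assumes v: "norm v = 1" and orth: "\<And>j. j < n \<Longrightarrow> herm v (V j) = 0"
    and lam: "lam > 0" and \<sigma>: "\<sigma> > 0"
  defines "al \<equiv> \<Sum>j<n. (cmod (a j))\<^sup>2" and "g \<equiv> \<Sum>j<n. cnj (a j) *s V j"
    and "K \<equiv> \<Sum>j<n. (norm (V j))\<^sup>2"
    and "s \<equiv> sqrt (lam + \<sigma>\<^sup>2)"
  defines "h \<equiv> \<Sum>j<n. (cmod (herm g (V j)))\<^sup>2"
  defines "l \<equiv> 2 * largest_eigenvalue (\<Sum>j<n. self_outer ((1 / sqrt 2) *\<^sub>R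
      (complex_of_real s *s (a j *s v) + complex_of_real \<sigma> *s V j)))"
  assumes al: "al > 0" and small: "\<sigma>\<^sup>2 * K \<le> lam * al / 2"
  obtains e where "\<bar>e\<bar> \<le> (norm g)\<^sup>2 * K\<^sup>2 * 2 * s * \<sigma> / (lam * al)"
    and "l = s\<^sup>2 * al + s\<^sup>2 * \<sigma>\<^sup>2 * (norm g)\<^sup>2 / l + s\<^sup>2 * \<sigma>^4 * h / l\<^sup>2 + s * \<sigma>^5 * e / l\<^sup>2"
    and "l \<ge> s\<^sup>2 * al"
proof -
  define X where "X j = complex_of_real s *s (a j *s v) + complex_of_real \<sigma> *s V j" for j
  define S where "S = (\<Sum>j<n. self_outer (V j))"
  define G where "G = (\<Sum>j<n. self_outer (X j))"
  define H where "H = (\<Sum>j<n. self_outer ((1 / sqrt 2) *\<^sub>R X j))"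
  \<comment> \<open>The factor 1 / sqrt 2 on the sample halves the Gram matrix; doubling the
    eigenvalue in \<open>l\<close> undoes this.\<close>
  have HG: "H = (1/2) *\<^sub>R G"
    unfolding H_def G_def self_outer_scaleR by (simp add: scaleR_sum_right power_divide)
  have hH: "hermitian H" unfolding H_def by (rule hermitian_gram)
  have l: "l = 2 * largest_eigenvalue H" unfolding l_def H_def X_def ..
  obtain x where x: "norm x = 1" "H *v x = largest_eigenvalue H *\<^sub>R x"
    using largest_eigenvalue_hermitian(1)[OF hH] by blast
  have Gx: "G *v x = l *\<^sub>R x"
  proof -
    have "G *v x = 2 *\<^sub>R (H *v x)" by (simp add: HG scaleR_matrix_mult)
    then show ?thesis by (simp add: x l)
  qed
  have s2: "s\<^sup>2 = lam + \<sigma>\<^sup>2" using lam by (simp add: s_def)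
  have s0: "s > 0" using lam \<sigma> by (simp add: s_def add_pos_pos)
  \<comment> \<open>Test vector \<open>v\<close> in the variational bound.\<close>
  have ge: "l \<ge> s\<^sup>2 * al"
  proof -
    have vX: "herm v (X j) = s * a j" if "j < n" for j
      using orth[OF that] by (simp add: X_def herm_add_right herm_scale_right herm_self v)
    have "v \<bullet> (G *v v) = (\<Sum>j<n. (cmod (herm v (X j)))\<^sup>2)"
      unfolding G_def Re_herm[symmetric] herm_gram by simp
    also have "\<dots> = s\<^sup>2 * al"
      unfolding al_def sum_distrib_left
      by (intro sum.cong refl) (use s0 in \<open>simp add: vX norm_mult power_mult_distrib\<close>)
    finally have "v \<bullet> (G *v v) = s\<^sup>2 * al" .
    moreover have "v \<bullet> (H *v v) \<le> largest_eigenvalue H"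
      using largest_eigenvalue_hermitian(2)[OF hH, of v] v by simp
    ultimately show ?thesis unfolding HG l by (simp add: scaleR_matrix_mult)
  qed
  have lal: "s\<^sup>2 * al \<ge> lam * al" using al by (simp add: s2)
  have pos: "lam * al > 0" using lam al by simp
  have l0: "l > 0" using ge lal pos by linarith
  have x0: "x \<noteq> 0" using x by auto
  have lK: "\<sigma>\<^sup>2 * K < l" using small ge lal pos by linarith
  obtain y where y1: "complex_of_real l = complex_of_real (s\<^sup>2 * al) + complex_of_real (s * \<sigma>) * herm g y"
    and y2: "l *\<^sub>R y = (s * \<sigma>) *\<^sub>R g + \<sigma>\<^sup>2 *\<^sub>R (S *v y)" 
    and Sn: "\<And>y. norm (S *v y) \<le> K * norm y"
    using top_eigenvalue_equations[OF v orth x0 Gx[unfolded G_def X_def] lK[unfolded K_def]]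
    unfolding al_def[symmetric] g_def[symmetric] S_def[symmetric] K_def[symmetric] by blast
  have K0: "K \<ge> 0" unfolding K_def by (intro sum_nonneg) auto
  \<comment> \<open>The term with \<open>S *v y\<close> is absorbed: it costs at most half of
    \<open>lam * al\<close>, while the left side has at least all of it. This is the origin of the
    factor 2.\<close>
  have yn: "norm y \<le> 2 * s * \<sigma> * norm g / (lam * al)"
  proof -
    have "l * norm y = norm (l *\<^sub>R y)" using l0 by simp
    also have "\<dots> \<le> s * \<sigma> * norm g + \<sigma>\<^sup>2 * norm (S *v y)"
      unfolding y2 using norm_triangle_ineq[of "(s * \<sigma>) *\<^sub>R g" "\<sigma>\<^sup>2 *\<^sub>R (S *v y)"] s0 \<sigma> by simp
    also have "\<dots> \<le> s * \<sigma> * norm g + \<sigma>\<^sup>2 * K * norm y"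
      using mult_left_mono[OF Sn[of y], of "\<sigma>\<^sup>2"] by simp
    also have "\<dots> \<le> s * \<sigma> * norm g + (lam * al / 2) * norm y"
      using mult_right_mono[OF small, of "norm y"] by simp
    finally have "l * norm y \<le> s * \<sigma> * norm g + (lam * al / 2) * norm y" .
    moreover have "lam * al * norm y \<le> l * norm y"
      using ge lal by (intro mult_right_mono) auto
    ultimately have "(lam * al) * norm y \<le> 2 * s * \<sigma> * norm g" by simp
    then show ?thesis using pos by (simp add: field_simps)
  qed
  \<comment> \<open>The remainder after two substitutions, with the still unknown \<open>y\<close>
    inside; only its size matters.\<close>
  define e where "e = g \<bullet> (S *v (S *v y))"
  have hgS: "g \<bullet> (S *v g) = h"
    unfolding S_def h_def Re_herm[symmetric] herm_gram by simp
  have Re1: "l = s\<^sup>2 * al + s * \<sigma> * (g \<bullet> y)"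
    using arg_cong[OF y1, of Re] by (simp add: Re_herm)
  have Re2: "l * (g \<bullet> y) = s * \<sigma> * (norm g)\<^sup>2 + \<sigma>\<^sup>2 * (g \<bullet> (S *v y))"
    using arg_cong[OF y2, of "\<lambda>z. g \<bullet> z"] by (simp add: inner_add_right power2_norm_eq_inner)
  have "l *\<^sub>R (S *v y) = (s * \<sigma>) *\<^sub>R (S *v g) + \<sigma>\<^sup>2 *\<^sub>R (S *v (S *v y))"
    using arg_cong[OF y2, of "\<lambda>z. S *v z"] by (simp add: matrix_vector_right_distrib matrix_scaleR_mult)
  from arg_cong[OF this, of "\<lambda>z. g \<bullet> z"]
  have Re3: "l * (g \<bullet> (S *v y)) = s * \<sigma> * h + \<sigma>\<^sup>2 * e"
    by (simp add: inner_add_right hgS e_def)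
  have r3: "g \<bullet> (S *v y) = (s * \<sigma> * h + \<sigma>\<^sup>2 * e) / l" using Re3 l0 by (simp add: field_simps)
  have r2: "g \<bullet> y = (s * \<sigma> * (norm g)\<^sup>2 + \<sigma>\<^sup>2 * (g \<bullet> (S *v y))) / l"
    using Re2 l0 by (simp add: field_simps)
  show thesis
  proof
    have "\<bar>e\<bar> \<le> norm g * norm (S *v (S *v y))" unfolding e_def by (rule Cauchy_Schwarz_ineq2)
    also have "\<dots> \<le> norm g * (K * (K * norm y))"
      by (intro mult_left_mono order_trans[OF Sn] Sn K0 norm_ge_zero)
    also have "\<dots> \<le> norm g * (K * (K * (2 * s * \<sigma> * norm g / (lam * al))))"
      by (intro mult_left_mono yn K0 norm_ge_zero)
    finally show "\<bar>e\<bar> \<le> (norm g)\<^sup>2 * K\<^sup>2 * 2 * s * \<sigma> / (lam * al)"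
      by (simp add: power2_eq_square mult_ac)
    show "l = s\<^sup>2 * al + s\<^sup>2 * \<sigma>\<^sup>2 * (norm g)\<^sup>2 / l + s\<^sup>2 * \<sigma>^4 * h / l\<^sup>2 + s * \<sigma>^5 * e / l\<^sup>2"
      apply (subst Re1)
      unfolding r2 r3 using l0
      by (simp add: field_simps power2_eq_square eval_nat_numeral)
  qed (rule ge)
qed

text \<open>The implicit equation is bootstrapped: the lower bound on \<open>l\<close> gives
  convergence of \<open>l\<close>, then the limit of the coefficient of
  \<open>\<sigma>\<^sup>2\<close>, and finally the coefficient at order 4. The correction
  \<open>- p\<^sup>2 / al\<close> comes from the first-order change of \<open>l\<close> in the
  denominator of \<open>p / l\<close>.\<close>

lemma fixed_point_expansion:
  fixes l :: "real \<Rightarrow> real" and lam al p h k c :: real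
  assumes lam: "lam > 0" and al: "al > 0"
    and ev: "\<forall>\<^sub>F \<sigma> in at_right 0. \<exists>e. \<bar>e\<bar> \<le> c * sqrt (lam + \<sigma>\<^sup>2) * \<sigma> \<and>
      l \<sigma> = (lam + \<sigma>\<^sup>2) * al + (lam + \<sigma>\<^sup>2) * \<sigma>\<^sup>2 * p / l \<sigma> + (lam + \<sigma>\<^sup>2) * \<sigma>^4 * h / (l \<sigma>)\<^sup>2
          + sqrt (lam + \<sigma>\<^sup>2) * \<sigma>^5 * e / (l \<sigma>)\<^sup>2 \<and> l \<sigma> \<ge> (lam + \<sigma>\<^sup>2) * al"
  shows "((\<lambda>\<sigma>. (l \<sigma> - ((lam + \<sigma>\<^sup>2) * al + \<sigma>\<^sup>2 * (p / al)
        + \<sigma>^4 / (lam + \<sigma>\<^sup>2) * ((h - p\<^sup>2 / al) / al\<^sup>2))) / \<sigma>^4) \<longlongrightarrow> 0) (at_right 0)"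
proof -
  have pos: "lam * al > 0" using lam al by simp
  have e0: "\<forall>\<^sub>F \<sigma>::real in at_right 0. \<sigma> > 0" by (simp add: eventually_at_right_less)
  \<comment> \<open>Here \<open>s\<close> stands for \<open>lam + \<sigma>\<^sup>2\<close> itself,
    not for its square root.\<close>
  define s where "s \<sigma> = lam + \<sigma>\<^sup>2" for \<sigma>
  have sT: "(s \<longlongrightarrow> lam) (at_right 0)" unfolding s_def by (rule tendsto_eq_intros | simp)+
  have sig: "((\<lambda>\<sigma>::real. \<sigma>) \<longlongrightarrow> 0) (at_right 0)" by (rule tendsto_ident_at)
  have "\<forall>\<^sub>F \<sigma> in at_right 0. \<exists>w. \<bar>w\<bar> \<le> c * s \<sigma> * \<sigma>\<^sup>2 / (lam * al)\<^sup>2 \<and>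
      l \<sigma> = s \<sigma> * al + s \<sigma> * \<sigma>\<^sup>2 * p / l \<sigma> + s \<sigma> * \<sigma>^4 * h / (l \<sigma>)\<^sup>2 + \<sigma>^4 * w \<and> l \<sigma> \<ge> lam * al"
    using ev e0
  proof eventually_elim
    case (elim \<sigma>)
    then obtain e where e: "\<bar>e\<bar> \<le> c * sqrt (s \<sigma>) * \<sigma>"
      "l \<sigma> = s \<sigma> * al + s \<sigma> * \<sigma>\<^sup>2 * p / l \<sigma> + s \<sigma> * \<sigma>^4 * h / (l \<sigma>)\<^sup>2
          + sqrt (s \<sigma>) * \<sigma>^5 * e / (l \<sigma>)\<^sup>2" "l \<sigma> \<ge> s \<sigma> * al" 
      by (auto simp: s_def)
    have "s \<sigma> * al \<ge> lam * al" using al by (simp add: s_def)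
    then have ge: "l \<sigma> \<ge> lam * al" using e(3) by linarith
    have lp: "l \<sigma> > 0" using ge pos by linarith
    have sp: "s \<sigma> \<ge> 0" using lam by (simp add: s_def)
    let ?w = "sqrt (s \<sigma>) * \<sigma> * e / (l \<sigma>)\<^sup>2"
    have "0 \<le> c * sqrt (s \<sigma>) * \<sigma>" using e(1) by linarith
    then have num: "0 \<le> sqrt (s \<sigma>) * \<sigma> * (c * sqrt (s \<sigma>) * \<sigma>)"
      by (rule mult_nonneg_nonneg[rotated]) (use sp elim in simp)
    have "\<bar>?w\<bar> = sqrt (s \<sigma>) * \<sigma> * \<bar>e\<bar> / (l \<sigma>)\<^sup>2"
      using sp elim by (simp add: abs_mult)
    also have "\<dots> \<le> sqrt (s \<sigma>) * \<sigma> * (c * sqrt (s \<sigma>) * \<sigma>) / (l \<sigma>)\<^sup>2"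
      using sp elim by (intro divide_right_mono mult_left_mono e(1)) auto
    also have "\<dots> \<le> sqrt (s \<sigma>) * \<sigma> * (c * sqrt (s \<sigma>) * \<sigma>) / (lam * al)\<^sup>2"
      using pos lam al ge num lp by (intro divide_left_mono power_mono mult_pos_pos zero_less_power) auto
    also have "\<dots> = c * s \<sigma> * \<sigma>\<^sup>2 / (lam * al)\<^sup>2"
      using sp by (simp add: power2_eq_square mult_ac)
    finally have "\<bar>?w\<bar> \<le> c * s \<sigma> * \<sigma>\<^sup>2 / (lam * al)\<^sup>2" .
    moreover have "sqrt (s \<sigma>) * \<sigma>^5 * e / (l \<sigma>)\<^sup>2 = \<sigma>^4 * ?w"
      by (simp add: eval_nat_numeral)
    ultimately show ?case using e(2) ge by metis
  qed
  \<comment> \<open>The error becomes a function of \<open>\<sigma>\<close>, normalized so that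
    \<open>\<sigma>^4 * w \<sigma>\<close> is the last term and \<open>w\<close> tends to 0.\<close>
  then obtain w where w: "\<forall>\<^sub>F \<sigma> in at_right 0. \<bar>w \<sigma>\<bar> \<le> c * s \<sigma> * \<sigma>\<^sup>2 / (lam * al)\<^sup>2 \<and>
      l \<sigma> = s \<sigma> * al + s \<sigma> * \<sigma>\<^sup>2 * p / l \<sigma> + s \<sigma> * \<sigma>^4 * h / (l \<sigma>)\<^sup>2 + \<sigma>^4 * w \<sigma> \<and> l \<sigma> \<ge> lam * al"
    unfolding eventually_ex by blast
  have wT: "(w \<longlongrightarrow> 0) (at_right 0)"
  proof (rule Lim_null_comparison)
    show "\<forall>\<^sub>F \<sigma> in at_right 0. norm (w \<sigma>) \<le> c * s \<sigma> * \<sigma>\<^sup>2 / (lam * al)\<^sup>2"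
      using w by eventually_elim auto
    show "((\<lambda>\<sigma>. c * s \<sigma> * \<sigma>\<^sup>2 / (lam * al)\<^sup>2) \<longlongrightarrow> 0) (at_right 0)"
      using pos lam al by (auto intro!: tendsto_eq_intros sT)
  qed
  have bdd: "\<forall>\<^sub>F \<sigma> in at_right 0. \<bar>l \<sigma> - s \<sigma> * al\<bar> \<le> s \<sigma> * \<sigma>\<^sup>2 * \<bar>p\<bar> / (lam * al)
      + s \<sigma> * \<sigma>^4 * \<bar>h\<bar> / (lam * al)\<^sup>2 + \<sigma>^4 * \<bar>w \<sigma>\<bar>"
    using w e0
  proof eventually_elim
    case (elim \<sigma>)
    have ge: "lam * al \<le> l \<sigma>" using elim by simp
    have lp: "0 < l \<sigma>" using ge pos by linarith
    have sp: "s \<sigma> \<ge> 0" using lam by (simp add: s_def)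
    have "\<bar>l \<sigma> - s \<sigma> * al\<bar> = \<bar>s \<sigma> * \<sigma>\<^sup>2 * p / l \<sigma> + s \<sigma> * \<sigma>^4 * h / (l \<sigma>)\<^sup>2 + \<sigma>^4 * w \<sigma>\<bar>"
      using elim by linarith
    also have "\<dots> \<le> \<bar>s \<sigma> * \<sigma>\<^sup>2 * p / l \<sigma>\<bar> + \<bar>s \<sigma> * \<sigma>^4 * h / (l \<sigma>)\<^sup>2\<bar> + \<bar>\<sigma>^4 * w \<sigma>\<bar>" by linarith
    also have "\<dots> = s \<sigma> * \<sigma>\<^sup>2 * \<bar>p\<bar> / l \<sigma> + s \<sigma> * \<sigma>^4 * \<bar>h\<bar> / (l \<sigma>)\<^sup>2 + \<sigma>^4 * \<bar>w \<sigma>\<bar>"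
      using sp lp by (simp add: abs_mult)
    also have "\<dots> \<le> s \<sigma> * \<sigma>\<^sup>2 * \<bar>p\<bar> / (lam * al) + s \<sigma> * \<sigma>^4 * \<bar>h\<bar> / (lam * al)\<^sup>2 + \<sigma>^4 * \<bar>w \<sigma>\<bar>"
      using sp lp lam al ge
      by (intro add_mono divide_left_mono power_mono mult_nonneg_nonneg mult_pos_pos zero_less_power order_refl) auto
    finally show ?case .
  qed
  have "((\<lambda>\<sigma>. l \<sigma> - s \<sigma> * al) \<longlongrightarrow> 0) (at_right 0)"
  proof (rule Lim_null_comparison)
    show "\<forall>\<^sub>F \<sigma> in at_right 0. norm (l \<sigma> - s \<sigma> * al) \<le> s \<sigma> * \<sigma>\<^sup>2 * \<bar>p\<bar> / (lam * al)
      + s \<sigma> * \<sigma>^4 * \<bar>h\<bar> / (lam * al)\<^sup>2 + \<sigma>^4 * \<bar>w \<sigma>\<bar>" using bdd by simp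
    show "((\<lambda>\<sigma>. s \<sigma> * \<sigma>\<^sup>2 * \<bar>p\<bar> / (lam * al)
      + s \<sigma> * \<sigma>^4 * \<bar>h\<bar> / (lam * al)\<^sup>2 + \<sigma>^4 * \<bar>w \<sigma>\<bar>) \<longlongrightarrow> 0) (at_right 0)"
      using pos lam al by (auto intro!: tendsto_eq_intros sT wT)
  qed
  from tendsto_add[OF this tendsto_mult[OF sT tendsto_const[of al]]]
  have lT: "(l \<longlongrightarrow> lam * al) (at_right 0)" by simp
  \<comment> \<open>The exact quotient of \<open>l \<sigma> - s \<sigma> * al\<close> by
    \<open>\<sigma>\<^sup>2\<close>, written without dividing by \<open>\<sigma>\<close>.\<close>
  define \<delta> where "\<delta> \<sigma> = s \<sigma> * p / l \<sigma> + s \<sigma> * \<sigma>\<^sup>2 * h / (l \<sigma>)\<^sup>2 + \<sigma>\<^sup>2 * w \<sigma>" for \<sigma>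
  have dT: "(\<delta> \<longlongrightarrow> p / al) (at_right 0)"
    unfolding \<delta>_def using lam al by (auto intro!: tendsto_eq_intros sT wT lT)
  let ?r = "\<lambda>\<sigma>. - p * \<delta> \<sigma> / (l \<sigma> * al) + s \<sigma> * h / (l \<sigma>)\<^sup>2 + w \<sigma>
      - (h - p\<^sup>2 / al) / al\<^sup>2 / s \<sigma>"
  have "(?r \<longlongrightarrow> - p * (p / al) / (lam * al * al) + lam * h / (lam * al)\<^sup>2 + 0
      - (h - p\<^sup>2 / al) / al\<^sup>2 / lam) (at_right 0)"
    using lam al by (intro tendsto_intros sT wT lT dT) auto
  moreover have "- p * (p / al) / (lam * al * al) + lam * h / (lam * al)\<^sup>2 + 0
      - (h - p\<^sup>2 / al) / al\<^sup>2 / lam = 0"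
    using lam al by (simp add: field_simps power2_eq_square)
  ultimately have rT: "(?r \<longlongrightarrow> 0) (at_right 0)" by simp
  have "\<forall>\<^sub>F \<sigma> in at_right 0. ?r \<sigma> = (l \<sigma> - (s \<sigma> * al + \<sigma>\<^sup>2 * (p / al)
        + \<sigma>^4 / s \<sigma> * ((h - p\<^sup>2 / al) / al\<^sup>2))) / \<sigma>^4"
    using w e0
  proof eventually_elim
    case (elim \<sigma>)
    have lp: "l \<sigma> > 0" using elim pos by linarith
    have sp: "s \<sigma> > 0" using lam by (simp add: s_def add_pos_nonneg)
    have eq: "l \<sigma> = s \<sigma> * al + \<sigma>\<^sup>2 * \<delta> \<sigma>"
      using elim by (simp add: \<delta>_def algebra_simps power_numeral_reduce)
    have d2: "\<delta> \<sigma> - p / al = \<sigma>\<^sup>2 * (- p * \<delta> \<sigma> / (l \<sigma> * al) + s \<sigma> * h / (l \<sigma>)\<^sup>2 + w \<sigma>)"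
    proof -
      \<comment> \<open>Comparing \<open>s \<sigma> / l \<sigma>\<close> with its limit
        \<open>1 / al\<close> exposes the deviation
        \<open>\<sigma>\<^sup>2 * \<delta> \<sigma>\<close> of \<open>l\<close>, so that a factor
        \<open>\<sigma>\<^sup>2\<close> splits off exactly.\<close>
      have d1: "s \<sigma> * p / l \<sigma> - p / al = - p * (\<sigma>\<^sup>2 * \<delta> \<sigma>) / (l \<sigma> * al)"
      proof -
        have "\<sigma>\<^sup>2 * \<delta> \<sigma> = l \<sigma> - s \<sigma> * al" using eq by linarith
        moreover have "s \<sigma> * p / l \<sigma> - p / al = - p * (l \<sigma> - s \<sigma> * al) / (l \<sigma> * al)"
          using lp al by (simp add: field_simps)
        ultimately show ?thesis by simp
      qed
      have "\<delta> \<sigma> - p / al = (s \<sigma> * p / l \<sigma> - p / al) + \<sigma>\<^sup>2 * (s \<sigma> * h / (l \<sigma>)\<^sup>2 + w \<sigma>)"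
        unfolding \<delta>_def by (simp add: algebra_simps)
      then show ?thesis unfolding d1 by (simp add: algebra_simps)
    qed
    have "l \<sigma> - (s \<sigma> * al + \<sigma>\<^sup>2 * (p / al) + \<sigma>^4 / s \<sigma> * ((h - p\<^sup>2 / al) / al\<^sup>2))
      = \<sigma>\<^sup>2 * (\<delta> \<sigma> - p / al) - \<sigma>^4 * ((h - p\<^sup>2 / al) / al\<^sup>2 / s \<sigma>)"
      by (subst eq) (simp add: algebra_simps)
    also have "\<dots> = \<sigma>^4 * ?r \<sigma>"
      unfolding d2 by (simp add: algebra_simps power_numeral_reduce)
    finally show ?case using elim by simp
  qed
  from Lim_transform_eventually[OF rT this] show ?thesis unfolding s_def .
qed

text \<open>For fixed data the smallness hypothesis holds for all small \<open>\<sigma>\<close>, and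
  the constant in the bound on \<open>e\<close> is free of \<open>\<sigma>\<close>. No uniformity
  over outcomes is claimed.\<close>

lemma largest_eigenvalue_expansion:
  fixes v :: "complex ^ 'm" and a :: "nat \<Rightarrow> complex" and V :: "nat \<Rightarrow> complex ^ 'm"
    and lam :: real
  assumes v: "norm v = 1" and orth: "\<And>j. j < n \<Longrightarrow> herm v (V j) = 0"
    and lam: "lam > 0"
  defines "al \<equiv> \<Sum>j<n. (cmod (a j))\<^sup>2" and "g \<equiv> \<Sum>j<n. cnj (a j) *s V j"
  defines "h \<equiv> \<Sum>j<n. (cmod (herm g (V j)))\<^sup>2"
  assumes al: "al > 0"
  shows "((\<lambda>\<sigma>. (2 * largest_eigenvalue (\<Sum>j<n. self_outer ((1 / sqrt 2) *\<^sub>R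
        (complex_of_real (sqrt (lam + \<sigma>\<^sup>2)) *s (a j *s v) + complex_of_real \<sigma> *s V j)))
      - ((lam + \<sigma>\<^sup>2) * al + \<sigma>\<^sup>2 * ((norm g)\<^sup>2 / al)
        + \<sigma>^4 / (lam + \<sigma>\<^sup>2) * ((h - ((norm g)\<^sup>2)\<^sup>2 / al) / al\<^sup>2))) / \<sigma>^4) \<longlongrightarrow> 0) (at_right 0)"
proof (rule fixed_point_expansion[OF lam al, where c = "(norm g)\<^sup>2 * (\<Sum>j<n. (norm (V j))\<^sup>2)\<^sup>2 * 2 / (lam * al)"])
  let ?K = "\<Sum>j<n. (norm (V j))\<^sup>2"
  let ?l = "\<lambda>\<sigma>. 2 * largest_eigenvalue (\<Sum>j<n. self_outer ((1 / sqrt 2) *\<^sub>R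
        (complex_of_real (sqrt (lam + \<sigma>\<^sup>2)) *s (a j *s v) + complex_of_real \<sigma> *s V j)))"
  have "((\<lambda>\<sigma>. \<sigma>\<^sup>2 * ?K) \<longlongrightarrow> 0) (at_right 0)" by (rule tendsto_eq_intros | simp)+
  then have "\<forall>\<^sub>F \<sigma> in at_right 0. \<sigma>\<^sup>2 * ?K < lam * al / 2"
    by (rule order_tendstoD) (use lam al in simp)
  moreover have "\<forall>\<^sub>F \<sigma>::real in at_right 0. \<sigma> > 0" by (simp add: eventually_at_right_less)
  ultimately show "\<forall>\<^sub>F \<sigma> in at_right 0. \<exists>e. \<bar>e\<bar> \<le> (norm g)\<^sup>2 * ?K\<^sup>2 * 2 / (lam * al) * sqrt (lam + \<sigma>\<^sup>2) * \<sigma> \<and>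
      ?l \<sigma> = (lam + \<sigma>\<^sup>2) * al + (lam + \<sigma>\<^sup>2) * \<sigma>\<^sup>2 * (norm g)\<^sup>2 / ?l \<sigma> + (lam + \<sigma>\<^sup>2) * \<sigma>^4 * h / (?l \<sigma>)\<^sup>2
          + sqrt (lam + \<sigma>\<^sup>2) * \<sigma>^5 * e / (?l \<sigma>)\<^sup>2 \<and> ?l \<sigma> \<ge> (lam + \<sigma>\<^sup>2) * al"
  proof eventually_elim
    case (elim \<sigma>)
    have sq: "(sqrt (lam + \<sigma>\<^sup>2))\<^sup>2 = lam + \<sigma>\<^sup>2" using lam by simp
    show ?case
      using top_eigenvalue_fixed_point[OF v orth lam elim(2) al[unfolded al_def]
          less_imp_le[OF elim(1)[unfolded al_def]]]
      unfolding sq al_def[symmetric] g_def[symmetric] h_def[symmetric]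
      by (metis (no_types, lifting) times_divide_eq_left)
  qed
qed

section \<open>A unitary map adapted to the signal direction\<close>

lemma herm_axis: "herm (axis i 1) x = x $ i"
  unfolding herm_def
  by (subst sum.remove[of _ i]) (auto simp: axis_def intro!: sum.neutral)

lemma self_outer_scale: "cmod c = 1 \<Longrightarrow> self_outer (c *s x) = self_outer x"
proof -
  assume c: "cmod c = 1"
  then have "c * cnj c = 1" by (simp add: complex_norm_square[symmetric])
  then have "c * a * (cnj c * b) = a * b" for a b
    by (metis (no_types, lifting) mult.assoc mult.commute mult_1)
  then show ?thesis by (simp add: self_outer_def vec_eq_iff)
qed

text \<open>A Householder reflection exchanges two unit vectors only if their Hermitian product is real;
  the phase \<open>c\<close> makes that of \<open>axis k 1\<close> and \<open>c *s v\<close> real.\<close>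
lemma unitary_sending_axis:
  fixes v :: "complex ^ 'm"
  assumes v: "norm v = 1"
  obtains Q :: "complex ^ 'm \<Rightarrow> complex ^ 'm" and c
  where "cmod c = 1" "Q (axis k 1) = c *s v"
    "\<And>x y. Q (x + y) = Q x + Q y" "\<And>a x. Q (a *s x) = a *s Q x"
    "\<And>x y. herm (Q x) (Q y) = herm x y"
    "(\<Sum>i\<in>UNIV. self_outer (Q (axis i 1))) = mat 1"
proof -
  define c where "c = (if v $ k = 0 then 1 else cnj (sgn (v $ k)))"
  define r where "r = cmod (v $ k)"
  have c: "cmod c = 1" by (simp add: c_def norm_sgn)
  have ck: "c * v $ k = r"
    by (simp add: c_def r_def sgn_eq complex_norm_square[symmetric] mult.commute[of "cnj _"]
        power2_eq_square)
  let ?e = "axis k 1 :: complex ^ 'm"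
  define w where "w = c *s v - ?e"
  define d where "d = herm w w"
  have ee: "herm ?e ?e = 1" by (simp add: herm_axis)
  have vv: "herm (c *s v) (c *s v) = 1" by (simp add: herm_self norm_scale c v)
  have ve: "herm (c *s v) ?e = r" "herm ?e (c *s v) = r"
    using cnj_herm[of ?e "c *s v"] by (simp_all add: herm_axis ck)
  have d: "d = 2 - 2 * r"
    by (simp add: d_def w_def herm_diff_left herm_diff_right ee vv ve)
  have we: "herm w ?e = r - 1"
    by (simp add: w_def herm_diff_left ee ve)
  have d0: "d = 0 \<Longrightarrow> w = 0" by (simp add: d_def herm_self)
  have cd: "cnj d = d" by (simp add: d)
  \<comment> \<open>If \<open>c *s v\<close> is already the axis vector, then \<open>w = 0\<close>
    and the convention for division by zero makes \<open>Q\<close> the identity, as wanted.\<close>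
  define Q where "Q x = x - (2 * herm w x / d) *s w" for x
  have Qe: "Q ?e = c *s v"
  proof (cases "d = 0")
    case True
    then show ?thesis using d0[OF True] by (simp add: Q_def w_def)
  next
    case False
    then have "2 * herm w ?e / d = -1" unfolding we using d by (simp add: divide_simps)
    then show ?thesis by (simp add: Q_def w_def vec_eq_iff)
  qed
  have add: "Q (x + y) = Q x + Q y" for x y
    by (simp add: Q_def herm_add_right distrib_left add_divide_distrib vector_sadd_rdistrib)
  have scale: "Q (a *s x) = a *s Q x" for a x
    by (simp add: Q_def herm_scale_right vector_ssub_ldistrib vector_smult_assoc mult_ac)
  have iso: "herm (Q x) (Q y) = herm x y" for x y
  proof (cases "d = 0")
    case True
    then show ?thesis by (simp add: Q_def)
  next
    case False
    have xw: "cnj (herm w x) = herm x w" by (rule cnj_herm)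
    show ?thesis using False
      by (simp add: Q_def herm_diff_left herm_diff_right herm_scale_left herm_scale_right
          d_def[symmetric] cd xw field_simps)
  qed
  have inv: "Q (Q x) = x" for x
  proof (cases "d = 0")
    case True
    then show ?thesis by (simp add: Q_def)
  next
    case False
    have "herm w (Q x) = - herm w x"
      using False by (simp add: Q_def herm_diff_right herm_scale_right d_def[symmetric])
    then show ?thesis unfolding Q_def[of "Q x"] by (simp add: Q_def vec_eq_iff)
  qed
  have sumQ: "Q (\<Sum>i\<in>A. f i) = (\<Sum>i\<in>A. Q (f i))" for f :: "'m \<Rightarrow> complex^'m" and A
    by (induction A rule: infinite_finite_induct) (simp_all add: add, simp_all add: Q_def)
  \<comment> \<open>Completeness of the image basis: since \<open>Q\<close> is an involution,
    \<open>y = Q (Q y)\<close>, and the isometry property turns the coefficients of \<open>y\<close>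
    in the image basis into the coordinates of \<open>Q y\<close>.\<close>
  have "(\<Sum>i\<in>UNIV. self_outer (Q (axis i 1))) *v y = mat 1 *v y" for y
  proof -
    have "(\<Sum>i\<in>UNIV. self_outer (Q (axis i 1))) *v y
        = (\<Sum>i\<in>UNIV. herm (Q (axis i 1)) (Q (Q y)) *s Q (axis i 1))"
      unfolding gram_mult inv ..
    also have "\<dots> = Q (\<Sum>i\<in>UNIV. (Q y $ i) *s axis i 1)"
      unfolding iso herm_axis sumQ scale ..
    also have "(\<Sum>i\<in>UNIV. (Q y $ i) *s axis i 1) = Q y"
      by (rule basis_expansion)
    finally show ?thesis by (simp add: inv)
  qed
  then have "(\<Sum>i\<in>UNIV. self_outer (Q (axis i 1))) = mat 1"
    by (subst matrix_eq) blast
  with c Qe add scale iso show thesis by (rule that)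
qed

section \<open>The standard complex Gaussian law and chi-squared laws\<close>

text \<open>Laws are identified throughout by nonnegative integrals of arbitrary measurable
  functions, so that Fubini's theorem needs no integrability conditions.\<close>

lemma measure_eqI_nn_integral:
  assumes "sets M = sets N"
    and "\<And>f. f \<in> borel_measurable M \<Longrightarrow> (\<integral>\<^sup>+x. f x \<partial>M) = (\<integral>\<^sup>+x. f x \<partial>N)"
  shows "M = N"
  by (rule measure_eqI[OF assms(1)])
    (metis assms nn_integral_indicator borel_measurable_indicator)

abbreviation "std_normal \<equiv> density lborel std_normal_density"

lemma prob_space_std_normal: "prob_space std_normal"
  by (simp add: prob_space_normal_density)

lemma measurable_Complex [measurable]:
  assumes [measurable]: "f \<in> borel_measurable M" "g \<in> borel_measurable M"
  shows "(\<lambda>x. Complex (f x) (g x)) \<in> borel_measurable M"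
  unfolding Complex_eq by measurable

lemma lborel_complex:
  "(lborel :: complex measure) = distr (lborel \<Otimes>\<^sub>M lborel) borel (\<lambda>(x, y). Complex x y)"
proof (rule lborel_eqI)
  fix l u :: complex
  assume le: "\<And>b. b \<in> Basis \<Longrightarrow> l \<bullet> b \<le> u \<bullet> b"
  have "(\<lambda>(x, y). Complex x y) -` box l u \<inter> space (lborel \<Otimes>\<^sub>M lborel)
      = box (Re l) (Re u) \<times> box (Im l) (Im u)"
    by (auto simp: box_def Basis_complex_def inner_complex_def space_pair_measure)
  then show "emeasure (distr (lborel \<Otimes>\<^sub>M lborel) borel (\<lambda>(x, y). Complex x y)) (box l u)
      = (\<Prod>b\<in>Basis. (u - l) \<bullet> b)"
    using le[of 1] le[of \<i>]
    by (subst emeasure_distr)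
      (auto simp: lborel.emeasure_pair_measure_Times Basis_complex_def inner_complex_def ennreal_mult)
qed simp

text \<open>The law of X + iY with X, Y independent standard normal, hence of second absolute moment
  2. With this scaling |z|^2 has exactly the chi-squared law with two degrees of freedom.\<close>

definition cgauss :: "complex measure" where
  "cgauss = density lborel (\<lambda>z. ennreal (exp (- (cmod z)\<^sup>2 / 2) / (2 * pi)))"

lemma sets_cgauss [simp, measurable_cong]: "sets cgauss = sets borel"
  and space_cgauss [simp]: "space cgauss = UNIV"
  by (simp_all add: cgauss_def)

lemma nn_integral_cgauss:
  assumes [measurable]: "f \<in> borel_measurable borel"
  shows "(\<integral>\<^sup>+z. f z \<partial>cgauss) = (\<integral>\<^sup>+x. (\<integral>\<^sup>+y. f (Complex x y) \<partial>std_normal) \<partial>std_normal)"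
proof -
  have dens: "exp (- (cmod (Complex x y))\<^sup>2 / 2) / (2 * pi)
      = std_normal_density x * std_normal_density y" for x y
  proof -
    have "exp (- (x\<^sup>2 + y\<^sup>2) / 2) = exp (- x\<^sup>2 / 2) * exp (- y\<^sup>2 / 2)"
      by (simp add: exp_add[symmetric] add_divide_distrib[symmetric])
    moreover have "sqrt (2 * pi) * sqrt (2 * pi) = 2 * pi" by simp
    ultimately show ?thesis
      by (simp add: std_normal_density_def cmod_power2)
  qed
  have "(\<integral>\<^sup>+z. f z \<partial>cgauss) = (\<integral>\<^sup>+z. ennreal (exp (- (cmod z)\<^sup>2 / 2) / (2 * pi)) * f z \<partial>lborel)"
    unfolding cgauss_def by (rule nn_integral_density) auto
  also have "\<dots> = (\<integral>\<^sup>+p. (case p of (x, y) \<Rightarrow> ennreal (exp (- (cmod (Complex x y))\<^sup>2 / 2) / (2 * pi)) * f (Complex x y))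
      \<partial>(lborel \<Otimes>\<^sub>M lborel))"
    by (subst lborel_complex, subst nn_integral_distr) (auto simp: case_prod_unfold)
  also have "\<dots> = (\<integral>\<^sup>+x. (\<integral>\<^sup>+y. ennreal (std_normal_density x * std_normal_density y)
      * f (Complex x y) \<partial>lborel) \<partial>lborel)"
    unfolding dens by (subst lborel.nn_integral_fst[symmetric]) auto
  also have "\<dots> = (\<integral>\<^sup>+x. ennreal (std_normal_density x) * (\<integral>\<^sup>+y. ennreal (std_normal_density y)
      * f (Complex x y) \<partial>lborel) \<partial>lborel)"
    by (intro nn_integral_cong) (simp add: ennreal_mult' mult.assoc nn_integral_cmult)
  also have "\<dots> = (\<integral>\<^sup>+x. (\<integral>\<^sup>+y. f (Complex x y) \<partial>std_normal) \<partial>std_normal)"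
    by (subst nn_integral_density; simp add: nn_integral_density)
  finally show ?thesis .
qed

interpretation std_normal: prob_space std_normal by (rule prob_space_std_normal)

interpretation cgauss: prob_space cgauss
proof
  have "emeasure cgauss (space cgauss) = (\<integral>\<^sup>+z. 1 \<partial>cgauss)" by simp
  also have "\<dots> = 1"
    by (subst nn_integral_cgauss) (use std_normal.emeasure_space_1 in simp_all)
  finally show "emeasure cgauss (space cgauss) = 1" .
qed

lemma nn_integral_lborel_translate:
  fixes f :: "'a::euclidean_space \<Rightarrow> ennreal"
  assumes [measurable]: "f \<in> borel_measurable borel"
  shows "(\<integral>\<^sup>+x. f (x + c) \<partial>lborel) = (\<integral>\<^sup>+x. f x \<partial>lborel)"
proof -
  have "(\<integral>\<^sup>+x. f x \<partial>lborel) = (\<integral>\<^sup>+x. f x \<partial>distr lborel borel ((+) c))"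
    by (simp add: lborel_distr_plus)
  also have "\<dots> = (\<integral>\<^sup>+x. f (x + c) \<partial>lborel)"
    by (subst nn_integral_distr) (auto simp: add.commute)
  finally show ?thesis ..
qed

text \<open>A matrix in \<open>SU(2)\<close> is a product of shears, and shears preserve Lebesgue measure by Fubini
  and translation invariance.\<close>
lemma nn_integral_lborel_rotation:
  fixes F :: "complex \<times> complex \<Rightarrow> ennreal"
  assumes F: "F \<in> borel_measurable (borel \<Otimes>\<^sub>M borel)" and cs: "(cmod c)\<^sup>2 + (cmod s)\<^sup>2 = 1"
  shows "(\<integral>\<^sup>+x. (\<integral>\<^sup>+y. F (c * x + s * y, - cnj s * x + cnj c * y) \<partial>lborel) \<partial>lborel)
    = (\<integral>\<^sup>+x. (\<integral>\<^sup>+y. F (x, y) \<partial>lborel) \<partial>lborel)"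
proof -
  define L :: "(complex \<times> complex \<Rightarrow> ennreal) \<Rightarrow> ennreal"
    where "L F = (\<integral>\<^sup>+x. (\<integral>\<^sup>+y. F (x, y) \<partial>lborel) \<partial>lborel)" for F
  define sh1 :: "complex \<Rightarrow> complex \<times> complex \<Rightarrow> complex \<times> complex"
    where "sh1 w = (\<lambda>(x, y). (x + w * y, y))" for w
  define sh2 :: "complex \<Rightarrow> complex \<times> complex \<Rightarrow> complex \<times> complex"
    where "sh2 w = (\<lambda>(x, y). (x, y + w * x))" for w
  define T :: "complex \<Rightarrow> complex \<Rightarrow> complex \<times> complex \<Rightarrow> complex \<times> complex"
    where "T c s = (\<lambda>(x, y). (c * x + s * y, - cnj s * x + cnj c * y))" for c s
  have [measurable]: "sh1 w \<in> borel \<Otimes>\<^sub>M borel \<rightarrow>\<^sub>M borel \<Otimes>\<^sub>M borel"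
    "sh2 w \<in> borel \<Otimes>\<^sub>M borel \<rightarrow>\<^sub>M borel \<Otimes>\<^sub>M borel" "T c s \<in> borel \<Otimes>\<^sub>M borel \<rightarrow>\<^sub>M borel \<Otimes>\<^sub>M borel" for w c s
    unfolding sh1_def sh2_def T_def by measurable
  have L2: "L (G \<circ> sh2 w) = L G" if [measurable]: "G \<in> borel_measurable (borel \<Otimes>\<^sub>M borel)" for G w
    unfolding L_def sh2_def comp_def prod.case
    by (intro nn_integral_cong nn_integral_lborel_translate) measurable
  have L1: "L (G \<circ> sh1 w) = L G" if [measurable]: "G \<in> borel_measurable (borel \<Otimes>\<^sub>M borel)" for G w
  proof -
    have "L (G \<circ> sh1 w) = (\<integral>\<^sup>+y. (\<integral>\<^sup>+x. G (x + w * y, y) \<partial>lborel) \<partial>lborel)"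
      unfolding L_def sh1_def by (subst lborel_pair.Fubini') (auto simp: case_prod_beta)
    also have "\<dots> = (\<integral>\<^sup>+y. (\<integral>\<^sup>+x. G (x, y) \<partial>lborel) \<partial>lborel)"
      by (intro nn_integral_cong nn_integral_lborel_translate) measurable
    also have "\<dots> = L G"
      unfolding L_def by (subst lborel_pair.Fubini') (auto simp: case_prod_beta)
    finally show ?thesis .
  qed
  have nz: "L (G \<circ> T c s) = L G"
    if s: "s \<noteq> 0" and cs: "(cmod c)\<^sup>2 + (cmod s)\<^sup>2 = 1"
      and [measurable]: "G \<in> borel_measurable (borel \<Otimes>\<^sub>M borel)" for G c s
  proof -
    have cs': "c * cnj c + s * cnj s = 1"
      using arg_cong[OF cs, of complex_of_real] unfolding of_real_add complex_norm_square by simp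
    then have cs'': "s * cnj s = 1 - c * cnj c" by (simp add: algebra_simps)
    define y where "y = - cnj s"
    have y: "y \<noteq> 0" using s by (simp add: y_def)
    have sy: "s = (c * cnj c - 1) / y"
      using s cs'' by (simp add: y_def field_simps)
    define z u where "z = (cnj c - 1) / y" and "u = (c - 1) / y"
    \<comment> \<open>The lower left entry of the shear product is \<open>y\<close>, forced to be
      \<open>- cnj s\<close>. The diagonal entries then determine \<open>z\<close> and
      \<open>u\<close> by division by \<open>y\<close>, and determinant one yields the remaining
      entry.\<close>
    have uy: "u * y = c - 1" and yz: "y * z = cnj c - 1"
      using y by (simp_all add: z_def u_def)
    have czu: "c * z + u = s"
      using y by (simp add: z_def u_def sy add_divide_distrib[symmetric] right_diff_distrib)
    have "p + z * q + u * (q + y * (p + z * q)) = c * p + s * q" for p q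
    proof -
      have "p + z * q + u * (q + y * (p + z * q)) = p + z * q + u * q + (u * y) * (p + z * q)"
        by (simp add: algebra_simps)
      also have "\<dots> = c * p + (c * z + u) * q"
        unfolding uy by (simp add: algebra_simps)
      finally show ?thesis unfolding czu .
    qed
    moreover have "q + y * (p + z * q) = - cnj s * p + cnj c * q" for p q
    proof -
      have "q + y * (p + z * q) = q + y * p + (y * z) * q" by (simp add: algebra_simps)
      also have "\<dots> = y * p + cnj c * q" unfolding yz by (simp add: algebra_simps)
      finally show ?thesis by (simp add: y_def)
    qed
    ultimately have T: "T c s = sh1 u \<circ> sh2 y \<circ> sh1 z"
      by (simp add: T_def sh1_def sh2_def fun_eq_iff)
    have m1: "G \<circ> sh1 w \<in> borel_measurable (borel \<Otimes>\<^sub>M borel)" for w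
      unfolding comp_def by measurable
    have m2: "(G \<circ> sh1 w) \<circ> sh2 w' \<in> borel_measurable (borel \<Otimes>\<^sub>M borel)" for w w'
      unfolding comp_def by measurable
    have "L (G \<circ> T c s) = L (((G \<circ> sh1 u) \<circ> sh2 y) \<circ> sh1 z)"
      unfolding T by (simp add: comp_assoc)
    also have "\<dots> = L G"
      by (simp only: L1[OF m2] L2[OF m1] L1[OF that(3)])
    finally show ?thesis .
  qed
  have "L (F \<circ> T c s) = L F"
  proof (cases "s = 0")
    case False
    then show ?thesis using nz[OF False cs F] by simp
  next
    case True
    then have c: "cmod c = 1" using cs norm_ge_zero[of c] by (simp add: power2_eq_1_iff)
    \<comment> \<open>A diagonal matrix in SU(2) is a product of two antidiagonal ones, to which the
      case of a nonzero off-diagonal entry applies.\<close>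
    have "T c s = T 0 1 \<circ> T 0 (- cnj c)"
      by (auto simp: T_def fun_eq_iff True)
    then have "L (F \<circ> T c s) = L ((F \<circ> T 0 1) \<circ> T 0 (- cnj c))"
      by (simp add: comp_assoc)
    also have "\<dots> = L (F \<circ> T 0 1)"
      using c F by (intro nz) auto
    also have "\<dots> = L F" using F by (intro nz) auto
    finally show ?thesis .
  qed
  then show ?thesis by (simp add: L_def T_def)
qed

text \<open>The joint density of two copies depends only on |x|^2 + |y|^2, which the rotation
  preserves; Lebesgue measure is invariant as well.\<close>

lemma nn_integral_cgauss_rotation:
  fixes F :: "complex \<times> complex \<Rightarrow> ennreal"
  assumes F [measurable]: "F \<in> borel_measurable (borel \<Otimes>\<^sub>M borel)" and cs: "(cmod c)\<^sup>2 + (cmod s)\<^sup>2 = 1"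
  shows "(\<integral>\<^sup>+x. (\<integral>\<^sup>+y. F (c * x + s * y, - cnj s * x + cnj c * y) \<partial>cgauss) \<partial>cgauss)
    = (\<integral>\<^sup>+x. (\<integral>\<^sup>+y. F (x, y) \<partial>cgauss) \<partial>cgauss)"
proof -
  define d where "d z = ennreal (exp (- (cmod z)\<^sup>2 / 2) / (2 * pi))" for z
  have [measurable]: "d \<in> borel_measurable borel" unfolding d_def by measurable
  have dens: "(\<integral>\<^sup>+x. (\<integral>\<^sup>+y. G (x, y) \<partial>cgauss) \<partial>cgauss)
      = (\<integral>\<^sup>+x. (\<integral>\<^sup>+y. d x * d y * G (x, y) \<partial>lborel) \<partial>lborel)"
    if [measurable]: "G \<in> borel_measurable (borel \<Otimes>\<^sub>M borel)" for G
    unfolding cgauss_def d_def[symmetric]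
    by (subst nn_integral_density; simp add: nn_integral_density nn_integral_cmult mult.assoc)
  have cs': "c * cnj c + s * cnj s = 1"
    using arg_cong[OF cs, of complex_of_real] unfolding of_real_add complex_norm_square by simp
  have norm: "(cmod (c * x + s * y))\<^sup>2 + (cmod (- cnj s * x + cnj c * y))\<^sup>2 = (cmod x)\<^sup>2 + (cmod y)\<^sup>2"
    for x y
  proof -
    have "complex_of_real ((cmod (c * x + s * y))\<^sup>2 + (cmod (- cnj s * x + cnj c * y))\<^sup>2)
      = (c * cnj c + s * cnj s) * (x * cnj x + y * cnj y)"
      unfolding of_real_add complex_norm_square by (simp add: algebra_simps)
    also have "\<dots> = complex_of_real ((cmod x)\<^sup>2 + (cmod y)\<^sup>2)"
      unfolding of_real_add complex_norm_square cs' by simp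
    finally show ?thesis by (simp only: of_real_eq_iff)
  qed
  have dd: "d (c * x + s * y) * d (- cnj s * x + cnj c * y) = d x * d y" for x y
    using norm[of x y]
    by (simp add: d_def ennreal_mult[symmetric] exp_add[symmetric] add_divide_distrib[symmetric])
  let ?G = "\<lambda>p. d (fst p) * d (snd p) * F p"
  have "(\<integral>\<^sup>+x. (\<integral>\<^sup>+y. F (c * x + s * y, - cnj s * x + cnj c * y) \<partial>cgauss) \<partial>cgauss)
    = (\<integral>\<^sup>+x. (\<integral>\<^sup>+y. d x * d y * F (c * x + s * y, - cnj s * x + cnj c * y) \<partial>lborel) \<partial>lborel)"
    using dens[of "\<lambda>(x, y). F (c * x + s * y, - cnj s * x + cnj c * y)"] by simp
  also have "\<dots> = (\<integral>\<^sup>+x. (\<integral>\<^sup>+y. ?G (c * x + s * y, - cnj s * x + cnj c * y) \<partial>lborel) \<partial>lborel)"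
    by (simp only: fst_conv snd_conv dd)
  also have "\<dots> = (\<integral>\<^sup>+x. (\<integral>\<^sup>+y. ?G (x, y) \<partial>lborel) \<partial>lborel)"
    by (rule nn_integral_lborel_rotation[OF _ cs]) measurable
  also have "\<dots> = (\<integral>\<^sup>+x. (\<integral>\<^sup>+y. F (x, y) \<partial>cgauss) \<partial>cgauss)"
    by (simp add: dens)
  finally show ?thesis .
qed

section \<open>Chi-squared laws as laws of sums of squared moduli\<close>

lemma sets_chi_squared [simp, measurable_cong]: "sets (chi_squared k) = sets borel"
  and space_chi_squared [simp]: "space (chi_squared k) = UNIV"
  by (simp_all add: chi_squared_def)

lemma prob_space_chi_squared: "prob_space (chi_squared k)"
  unfolding chi_squared_def
  by (intro prob_space.prob_space_distr prob_space_PiM prob_space_std_normal) measurable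

lemma nn_integral_chi_squared_Suc:
  assumes [measurable]: "f \<in> borel_measurable borel"
  shows "(\<integral>\<^sup>+c. f c \<partial>chi_squared (Suc k))
    = (\<integral>\<^sup>+c. (\<integral>\<^sup>+y. f (y\<^sup>2 + c) \<partial>std_normal) \<partial>chi_squared k)"
proof -
  interpret product_sigma_finite "\<lambda>_::nat. std_normal" ..
  have "(\<integral>\<^sup>+c. f c \<partial>chi_squared (Suc k))
      = (\<integral>\<^sup>+x. f (\<Sum>i<Suc k. (x i)\<^sup>2) \<partial>PiM {..<Suc k} (\<lambda>_. std_normal))"
    unfolding chi_squared_def by (subst nn_integral_distr) measurable
  also have "\<dots> = (\<integral>\<^sup>+x. (\<integral>\<^sup>+y. f (y\<^sup>2 + (\<Sum>i<k. (x i)\<^sup>2)) \<partial>std_normal) \<partial>PiM {..<k} (\<lambda>_. std_normal))"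
    unfolding lessThan_Suc
    by (subst product_nn_integral_insert) (auto intro!: nn_integral_cong)
  also have "\<dots> = (\<integral>\<^sup>+c. (\<integral>\<^sup>+y. f (y\<^sup>2 + c) \<partial>std_normal) \<partial>chi_squared k)"
    unfolding chi_squared_def by (subst nn_integral_distr) measurable
  finally show ?thesis .
qed

lemma nn_integral_chi_squared_cgauss:
  assumes [measurable]: "f \<in> borel_measurable borel"
  shows "(\<integral>\<^sup>+c. f c \<partial>chi_squared (k + 2))
    = (\<integral>\<^sup>+c. (\<integral>\<^sup>+z. f ((cmod z)\<^sup>2 + c) \<partial>cgauss) \<partial>chi_squared k)"
proof -
  have "(\<integral>\<^sup>+c. f c \<partial>chi_squared (Suc (Suc k)))
      = (\<integral>\<^sup>+c. (\<integral>\<^sup>+x. (\<integral>\<^sup>+y. f (y\<^sup>2 + (x\<^sup>2 + c)) \<partial>std_normal) \<partial>std_normal) \<partial>chi_squared k)"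
  proof -
    have m: "(\<lambda>c. \<integral>\<^sup>+y. f (y\<^sup>2 + c) \<partial>std_normal) \<in> borel_measurable borel"
      by measurable
    show ?thesis
      by (rule trans[OF nn_integral_chi_squared_Suc[OF assms] nn_integral_chi_squared_Suc[OF m]])
  qed
  also have "\<dots> = (\<integral>\<^sup>+c. (\<integral>\<^sup>+z. f ((cmod z)\<^sup>2 + c) \<partial>cgauss) \<partial>chi_squared k)"
    by (intro nn_integral_cong) (subst nn_integral_cgauss, simp_all add: cmod_power2 ac_simps)
  finally show ?thesis by simp
qed

text \<open>Each complex Gaussian summand adds two degrees of freedom. The map \<open>\<phi>\<close>
  lets one induction serve scalar samples, a fixed coordinate of vector samples, and the component
  of vector samples along a unit vector.\<close>

lemma nn_integral_sum_norm_sq: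
  assumes J: "finite J" and N: "prob_space N" and [measurable]: "\<phi> \<in> borel_measurable N"
    and \<phi>: "\<And>f. f \<in> borel_measurable borel \<Longrightarrow> (\<integral>\<^sup>+w. f (\<phi> w) \<partial>N) = (\<integral>\<^sup>+z. f z \<partial>cgauss)"
    and "f \<in> borel_measurable borel"
  shows "(\<integral>\<^sup>+w. f (\<Sum>j\<in>J. (cmod (\<phi> (w j)))\<^sup>2) \<partial>PiM J (\<lambda>_. N)) = (\<integral>\<^sup>+c. f c \<partial>chi_squared (2 * card J))"
proof -
  interpret N: prob_space N by (rule N)
  interpret product_sigma_finite "\<lambda>_. N" ..
  show ?thesis using J assms(5)
  proof (induction J arbitrary: f rule: finite_induct)
    case empty
    then show ?case
      by (simp add: chi_squared_0 nn_integral_return nn_integral_empty del: nn_integral_const)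
  next
    case (insert j J)
    note [measurable] = insert.prems
    have "(\<integral>\<^sup>+w. f (\<Sum>j\<in>insert j J. (cmod (\<phi> (w j)))\<^sup>2) \<partial>PiM (insert j J) (\<lambda>_. N))
        = (\<integral>\<^sup>+w. (\<integral>\<^sup>+y. f ((cmod (\<phi> y))\<^sup>2 + (\<Sum>j\<in>J. (cmod (\<phi> (w j)))\<^sup>2)) \<partial>N) \<partial>PiM J (\<lambda>_. N))"
      using insert.hyps
      by (subst product_nn_integral_insert)
        (auto intro!: nn_integral_cong arg_cong[where f = f] sum.cong)
    also have "\<dots> = (\<integral>\<^sup>+w. (\<integral>\<^sup>+z. f ((cmod z)\<^sup>2 + (\<Sum>j\<in>J. (cmod (\<phi> (w j)))\<^sup>2)) \<partial>cgauss) \<partial>PiM J (\<lambda>_. N))"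
      by (intro nn_integral_cong \<phi>) measurable
    also have "\<dots> = (\<integral>\<^sup>+c. (\<integral>\<^sup>+z. f ((cmod z)\<^sup>2 + c) \<partial>cgauss) \<partial>chi_squared (2 * card J))"
      by (rule insert.IH) measurable
    also have "\<dots> = (\<integral>\<^sup>+c. f c \<partial>chi_squared (2 * card (insert j J)))"
      using insert.hyps nn_integral_chi_squared_cgauss[of f "2 * card J"] by simp
    finally show ?case .
  qed
qed

section \<open>Rotation invariance of Gaussian samples\<close>

text \<open>Lifts independence of the two parts of a single draw to independence of the two families
  formed from i.i.d. draws. Each induction step splits one more draw and exchanges the order of
  integration.\<close>

lemma nn_integral_PiM_split:
  assumes I: "finite I" and N: "prob_space N" and M1: "prob_space M1" and M2: "prob_space M2"
    and [measurable]: "p \<in> N \<rightarrow>\<^sub>M M1" "q \<in> N \<rightarrow>\<^sub>M M2"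
    and pq: "\<And>G. G \<in> borel_measurable (M1 \<Otimes>\<^sub>M M2) \<Longrightarrow>
      (\<integral>\<^sup>+z. G (p z, q z) \<partial>N) = (\<integral>\<^sup>+a. (\<integral>\<^sup>+b. G (a, b) \<partial>M2) \<partial>M1)"
    and F: "F \<in> borel_measurable (PiM I (\<lambda>_. M1) \<Otimes>\<^sub>M PiM I (\<lambda>_. M2))"
  shows "(\<integral>\<^sup>+z. F (\<lambda>i\<in>I. p (z i), \<lambda>i\<in>I. q (z i)) \<partial>PiM I (\<lambda>_. N))
    = (\<integral>\<^sup>+a. (\<integral>\<^sup>+b. F (a, b) \<partial>PiM I (\<lambda>_. M2)) \<partial>PiM I (\<lambda>_. M1))"
proof -
  interpret N: prob_space N by (rule N)
  interpret M1: prob_space M1 by (rule M1)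
  interpret M2: prob_space M2 by (rule M2)
  interpret PN: product_prob_space "\<lambda>_. N" ..
  interpret P1: product_prob_space "\<lambda>_. M1" ..
  interpret P2: product_prob_space "\<lambda>_. M2" ..
  show ?thesis using I F
  proof (induction I arbitrary: F rule: finite_induct)
    case empty
    then show ?case
      by (simp add: PN.nn_integral_empty P1.nn_integral_empty P2.nn_integral_empty restrict_def
          del: nn_integral_const)
  next
    case (insert i I)
    note [measurable] = insert.prems
    interpret I1: prob_space "PiM I (\<lambda>_. M1)" by (rule prob_space_PiM) (rule M1)
    interpret I2: prob_space "PiM I (\<lambda>_. M2)" by (rule prob_space_PiM) (rule M2)
    interpret X: pair_sigma_finite "M1" "PiM I (\<lambda>_. M2)" ..
    let ?G = "\<lambda>(\<alpha>, \<beta>). \<integral>\<^sup>+a. (\<integral>\<^sup>+b. F (\<alpha>(i := a), \<beta>(i := b)) \<partial>M2) \<partial>M1"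
    have "(\<integral>\<^sup>+z. F (\<lambda>j\<in>insert i I. p (z j), \<lambda>j\<in>insert i I. q (z j)) \<partial>PiM (insert i I) (\<lambda>_. N))
        = (\<integral>\<^sup>+z. (\<integral>\<^sup>+y. F ((\<lambda>j\<in>I. p (z j))(i := p y), (\<lambda>j\<in>I. q (z j))(i := q y)) \<partial>N) \<partial>PiM I (\<lambda>_. N))"
    proof -
      have r: "(\<lambda>j\<in>insert i I. p ((z(i := y)) j)) = (\<lambda>j\<in>I. p (z j))(i := p y)"
        "(\<lambda>j\<in>insert i I. q ((z(i := y)) j)) = (\<lambda>j\<in>I. q (z j))(i := q y)" for z y
        using insert.hyps by (auto simp: fun_eq_iff)
      show ?thesis
        using insert.hyps by (subst PN.product_nn_integral_insert; (simp only: r)?) measurable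
    qed
    also have "\<dots> = (\<integral>\<^sup>+z. ?G (\<lambda>j\<in>I. p (z j), \<lambda>j\<in>I. q (z j)) \<partial>PiM I (\<lambda>_. N))"
    proof (intro nn_integral_cong)
      fix z assume "z \<in> space (PiM I (\<lambda>_. N))"
      then have [measurable]: "(\<lambda>j\<in>I. p (z j)) \<in> space (PiM I (\<lambda>_. M1))"
        "(\<lambda>j\<in>I. q (z j)) \<in> space (PiM I (\<lambda>_. M2))"
        by (auto simp: space_PiM intro!: measurable_space[of p] measurable_space[of q])
      show "(\<integral>\<^sup>+y. F ((\<lambda>j\<in>I. p (z j))(i := p y), (\<lambda>j\<in>I. q (z j))(i := q y)) \<partial>N)
          = ?G (\<lambda>j\<in>I. p (z j), \<lambda>j\<in>I. q (z j))"
        using pq[of "\<lambda>(a, b). F ((\<lambda>j\<in>I. p (z j))(i := a), (\<lambda>j\<in>I. q (z j))(i := b))"]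
        by simp
    qed
    also have "\<dots> = (\<integral>\<^sup>+\<alpha>. (\<integral>\<^sup>+\<beta>. ?G (\<alpha>, \<beta>) \<partial>PiM I (\<lambda>_. M2)) \<partial>PiM I (\<lambda>_. M1))"
      by (rule insert.IH) measurable
    also have "\<dots> = (\<integral>\<^sup>+\<alpha>. (\<integral>\<^sup>+a. (\<integral>\<^sup>+\<beta>. (\<integral>\<^sup>+b. F (\<alpha>(i := a), \<beta>(i := b)) \<partial>M2) \<partial>PiM I (\<lambda>_. M2)) \<partial>M1) \<partial>PiM I (\<lambda>_. M1))"
      unfolding prod.case by (intro nn_integral_cong X.Fubini') measurable
    also have "\<dots> = (\<integral>\<^sup>+\<alpha>. (\<integral>\<^sup>+a. (\<integral>\<^sup>+\<beta>. F (\<alpha>(i := a), \<beta>) \<partial>PiM (insert i I) (\<lambda>_. M2)) \<partial>M1) \<partial>PiM I (\<lambda>_. M1))"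
      using insert.hyps by (intro nn_integral_cong P2.product_nn_integral_insert[symmetric]) measurable
    also have "\<dots> = (\<integral>\<^sup>+a. (\<integral>\<^sup>+b. F (a, b) \<partial>PiM (insert i I) (\<lambda>_. M2)) \<partial>PiM (insert i I) (\<lambda>_. M1))"
    proof -
      interpret I2': prob_space "PiM (insert i I) (\<lambda>_. M2)" by (rule prob_space_PiM) (rule M2)
      show ?thesis
      using insert.hyps by (intro P1.product_nn_integral_insert[symmetric]) measurable
    qed
    finally show ?case .
  qed
qed

lemma sum_insert_upd:
  "finite I \<Longrightarrow> i \<notin> I \<Longrightarrow>
    (\<Sum>j\<in>insert i I. h j ((w(i := x)) j)) = h i x + (\<Sum>j\<in>I. h j (w j))"
  by (auto intro!: arg_cong2[where f = "(+)"] sum.cong)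

text \<open>Invariance in law under \<open>SU(2)\<close> of a pair of independent copies; \<open>sc\<close> is the complex
  scalar multiplication.\<close>
definition pair_rotation_invariant ::
    "(complex \<Rightarrow> 'e \<Rightarrow> 'e) \<Rightarrow> ('e :: euclidean_space) measure \<Rightarrow> bool" where
  "pair_rotation_invariant sc N \<longleftrightarrow>
     (\<forall>c s F. (cmod c)\<^sup>2 + (cmod s)\<^sup>2 = 1 \<longrightarrow> F \<in> borel_measurable (borel \<Otimes>\<^sub>M borel) \<longrightarrow>
       (\<integral>\<^sup>+x. (\<integral>\<^sup>+y. F (sc c x + sc s y, sc (- cnj s) x + sc (cnj c) y) \<partial>N) \<partial>N)
       = (\<integral>\<^sup>+x. (\<integral>\<^sup>+y. F (x, y) \<partial>N) \<partial>N))"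

lemma pair_rotation_invariantD:
  assumes "pair_rotation_invariant sc N" "(cmod c)\<^sup>2 + (cmod s)\<^sup>2 = 1"
    "F \<in> borel_measurable (borel \<Otimes>\<^sub>M borel)"
  shows "(\<integral>\<^sup>+x. (\<integral>\<^sup>+y. F (sc c x + sc s y, sc (- cnj s) x + sc (cnj c) y) \<partial>N) \<partial>N)
    = (\<integral>\<^sup>+x. (\<integral>\<^sup>+y. F (x, y) \<partial>N) \<partial>N)"
  using assms unfolding pair_rotation_invariant_def by blast

text \<open>A rotation in the plane of \<open>i0\<close> and \<open>i\<close> moves the whole weight
  of \<open>i\<close> onto \<open>i0\<close> and preserves both the law and the sum of the
  \<open>f (w i)\<close>. Repeating this collects all weight at \<open>i0\<close>. With scalars and
  \<open>f = 0\<close> it gives the law of a projection of a Gaussian vector; with vectors and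
  \<open>f = self_outer\<close> it rotates the sample inside its Gram matrix.\<close>

lemma nn_integral_unit_combination:
  fixes sc :: "complex \<Rightarrow> 'e :: euclidean_space \<Rightarrow> 'e" and f :: "'e \<Rightarrow> 'f :: euclidean_space"
  assumes module_sc: "module sc" and [measurable]: "\<And>a. sc a \<in> borel_measurable borel"
    and N: "prob_space N" and [measurable_cong, simp]: "sets N = sets borel"
    and rot: "pair_rotation_invariant sc N"
    and [measurable]: "f \<in> borel_measurable borel"
    and f1: "\<And>c x. cmod c = 1 \<Longrightarrow> f (sc c x) = f x"
    and f2: "\<And>c s x y. (cmod c)\<^sup>2 + (cmod s)\<^sup>2 = 1 \<Longrightarrow>
      f (sc c x + sc s y) + f (sc (- cnj s) x + sc (cnj c) y) = f x + f y"
    and I: "finite I" and i0: "i0 \<notin> I"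
    and u: "(\<Sum>i\<in>insert i0 I. (cmod (u i))\<^sup>2) = 1"
    and F: "F \<in> borel_measurable (borel \<Otimes>\<^sub>M borel)"
  shows "(\<integral>\<^sup>+w. F (\<Sum>i\<in>insert i0 I. sc (u i) (w i), \<Sum>i\<in>insert i0 I. f (w i)) \<partial>PiM (insert i0 I) (\<lambda>_. N))
    = (\<integral>\<^sup>+w. F (w i0, \<Sum>i\<in>insert i0 I. f (w i)) \<partial>PiM (insert i0 I) (\<lambda>_. N))"
proof -
  interpret module sc by (rule module_sc)
  interpret N: prob_space N by (rule N)
  interpret P: product_prob_space "\<lambda>_. N" ..
  note rotD = pair_rotation_invariantD[OF rot]
  show ?thesis using I i0 u F
  proof (induction I arbitrary: u F rule: finite_induct)
    case empty
    note [measurable] = empty.prems(3)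
    \<comment> \<open>A single unit weight is a phase, that is, a rotation with
      \<open>s = 0\<close>.\<close>
    have u: "cmod (u i0) = 1" using empty.prems(2) norm_ge_zero[of "u i0"] by (simp add: power2_eq_1_iff)
    have "(\<integral>\<^sup>+x. F (sc (u i0) x, f x) \<partial>N) = (\<integral>\<^sup>+x. F (sc (u i0) x, f (sc (u i0) x)) \<partial>N)"
      by (simp add: f1 u)
    also have "\<dots> = (\<integral>\<^sup>+x. F (x, f x) \<partial>N)"
      using rotD[of "u i0" 0 "\<lambda>(x, y). F (x, f x)"] u by (simp add: N.emeasure_space_1)
    finally show ?case
      using P.product_nn_integral_singleton[of "\<lambda>x. F (sc (u i0) x, f x)" i0]
        P.product_nn_integral_singleton[of "\<lambda>x. F (x, f x)" i0] by simp
  next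
    case (insert i I)
    note [measurable] = insert.prems(3)
    from insert.prems insert.hyps have i: "i0 \<notin> I" "i0 \<noteq> i" "i \<notin> I" "finite I" by auto
    have m: "(\<lambda>w. \<Sum>j\<in>J. h j (w j)) \<in> borel_measurable (PiM K (\<lambda>_. N))"
      if "\<And>j. h j \<in> borel_measurable borel" "J \<subseteq> K" for h :: "'a \<Rightarrow> 'e \<Rightarrow> 'g :: euclidean_space" and J K
      using that by (intro borel_measurable_sum measurable_compose[OF measurable_component_singleton[of _ K "\<lambda>_. N"]]) auto
    have ii: "insert i0 (insert i I) = insert i (insert i0 I)" by (rule insert_commute)
    have fi: "finite (insert i0 I)" "i \<notin> insert i0 I" using i by auto
    note upd = sum_insert_upd[OF fi, where h = "\<lambda>j. sc (v j)" for v] sum_insert_upd[OF fi, where h = "\<lambda>_. f"]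
      sum_insert_upd[OF i(4,1), where h = "\<lambda>j. sc (v j)" for v] sum_insert_upd[OF i(4,1), where h = "\<lambda>_. f"]
    have expand1: "(\<integral>\<^sup>+w. F (\<Sum>j\<in>insert i0 (insert i I). sc (v j) (w j),
          \<Sum>j\<in>insert i0 (insert i I). f (w j)) \<partial>PiM (insert i0 (insert i I)) (\<lambda>_. N))
        = (\<integral>\<^sup>+w. (\<integral>\<^sup>+y. F (sc (v i) y + (\<Sum>j\<in>insert i0 I. sc (v j) (w j)),
            f y + (\<Sum>j\<in>insert i0 I. f (w j))) \<partial>N) \<partial>PiM (insert i0 I) (\<lambda>_. N))" for v
      unfolding ii using fi
      by (subst P.product_nn_integral_insert; (simp only: upd)?)
        (auto intro!: measurable_compose[OF _ insert.prems(3)] m)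
    have expand: "(\<integral>\<^sup>+w. F (\<Sum>j\<in>insert i0 (insert i I). sc (v j) (w j),
          \<Sum>j\<in>insert i0 (insert i I). f (w j)) \<partial>PiM (insert i0 (insert i I)) (\<lambda>_. N))
        = (\<integral>\<^sup>+w. (\<integral>\<^sup>+x. (\<integral>\<^sup>+y. F (sc (v i) y + (sc (v i0) x + (\<Sum>j\<in>I. sc (v j) (w j))),
            f y + (f x + (\<Sum>j\<in>I. f (w j)))) \<partial>N) \<partial>N) \<partial>PiM I (\<lambda>_. N))" for v
      unfolding expand1 using i
      by (subst P.product_nn_integral_insert; (simp only: upd)?) measurable
    define \<rho> where "\<rho> = sqrt ((cmod (u i0))\<^sup>2 + (cmod (u i))\<^sup>2)"
    have \<rho>2: "\<rho>\<^sup>2 = (cmod (u i0))\<^sup>2 + (cmod (u i))\<^sup>2" by (simp add: \<rho>_def)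
    \<comment> \<open>If both weights vanish, any rotation serves, and the identity is
      taken.\<close>
    obtain c s :: complex where cs: "(cmod c)\<^sup>2 + (cmod s)\<^sup>2 = 1" and c: "u i0 = \<rho> * c" and s: "u i = \<rho> * s"
    proof (cases "\<rho> = 0")
      case True
      then have "u i0 = 0" "u i = 0" by (auto simp: \<rho>_def)
      then show thesis using that[of 1 0] True by simp
    next
      case False
      then show thesis
        by (intro that[of "u i0 / \<rho>" "u i / \<rho>"])
          (simp_all add: norm_divide power_divide add_divide_distrib[symmetric] \<rho>2[symmetric])
    qed
    \<comment> \<open>The weights after the rotation: \<open>i0\<close> carries the combined
      modulus, \<open>i\<close> carries nothing. The induction hypothesis then applies without
      \<open>i\<close>, whose contribution to the sum of the \<open>f (w j)\<close> is integrated
      separately.\<close>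
    define u' where "u' = u(i0 := complex_of_real \<rho>, i := 0)"
    have u'1: "(\<Sum>j\<in>insert i0 I. (cmod (u' j))\<^sup>2) = 1"
    proof -
      have "(\<Sum>j\<in>insert i0 I. (cmod (u' j))\<^sup>2) = \<rho>\<^sup>2 + (\<Sum>j\<in>I. (cmod (u j))\<^sup>2)"
        using i by (auto simp: u'_def intro!: sum.cong)
      then show ?thesis using insert.prems(2) i unfolding \<rho>2 by (simp add: add_ac)
    qed
    have "(\<integral>\<^sup>+w. F (\<Sum>j\<in>insert i0 (insert i I). sc (u j) (w j),
          \<Sum>j\<in>insert i0 (insert i I). f (w j)) \<partial>PiM (insert i0 (insert i I)) (\<lambda>_. N))
        = (\<integral>\<^sup>+w. F (\<Sum>j\<in>insert i0 (insert i I). sc (u' j) (w j),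
          \<Sum>j\<in>insert i0 (insert i I). f (w j)) \<partial>PiM (insert i0 (insert i I)) (\<lambda>_. N))"
      unfolding expand
    proof (rule nn_integral_cong)
      fix w :: "'a \<Rightarrow> 'e"
      let ?b = "\<Sum>j\<in>I. sc (u j) (w j)" and ?S = "\<Sum>j\<in>I. f (w j)"
      let ?H = "\<lambda>(x, y). F (sc \<rho> x + ?b, (f x + f y) + ?S)"
      have b: "(\<Sum>j\<in>I. sc (u' j) (w j)) = ?b"
        using i by (intro sum.cong) (auto simp: u'_def)
      have "(\<integral>\<^sup>+x. (\<integral>\<^sup>+y. F (sc (u i) y + (sc (u i0) x + ?b), f y + (f x + ?S)) \<partial>N) \<partial>N)
        = (\<integral>\<^sup>+x. (\<integral>\<^sup>+y. ?H (sc c x + sc s y, sc (- cnj s) x + sc (cnj c) y) \<partial>N) \<partial>N)"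
        unfolding prod.case f2[OF cs] by (simp add: c s scale_right_distrib add_ac)
      also have "\<dots> = (\<integral>\<^sup>+x. (\<integral>\<^sup>+y. ?H (x, y) \<partial>N) \<partial>N)"
        by (rule rotD[OF cs]) measurable
      finally show "(\<integral>\<^sup>+x. (\<integral>\<^sup>+y. F (sc (u i) y + (sc (u i0) x + ?b), f y + (f x + ?S)) \<partial>N) \<partial>N)
        = (\<integral>\<^sup>+x. (\<integral>\<^sup>+y. F (sc (u' i) y + (sc (u' i0) x + (\<Sum>j\<in>I. sc (u' j) (w j))), f y + (f x + ?S)) \<partial>N) \<partial>N)"
        using i unfolding b by (simp add: u'_def add_ac)
    qed
    also have "\<dots> = (\<integral>\<^sup>+w. F (w i0, \<Sum>j\<in>insert i0 (insert i I). f (w j)) \<partial>PiM (insert i0 (insert i I)) (\<lambda>_. N))"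
    proof -
      have "(\<integral>\<^sup>+w. F (\<Sum>j\<in>insert i0 (insert i I). sc (u' j) (w j),
          \<Sum>j\<in>insert i0 (insert i I). f (w j)) \<partial>PiM (insert i0 (insert i I)) (\<lambda>_. N))
        = (\<integral>\<^sup>+w. (\<lambda>(b, S). \<integral>\<^sup>+y. F (b, f y + S) \<partial>N) (\<Sum>j\<in>insert i0 I. sc (u' j) (w j),
            \<Sum>j\<in>insert i0 I. f (w j)) \<partial>PiM (insert i0 I) (\<lambda>_. N))"
        unfolding expand1 by (simp add: u'_def)
      also have "\<dots> = (\<integral>\<^sup>+w. (\<lambda>(b, S). \<integral>\<^sup>+y. F (b, f y + S) \<partial>N) (w i0,
            \<Sum>j\<in>insert i0 I. f (w j)) \<partial>PiM (insert i0 I) (\<lambda>_. N))"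
        by (rule insert.IH[OF i(1) u'1]) measurable
      also have "\<dots> = (\<integral>\<^sup>+w. F (w i0, \<Sum>j\<in>insert i (insert i0 I). f (w j)) \<partial>PiM (insert i (insert i0 I)) (\<lambda>_. N))"
        using fi i(2)
        by (subst (2) P.product_nn_integral_insert; (simp only: upd)?)
          (auto intro!: measurable_compose[OF _ insert.prems(3)] m measurable_Pair)
      finally show ?thesis unfolding ii .
    qed
    finally show ?case .
  qed
qed

section \<open>Borel measurability for vectors, matrices and the top eigenvalue\<close>

lemma borel_measurable_vecI:
  fixes f :: "'a \<Rightarrow> 'b :: euclidean_space ^ 'm"
  assumes [measurable]: "\<And>i. (\<lambda>x. f x $ i) \<in> borel_measurable M"
  shows "f \<in> borel_measurable M"
proof (subst borel_measurable_euclidean_space, intro ballI)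
  fix b :: "'b ^ 'm" assume "b \<in> Basis"
  then obtain i u where "b = axis i u" by (auto simp: Basis_vec_def)
  then show "(\<lambda>x. f x \<bullet> b) \<in> borel_measurable M" by (simp add: inner_axis)
qed

lemma borel_measurable_nth [measurable (raw)]:
  fixes f :: "'a \<Rightarrow> 'b :: euclidean_space ^ 'm"
  assumes "f \<in> borel_measurable M"
  shows "(\<lambda>x. f x $ i) \<in> borel_measurable M"
proof (rule measurable_compose[OF assms])
  show "(\<lambda>x :: 'b ^ 'm. x $ i) \<in> borel_measurable borel"
    by (intro borel_measurable_continuous_onI continuous_intros)
qed

lemma borel_measurable_cnj [measurable (raw)]:
  assumes "f \<in> borel_measurable M"
  shows "(\<lambda>x. cnj (f x)) \<in> borel_measurable M"
proof (rule measurable_compose[OF assms])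
  show "cnj \<in> borel_measurable borel"
    by (intro borel_measurable_continuous_onI continuous_intros)
qed

lemma borel_measurable_smult [measurable (raw)]:
  fixes g :: "'a \<Rightarrow> complex ^ 'm"
  assumes [measurable]: "f \<in> borel_measurable M" "g \<in> borel_measurable M"
  shows "(\<lambda>x. f x *s g x) \<in> borel_measurable M"
  by (rule borel_measurable_vecI) simp

lemma borel_measurable_herm [measurable (raw)]:
  fixes f g :: "'a \<Rightarrow> complex ^ 'm"
  assumes [measurable]: "f \<in> borel_measurable M" "g \<in> borel_measurable M"
  shows "(\<lambda>x. herm (f x) (g x)) \<in> borel_measurable M"
  unfolding herm_def by measurable

lemma borel_measurable_self_outer [measurable (raw)]:
  fixes f :: "'a \<Rightarrow> complex ^ 'm"
  assumes [measurable]: "f \<in> borel_measurable M"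
  shows "(\<lambda>x. self_outer (f x)) \<in> borel_measurable M"
  unfolding self_outer_def by (intro borel_measurable_vecI) (simp, measurable)

lemma borel_measurable_matrix_vector_mult [measurable (raw)]:
  fixes f :: "'a \<Rightarrow> complex ^ 'm ^ 'n" and g :: "'a \<Rightarrow> complex ^ 'm"
  assumes [measurable]: "f \<in> borel_measurable M" "g \<in> borel_measurable M"
  shows "(\<lambda>x. f x *v g x) \<in> borel_measurable M"
  unfolding matrix_vector_mult_def by (intro borel_measurable_vecI) (simp, measurable)

text \<open>The bound on the quadratic form is closed in \<open>y\<close>, hence needs checking only
  on a countable dense set; each sublevel set becomes a countable intersection of measurable
  sets.\<close>

lemma borel_measurable_largest_eigenvalue:
  fixes H :: "'a \<Rightarrow> complex ^ 'm ^ 'm"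
  assumes H [measurable]: "H \<in> borel_measurable M" and herm: "\<And>\<omega>. hermitian (H \<omega>)"
  shows "(\<lambda>\<omega>. largest_eigenvalue (H \<omega>)) \<in> borel_measurable M"
proof (subst borel_measurable_iff_le, intro allI)
  fix c
  obtain D :: "(complex^'m) set" where D: "countable D"
    and dense: "\<And>X. open X \<Longrightarrow> X \<noteq> {} \<Longrightarrow> \<exists>d\<in>D. d \<in> X"
    by (erule countable_dense_setE)
  have clD: "closure D = UNIV"
    using dense by (auto simp: closure_iff_nhds_not_empty) blast
  have iff: "largest_eigenvalue (H \<omega>) \<le> c \<longleftrightarrow> (\<forall>y\<in>D. y \<bullet> (H \<omega> *v y) \<le> c * (norm y)\<^sup>2)" for \<omega>
  proof -
    have "closed {y. y \<bullet> (H \<omega> *v y) \<le> c * (norm y)\<^sup>2}"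
      by (intro closed_Collect_le continuous_intros linear_continuous_on
          linear_matrix_mult[unfolded linear_conv_bounded_linear])
    then have "D \<subseteq> {y. y \<bullet> (H \<omega> *v y) \<le> c * (norm y)\<^sup>2} \<longleftrightarrow>
        {y. y \<bullet> (H \<omega> *v y) \<le> c * (norm y)\<^sup>2} = UNIV"
      using closure_minimal[of D "{y. y \<bullet> (H \<omega> *v y) \<le> c * (norm y)\<^sup>2}"] by (auto simp: clD)
    then show ?thesis unfolding largest_eigenvalue_le_iff[OF herm] by auto
  qed
  show "{\<omega> \<in> space M. largest_eigenvalue (H \<omega>) \<le> c} \<in> sets M"
    unfolding iff using D by measurable
qed

lemma norm_vec_sq: "(norm (x :: complex ^ 'm))\<^sup>2 = (\<Sum>i\<in>UNIV. (cmod (x $ i))\<^sup>2)"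
  by (simp add: power2_norm_eq_inner inner_vec_def)

lemma distr_eqI_nn_integral:
  fixes X :: "'a \<Rightarrow> 'c :: topological_space"
  assumes [measurable]: "X \<in> borel_measurable M" "Y \<in> borel_measurable N"
    and eq: "\<And>f. f \<in> borel_measurable borel \<Longrightarrow> (\<integral>\<^sup>+x. f (X x) \<partial>M) = (\<integral>\<^sup>+x. f (Y x) \<partial>N)"
  shows "distr M borel X = distr N borel Y"
  by (rule measure_eqI_nn_integral) (simp_all add: nn_integral_distr eq)

text \<open>Both sides equal an integral over one family of independent pairs: splitting the pairs
  into rotated components gives the right side, splitting them into plain components gives the left
  side.\<close>

lemma nn_integral_PiM_cgauss_rotation:
  assumes J: "finite J" and cs: "(cmod c)\<^sup>2 + (cmod s)\<^sup>2 = 1"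
    and F: "F \<in> borel_measurable (PiM J (\<lambda>_. cgauss) \<Otimes>\<^sub>M PiM J (\<lambda>_. cgauss))"
  shows "(\<integral>\<^sup>+a. (\<integral>\<^sup>+b. F (\<lambda>i\<in>J. c * a i + s * b i, \<lambda>i\<in>J. - cnj s * a i + cnj c * b i)
        \<partial>PiM J (\<lambda>_. cgauss)) \<partial>PiM J (\<lambda>_. cgauss))
    = (\<integral>\<^sup>+a. (\<integral>\<^sup>+b. F (a, b) \<partial>PiM J (\<lambda>_. cgauss)) \<partial>PiM J (\<lambda>_. cgauss))"
proof -
  interpret C2: prob_space "cgauss \<Otimes>\<^sub>M cgauss"
    by (intro prob_space_pair cgauss.prob_space_axioms)
  note prob = C2.prob_space_axioms cgauss.prob_space_axioms cgauss.prob_space_axioms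
  let ?P = "PiM J (\<lambda>_. cgauss)"
  let ?T1 = "\<lambda>z::complex \<times> complex. c * fst z + s * snd z"
  let ?T2 = "\<lambda>z::complex \<times> complex. - cnj s * fst z + cnj c * snd z"
  have "(\<integral>\<^sup>+z. F (\<lambda>i\<in>J. ?T1 (z i), \<lambda>i\<in>J. ?T2 (z i)) \<partial>PiM J (\<lambda>_. cgauss \<Otimes>\<^sub>M cgauss))
      = (\<integral>\<^sup>+a. (\<integral>\<^sup>+b. F (a, b) \<partial>?P) \<partial>?P)"
  proof (rule nn_integral_PiM_split[OF J prob _ _ _ F])
    fix G :: "complex \<times> complex \<Rightarrow> ennreal" assume "G \<in> borel_measurable (cgauss \<Otimes>\<^sub>M cgauss)"
    then have [measurable]: "G \<in> borel_measurable (borel \<Otimes>\<^sub>M borel)"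
      by (simp cong: measurable_cong_sets sets_pair_measure_cong)
    show "(\<integral>\<^sup>+z. G (?T1 z, ?T2 z) \<partial>(cgauss \<Otimes>\<^sub>M cgauss)) = (\<integral>\<^sup>+a. (\<integral>\<^sup>+b. G (a, b) \<partial>cgauss) \<partial>cgauss)"
      using nn_integral_cgauss_rotation[OF \<open>G \<in> borel_measurable (borel \<Otimes>\<^sub>M borel)\<close> cs]
      by (subst cgauss.nn_integral_fst[symmetric]) simp_all
  qed measurable
  moreover have "(\<integral>\<^sup>+z. (\<lambda>(a, b). F (\<lambda>i\<in>J. c * a i + s * b i, \<lambda>i\<in>J. - cnj s * a i + cnj c * b i))
        (\<lambda>i\<in>J. fst (z i), \<lambda>i\<in>J. snd (z i)) \<partial>PiM J (\<lambda>_. cgauss \<Otimes>\<^sub>M cgauss))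
      = (\<integral>\<^sup>+a. (\<integral>\<^sup>+b. (\<lambda>(a, b). F (\<lambda>i\<in>J. c * a i + s * b i, \<lambda>i\<in>J. - cnj s * a i + cnj c * b i)) (a, b) \<partial>?P) \<partial>?P)"
  proof (rule nn_integral_PiM_split[OF J prob])
    fix G :: "complex \<times> complex \<Rightarrow> ennreal" assume "G \<in> borel_measurable (cgauss \<Otimes>\<^sub>M cgauss)"
    then show "(\<integral>\<^sup>+z. G (fst z, snd z) \<partial>(cgauss \<Otimes>\<^sub>M cgauss)) = (\<integral>\<^sup>+a. (\<integral>\<^sup>+b. G (a, b) \<partial>cgauss) \<partial>cgauss)"
      by (subst cgauss.nn_integral_fst[symmetric]) simp_all
  qed (use F in measurable)
  ultimately show ?thesis by (simp cong: restrict_cong)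
qed

section \<open>Standard Gaussian vectors on coordinate subspaces\<close>

definition vec_on :: "'m set \<Rightarrow> ('m \<Rightarrow> complex) \<Rightarrow> complex ^ 'm" where
  "vec_on J f = (\<chi> i. if i \<in> J then f i else 0)"

text \<open>Supported on the vectors that vanish outside \<open>J\<close>, but living in the full
  space, so that the noise orthogonal to one axis has the same type as the sample.\<close>

definition gauss_on :: "'m set \<Rightarrow> (complex ^ 'm) measure" where
  "gauss_on J = distr (PiM J (\<lambda>_. cgauss)) borel (vec_on J)"

lemma measurable_vec_on [measurable]:
  "vec_on J \<in> PiM J (\<lambda>_. cgauss) \<rightarrow>\<^sub>M (borel :: (complex ^ 'm) measure)"
proof (rule borel_measurable_vecI)
  fix i
  show "(\<lambda>x. vec_on J x $ i) \<in> borel_measurable (Pi\<^sub>M J (\<lambda>_. cgauss))"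
    by (cases "i \<in> J") (simp_all add: vec_on_def)
qed

lemma sets_gauss_on [simp, measurable_cong]: "sets (gauss_on J) = sets borel"
  and space_gauss_on [simp]: "space (gauss_on J) = UNIV"
  by (simp_all add: gauss_on_def)

lemma prob_space_gauss_on: "prob_space (gauss_on (J :: 'm :: finite set))"
  unfolding gauss_on_def
  by (intro prob_space.prob_space_distr prob_space_PiM cgauss.prob_space_axioms) measurable

lemma nn_integral_gauss_on:
  assumes [measurable]: "f \<in> borel_measurable borel"
  shows "(\<integral>\<^sup>+z. f z \<partial>gauss_on J) = (\<integral>\<^sup>+a. f (vec_on J a) \<partial>PiM J (\<lambda>_. cgauss))"
  unfolding gauss_on_def by (rule nn_integral_distr) measurable

lemma pair_rotation_invariant_gauss_on:
  "pair_rotation_invariant (*s) (gauss_on (J :: 'm :: finite set))"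
  unfolding pair_rotation_invariant_def
proof (intro allI impI)
  fix c s :: complex and F :: "(complex ^ 'm) \<times> (complex ^ 'm) \<Rightarrow> ennreal"
  assume cs: "(cmod c)\<^sup>2 + (cmod s)\<^sup>2 = 1" and [measurable]: "F \<in> borel_measurable (borel \<Otimes>\<^sub>M borel)"
  interpret G: prob_space "gauss_on J" by (rule prob_space_gauss_on)
  let ?P = "PiM J (\<lambda>_. cgauss)"
  have 1: "(\<integral>\<^sup>+x. (\<integral>\<^sup>+y. H (x, y) \<partial>gauss_on J) \<partial>gauss_on J)
      = (\<integral>\<^sup>+a. (\<integral>\<^sup>+b. H (vec_on J a, vec_on J b) \<partial>?P) \<partial>?P)"
    if [measurable]: "H \<in> borel_measurable (borel \<Otimes>\<^sub>M borel)" for H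
    by (subst nn_integral_gauss_on, measurable)
      (intro nn_integral_cong, subst nn_integral_gauss_on, measurable)
  have lin: "vec_on J (\<lambda>i\<in>J. c * a i + s * b i) = c *s vec_on J a + s *s vec_on J b" for c s a b
    by (simp add: vec_on_def vec_eq_iff)
  have "(\<integral>\<^sup>+x. (\<integral>\<^sup>+y. F (c *s x + s *s y, (- cnj s) *s x + cnj c *s y) \<partial>gauss_on J) \<partial>gauss_on J)
    = (\<integral>\<^sup>+x. (\<integral>\<^sup>+y. (\<lambda>(x, y). F (c *s x + s *s y, (- cnj s) *s x + cnj c *s y)) (x, y) \<partial>gauss_on J) \<partial>gauss_on J)"
    by simp
  also have "\<dots> = (\<integral>\<^sup>+a. (\<integral>\<^sup>+b. (\<lambda>(a, b). F (vec_on J a, vec_on J b))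
      (\<lambda>i\<in>J. c * a i + s * b i, \<lambda>i\<in>J. - cnj s * a i + cnj c * b i) \<partial>?P) \<partial>?P)"
    by (subst 1) (simp_all only: lin prod.case, measurable)
  also have "\<dots> = (\<integral>\<^sup>+a. (\<integral>\<^sup>+b. (\<lambda>(a, b). F (vec_on J a, vec_on J b)) (a, b) \<partial>?P) \<partial>?P)"
    by (rule nn_integral_PiM_cgauss_rotation[OF _ cs]) (simp, measurable)
  also have "\<dots> = (\<integral>\<^sup>+x. (\<integral>\<^sup>+y. F (x, y) \<partial>gauss_on J) \<partial>gauss_on J)"
    by (subst 1) simp_all
  finally show "(\<integral>\<^sup>+x. (\<integral>\<^sup>+y. F (c *s x + s *s y, (- cnj s) *s x + cnj c *s y) \<partial>gauss_on J) \<partial>gauss_on J)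
    = (\<integral>\<^sup>+x. (\<integral>\<^sup>+y. F (x, y) \<partial>gauss_on J) \<partial>gauss_on J)" .
qed

definition drop_coord :: "'m \<Rightarrow> complex ^ 'm \<Rightarrow> complex ^ 'm" where
  "drop_coord k z = (\<chi> i. if i = k then 0 else z $ i)"

lemma measurable_drop_coord [measurable]: "drop_coord k \<in> borel \<rightarrow>\<^sub>M borel"
  by (rule borel_measurable_vecI) (simp add: drop_coord_def)

text \<open>Within one sample point this separates the signal coefficient a_j from the noise
  W_j.\<close>

lemma nn_integral_gauss_on_split:
  fixes k :: "'m :: finite"
  assumes [measurable]: "G \<in> borel_measurable (borel \<Otimes>\<^sub>M borel)"
  shows "(\<integral>\<^sup>+z. G (z $ k, drop_coord k z) \<partial>gauss_on UNIV)
    = (\<integral>\<^sup>+a. (\<integral>\<^sup>+w. G (a, w) \<partial>gauss_on (UNIV - {k})) \<partial>cgauss)"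
proof -
  interpret P: product_prob_space "\<lambda>_ :: 'm. cgauss" ..
  let ?K = "UNIV - {k}"
  have U: "UNIV = insert k ?K" by auto
  have eq: "vec_on UNIV (f(k := a)) $ k = a" "drop_coord k (vec_on UNIV (f(k := a))) = vec_on ?K f" for f a
    by (simp_all add: vec_on_def drop_coord_def vec_eq_iff)
  have "(\<integral>\<^sup>+z. G (z $ k, drop_coord k z) \<partial>gauss_on UNIV)
    = (\<integral>\<^sup>+f. G (vec_on UNIV f $ k, drop_coord k (vec_on UNIV f)) \<partial>PiM UNIV (\<lambda>_. cgauss))"
    by (rule nn_integral_gauss_on) measurable
  also have "\<dots> = (\<integral>\<^sup>+f. G (vec_on UNIV f $ k, drop_coord k (vec_on UNIV f)) \<partial>PiM (insert k ?K) (\<lambda>_. cgauss))"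
    using U by simp
  also have "\<dots> = (\<integral>\<^sup>+a. (\<integral>\<^sup>+f. G (a, vec_on ?K f) \<partial>PiM ?K (\<lambda>_. cgauss)) \<partial>cgauss)"
    by (subst P.product_nn_integral_insert_rev) (simp_all add: eq insert_absorb)
  also have "\<dots> = (\<integral>\<^sup>+a. (\<integral>\<^sup>+w. G (a, w) \<partial>gauss_on ?K) \<partial>cgauss)"
    by (intro nn_integral_cong) (subst nn_integral_gauss_on, simp_all)
  finally show ?thesis .
qed

lemma nn_integral_gauss_on_nth:
  fixes k :: "'m :: finite"
  assumes [measurable]: "f \<in> borel_measurable borel"
  shows "(\<integral>\<^sup>+z. f (z $ k) \<partial>gauss_on UNIV) = (\<integral>\<^sup>+a. f a \<partial>cgauss)"
proof -
  interpret G: prob_space "gauss_on (UNIV - {k})" by (rule prob_space_gauss_on)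
  show ?thesis
    using nn_integral_gauss_on_split[of "\<lambda>(a, w). f a" k] G.emeasure_space_1 by simp
qed

text \<open>The projection is a combination of i.i.d. coordinates with the unit weights
  \<open>cnj (u $ i)\<close>, so it has the law of one coordinate.\<close>

lemma nn_integral_gauss_on_herm:
  fixes u :: "complex ^ 'm"
  assumes u: "norm u = 1" and supp: "\<And>i. i \<notin> J \<Longrightarrow> u $ i = 0"
    and [measurable]: "f \<in> borel_measurable borel"
  shows "(\<integral>\<^sup>+z. f (herm u z) \<partial>gauss_on J) = (\<integral>\<^sup>+a. f a \<partial>cgauss)"
proof -
  interpret P: product_prob_space "\<lambda>_ :: 'm. cgauss" ..
  have uJ: "(\<Sum>i\<in>J. (cmod (cnj (u $ i)))\<^sup>2) = 1"
  proof -
    have "(\<Sum>i\<in>J. (cmod (cnj (u $ i)))\<^sup>2) = (\<Sum>i\<in>UNIV. (cmod (u $ i))\<^sup>2)"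
      using supp by (intro sum.mono_neutral_cong_left) auto
    then show ?thesis using u by (simp add: norm_vec_sq[symmetric])
  qed
  then have "J \<noteq> {}" by auto
  then obtain i0 I where J: "J = insert i0 I" "i0 \<notin> I" by (meson mk_disjoint_insert ex_in_conv)
  have herm: "herm u (vec_on J a) = (\<Sum>i\<in>J. cnj (u $ i) * a i)" for a
    unfolding herm_def vec_on_def by (intro sum.mono_neutral_cong_right) auto
  have mod: "module ((*) :: complex \<Rightarrow> complex \<Rightarrow> complex)"
    by standard (simp_all add: algebra_simps)
  have rot: "pair_rotation_invariant (*) cgauss"
    unfolding pair_rotation_invariant_def using nn_integral_cgauss_rotation by blast
  have "(\<integral>\<^sup>+z. f (herm u z) \<partial>gauss_on J) = (\<integral>\<^sup>+a. f (\<Sum>i\<in>J. cnj (u $ i) * a i) \<partial>PiM J (\<lambda>_. cgauss))"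
    by (subst nn_integral_gauss_on) (simp_all add: herm)
  also have "\<dots> = (\<integral>\<^sup>+a. f (a i0) \<partial>PiM J (\<lambda>_. cgauss))"
    using nn_integral_unit_combination[OF mod _ cgauss.prob_space_axioms sets_cgauss rot,
        of "\<lambda>_. 0 :: real" I i0 "\<lambda>i. cnj (u $ i)" "\<lambda>(b, S). f b"] uJ J
    by simp
  also have "\<dots> = (\<integral>\<^sup>+a. f a \<partial>distr (PiM J (\<lambda>_. cgauss)) cgauss (\<lambda>a. a i0))"
    using J by (subst nn_integral_distr) auto
  also have "\<dots> = (\<integral>\<^sup>+a. f a \<partial>cgauss)"
    using J by (subst distr_PiM_component) (auto intro: cgauss.prob_space_axioms)
  finally show ?thesis .
qed

lemma nn_integral_gauss_on_norm_sq:
  fixes J :: "'m :: finite set"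
  assumes [measurable]: "f \<in> borel_measurable borel"
  shows "(\<integral>\<^sup>+z. f ((norm z)\<^sup>2) \<partial>gauss_on J) = (\<integral>\<^sup>+c. f c \<partial>chi_squared (2 * card J))"
proof -
  have norm: "(norm (vec_on J a))\<^sup>2 = (\<Sum>i\<in>J. (cmod (a i))\<^sup>2)" for a
    unfolding norm_vec_sq vec_on_def by (intro sum.mono_neutral_cong_right) auto
  have "(\<integral>\<^sup>+z. f ((norm z)\<^sup>2) \<partial>gauss_on J) = (\<integral>\<^sup>+a. f (\<Sum>i\<in>J. (cmod (a i))\<^sup>2) \<partial>PiM J (\<lambda>_. cgauss))"
    by (subst nn_integral_gauss_on) (simp_all add: norm)
  also have "\<dots> = (\<integral>\<^sup>+c. f c \<partial>chi_squared (2 * card J))"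
    by (rule nn_integral_sum_norm_sq[where \<phi> = "\<lambda>x. x"])
      (simp_all add: cgauss.prob_space_axioms)
  finally show ?thesis .
qed

section \<open>Moments, and linear images as complex normal laws\<close>

lemma nn_integral_std_normal_sq: "(\<integral>\<^sup>+x. ennreal (x\<^sup>2) \<partial>std_normal) = 1"
proof -
  have m: "has_bochner_integral lborel (\<lambda>x. std_normal_density x * x\<^sup>2) 1"
    using std_normal_moment_even[of 1] by simp
  have "(\<integral>\<^sup>+x. ennreal (x\<^sup>2) \<partial>std_normal) = (\<integral>\<^sup>+x. ennreal (std_normal_density x * x\<^sup>2) \<partial>lborel)"
    by (subst nn_integral_density) (simp_all add: ennreal_mult')
  also have "\<dots> = ennreal 1"
    using nn_integral_eq_integral[of lborel "\<lambda>x. std_normal_density x * x\<^sup>2"] m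
    by (simp add: has_bochner_integral_iff)
  finally show ?thesis by simp
qed

lemma nn_integral_cgauss_sq: "(\<integral>\<^sup>+z. ennreal ((cmod z)\<^sup>2) \<partial>cgauss) = 2"
proof -
  have "(\<integral>\<^sup>+z. ennreal ((cmod z)\<^sup>2) \<partial>cgauss)
      = (\<integral>\<^sup>+x. (\<integral>\<^sup>+y. ennreal (x\<^sup>2) + ennreal (y\<^sup>2) \<partial>std_normal) \<partial>std_normal)"
    by (subst nn_integral_cgauss) (simp_all add: cmod_power2)
  also have "\<dots> = (\<integral>\<^sup>+x. ennreal (x\<^sup>2) + 1 \<partial>std_normal)"
    by (intro nn_integral_cong, subst nn_integral_add)
      (simp_all add: nn_integral_std_normal_sq std_normal.emeasure_space_1[simplified])
  also have "\<dots> = 1 + 1"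
    by (subst nn_integral_add)
      (simp_all add: nn_integral_std_normal_sq std_normal.emeasure_space_1[simplified])
  finally show ?thesis by simp
qed

lemma integral_cgauss_sq:
  "integrable cgauss (\<lambda>z. (cmod z)\<^sup>2)" "(\<integral>z. (cmod z)\<^sup>2 \<partial>cgauss) = 2"
proof -
  show i: "integrable cgauss (\<lambda>z. (cmod z)\<^sup>2)"
    by (rule integrableI_nonneg) (simp_all add: nn_integral_cgauss_sq)
  have "ennreal (\<integral>z. (cmod z)\<^sup>2 \<partial>cgauss) = ennreal 2"
    by (subst nn_integral_eq_integral[OF i, symmetric]) (simp_all add: nn_integral_cgauss_sq)
  then show "(\<integral>z. (cmod z)\<^sup>2 \<partial>cgauss) = 2"
    by (subst (asm) ennreal_inj) simp_all
qed

lemma distr_cgauss_phase: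
  assumes "cmod c = 1"
  shows "distr cgauss borel (\<lambda>z. c * z) = cgauss"
proof -
  have "distr cgauss borel (\<lambda>z. c * z) = distr cgauss borel (\<lambda>z. z)"
  proof (rule distr_eqI_nn_integral)
    fix f :: "complex \<Rightarrow> ennreal" assume [measurable]: "f \<in> borel_measurable borel"
    show "(\<integral>\<^sup>+z. f (c * z) \<partial>cgauss) = (\<integral>\<^sup>+z. f z \<partial>cgauss)"
      using nn_integral_cgauss_rotation[of "\<lambda>(x, y). f x" c 0] assms cgauss.emeasure_space_1 by simp
  qed measurable
  also have "\<dots> = cgauss" by (rule distr_id2) simp
  finally show ?thesis .
qed

text \<open>Integrability follows from the second moment, and the mean vanishes by symmetry under z
  -> -z.\<close>

lemma integral_cgauss_id: "integrable cgauss (\<lambda>z. z)" "(\<integral>z. z \<partial>cgauss) = 0"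
proof -
  have le: "cmod z \<le> 1 + (cmod z)\<^sup>2" for z
  proof -
    have "2 * cmod z \<le> (cmod z)\<^sup>2 + 1"
      using zero_le_power2[of "cmod z - 1"] by (simp add: power2_diff)
    then show ?thesis using norm_ge_zero[of z] by linarith
  qed
  show "integrable cgauss (\<lambda>z. z)"
    by (rule Bochner_Integration.integrable_bound[of _ "\<lambda>z. 1 + (cmod z)\<^sup>2"])
      (use le in \<open>auto intro!: integral_cgauss_sq cgauss.integrable_const\<close>)
  have "(\<integral>z. z \<partial>cgauss) = (\<integral>z. z \<partial>distr cgauss borel (\<lambda>z. (-1) * z))"
    by (subst distr_cgauss_phase) simp_all
  also have "\<dots> = - (\<integral>z. z \<partial>cgauss)" by (subst integral_distr) simp_all
  finally show "(\<integral>z. z \<partial>cgauss) = 0" by simp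
qed

lemma distr_gauss_on_nth: "distr (gauss_on UNIV) borel (\<lambda>z. z $ k) = cgauss"
proof -
  have "distr (gauss_on UNIV) borel (\<lambda>z. z $ k) = distr cgauss borel (\<lambda>z. z)"
    by (rule distr_eqI_nn_integral) (simp_all add: nn_integral_gauss_on_nth)
  then show ?thesis by (simp add: distr_id2)
qed

lemma integral_gauss_on_nth:
  fixes f :: "complex \<Rightarrow> 'b :: {banach, second_countable_topology}"
  assumes "f \<in> borel_measurable borel"
  shows "integrable (gauss_on UNIV) (\<lambda>z. f (z $ k)) \<longleftrightarrow> integrable cgauss f"
    and "(\<integral>z. f (z $ k) \<partial>gauss_on UNIV) = (\<integral>z. f z \<partial>cgauss)"
  using assms
  by (subst distr_gauss_on_nth[of k, symmetric], subst integrable_distr_eq integral_distr; simp)+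

lemma integral_gauss_on_cross:
  fixes k l :: "'m :: finite"
  shows "integrable (gauss_on UNIV) (\<lambda>z. z $ k * cnj (z $ l))"
    and "(\<integral>z. z $ k * cnj (z $ l) \<partial>gauss_on UNIV) = (if k = l then 2 else 0)"
proof -
  have sq: "integrable (gauss_on UNIV) (\<lambda>z. (cmod (z $ i))\<^sup>2)" for i :: 'm
    by (subst integral_gauss_on_nth) (simp_all add: integral_cgauss_sq)
  have le: "a * b \<le> a\<^sup>2 + b\<^sup>2" if "a \<ge> 0" "b \<ge> 0" for a b :: real
    using sum_squares_bound[of a b] mult_nonneg_nonneg[OF that] by linarith
  show "integrable (gauss_on UNIV) (\<lambda>z. z $ k * cnj (z $ l))"
    by (rule Bochner_Integration.integrable_bound[OF Bochner_Integration.integrable_add[OF sq[of k] sq[of l]]])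
      (auto simp: norm_mult intro!: AE_I2 le)
  show "(\<integral>z. z $ k * cnj (z $ l) \<partial>gauss_on UNIV) = (if k = l then 2 else 0)"
  proof (cases "k = l")
    case True
    have "(\<integral>z. z $ l * cnj (z $ l) \<partial>gauss_on UNIV) = (\<integral>z. complex_of_real ((cmod (z $ l))\<^sup>2) \<partial>gauss_on UNIV)"
      by (simp only: complex_norm_square)
    also have "\<dots> = 2"
      by (subst integral_complex_of_real, subst integral_gauss_on_nth) (simp_all add: integral_cgauss_sq)
    finally show ?thesis using True by simp
  next
    case False
    interpret P: product_prob_space "\<lambda>_ :: 'm. cgauss" ..
    \<comment> \<open>Padding with constant factors 1 turns the cross moment into a product over all
      coordinates, whose integral factors; the factor at \<open>k\<close> is a mean, hence
      zero.\<close>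
    define g :: "'m \<Rightarrow> complex \<Rightarrow> complex"
      where "g = (\<lambda>i z. if i = k then z else if i = l then cnj z else 1)"
    have prod: "(\<Prod>i\<in>UNIV. g i (a i)) = a k * cnj (a l)" for a
    proof -
      have "(\<Prod>i\<in>UNIV. g i (a i)) = (\<Prod>i\<in>{k, l}. g i (a i))"
        by (intro prod.mono_neutral_right) (auto simp: g_def)
      then show ?thesis using False by (simp add: g_def)
    qed
    have int: "integrable cgauss (g i)" for i
      using integral_cgauss_id by (cases "i = k"; cases "i = l") (simp_all add: g_def)
    have "(\<integral>z. z $ k * cnj (z $ l) \<partial>gauss_on UNIV) = (\<integral>a. (\<Prod>i\<in>UNIV. g i (a i)) \<partial>PiM UNIV (\<lambda>_. cgauss))"
      unfolding gauss_on_def by (subst integral_distr) (simp_all add: prod vec_on_def)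
    also have "\<dots> = (\<Prod>i\<in>UNIV. \<integral>z. g i z \<partial>cgauss)"
      by (rule P.product_integral_prod) (simp_all add: int)
    also have "\<dots> = 0"
    proof (rule prod_zero)
      have "(\<integral>z. g k z \<partial>cgauss) = 0" by (simp add: g_def integral_cgauss_id)
      then show "\<exists>i\<in>UNIV. (\<integral>z. g i z \<partial>cgauss) = 0" by blast
    qed simp
    finally show ?thesis using False by simp
  qed
qed

text \<open>After normalizing \<open>c\<close>, the projection is standard complex Gaussian and its
  real part standard normal; \<open>c = 0\<close> yields the degenerate normal law.\<close>

lemma distr_gauss_on_inner:
  fixes c :: "complex ^ 'm"
  shows "normal_law (distr (gauss_on UNIV) borel (\<lambda>z. Re (herm c z)))"
proof (cases "c = 0")
  case True
  interpret G: prob_space "gauss_on (UNIV :: 'm set)" by (rule prob_space_gauss_on)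
  show ?thesis unfolding normal_law_def using G.distr_const[of 0 borel] True by auto
next
  case False
  define r where "r = norm c"
  have r: "r > 0" using False by (simp add: r_def)
  define u where "u = complex_of_real (1 / r) *s c"
  have u: "norm u = 1" using r by (simp add: u_def norm_scale r_def[symmetric] norm_divide)
  have cu: "Re (herm c z) = r * Re (herm u z)" for z
    using r by (simp add: u_def herm_scale_left)
  have "distr (gauss_on UNIV) borel (\<lambda>z. Re (herm c z)) = distr std_normal borel (\<lambda>x. 0 + r * x)"
  proof (rule distr_eqI_nn_integral)
    fix f :: "real \<Rightarrow> ennreal" assume [measurable]: "f \<in> borel_measurable borel"
    have "(\<integral>\<^sup>+z. f (Re (herm c z)) \<partial>gauss_on UNIV) = (\<integral>\<^sup>+z. f (r * Re z) \<partial>cgauss)"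
      unfolding cu by (rule nn_integral_gauss_on_herm[OF u]) simp_all
    also have "\<dots> = (\<integral>\<^sup>+x. f (0 + r * x) \<partial>std_normal)"
      by (subst nn_integral_cgauss) (simp_all add: std_normal.emeasure_space_1[simplified])
    finally show "(\<integral>\<^sup>+z. f (Re (herm c z)) \<partial>gauss_on UNIV) = (\<integral>\<^sup>+x. f (0 + r * x) \<partial>std_normal)" .
  qed simp_all
  also have "\<dots> = density lborel (normal_density 0 r)"
  proof -
    have "distributed std_normal lborel (\<lambda>x. x) std_normal_density"
      unfolding distributed_def by (auto intro!: distr_id2)
    from std_normal.normal_density_affine[OF this, of r 0] r
    have "distributed std_normal lborel (\<lambda>x. 0 + r * x) (normal_density 0 r)" by simp
    from distributed_distr_eq_density[OF this] show ?thesis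
      by (simp cong: distr_cong)
  qed
  finally show ?thesis unfolding normal_law_def using r by blast
qed

text \<open>Every real-linear functional of the image is one of the Gaussian vector itself, and
  circular symmetry passes through the complex-linear map \<open>X\<close>. The factor 2 in the
  covariance is the second absolute moment of \<open>cgauss\<close>.\<close>

lemma complex_normal_combination:
  fixes q :: "'m :: finite \<Rightarrow> complex ^ 'm"
  defines "X \<equiv> \<lambda>z :: complex ^ 'm. \<Sum>i\<in>UNIV. z $ i *s q i"
  shows "complex_normal (distr (gauss_on UNIV) borel X) 0 (2 *\<^sub>R (\<Sum>i\<in>UNIV. self_outer (q i)))"
proof -
  interpret G: prob_space "gauss_on (UNIV :: 'm set)" by (rule prob_space_gauss_on)
  have X [measurable]: "X \<in> borel_measurable borel" unfolding X_def by measurable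
  have Xn: "X z $ a = (\<Sum>i\<in>UNIV. z $ i * q i $ a)" for z a by (simp add: X_def)
  have "normal_law (distr (gauss_on UNIV) borel (\<lambda>z. t \<bullet> X z))" for t
  proof -
    have "t \<bullet> X z = Re (herm (\<chi> i. cnj (herm t (q i))) z)" for z
      unfolding Re_herm[symmetric] X_def herm_sum_right herm_scale_right
      by (simp add: herm_def[of "\<chi> i. _ i"] mult.commute)
    then show ?thesis using distr_gauss_on_inner by simp
  qed
  moreover have "distr (gauss_on UNIV) borel (\<lambda>z. c *s X z) = distr (gauss_on UNIV) borel X"
    if "cmod c = 1" for c
  proof (rule distr_eqI_nn_integral)
    fix f :: "complex ^ 'm \<Rightarrow> ennreal" assume f [measurable]: "f \<in> borel_measurable borel"
    have cX: "c *s X z = X (c *s z)" for z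
      by (simp add: X_def scale_right_sum vector_smult_assoc)
    show "(\<integral>\<^sup>+z. f (c *s X z) \<partial>gauss_on UNIV) = (\<integral>\<^sup>+z. f (X z) \<partial>gauss_on UNIV)"
      using pair_rotation_invariantD[OF pair_rotation_invariant_gauss_on[of UNIV], of c 0 "\<lambda>(x, y). f (X x)"]
        that G.emeasure_space_1 by (simp add: cX)
  qed measurable
  moreover have "(\<integral>z. X z $ a \<partial>gauss_on UNIV) = 0" for a
  proof -
    have "integrable (gauss_on UNIV) (\<lambda>z. z $ i)" "(\<integral>z. z $ i \<partial>gauss_on UNIV) = 0" for i :: 'm
      by (subst integral_gauss_on_nth; simp add: integral_cgauss_id)+
    then show ?thesis unfolding Xn by simp
  qed
  moreover have "(\<integral>z. X z $ a * cnj (X z $ b) \<partial>gauss_on UNIV)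
      = 2 * (\<Sum>i\<in>UNIV. q i $ a * cnj (q i $ b))" for a b
  proof -
    have "X z $ a * cnj (X z $ b)
        = (\<Sum>i\<in>UNIV. \<Sum>j\<in>UNIV. (q i $ a * cnj (q j $ b)) * (z $ i * cnj (z $ j)))" for z
      unfolding Xn cnj_sum sum_product by (simp add: mult_ac)
    then have "(\<integral>z. X z $ a * cnj (X z $ b) \<partial>gauss_on UNIV)
        = (\<Sum>i\<in>UNIV. \<Sum>j\<in>UNIV. (q i $ a * cnj (q j $ b)) * (if i = j then 2 else 0))"
      by (simp add: integral_gauss_on_cross)
    also have "\<dots> = (\<Sum>i\<in>UNIV. (q i $ a * cnj (q i $ b)) * 2)"
      by (simp add: if_distrib[of "\<lambda>x. _ * x"] sum.delta cong: if_cong)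
    finally show ?thesis by (simp add: sum_distrib_left mult_ac)
  qed
  ultimately show ?thesis
    unfolding complex_normal_def
    by (auto simp: distr_distr comp_def integral_distr G.prob_space_distr self_outer_def
        scaleR_conv_of_real[where 'a = complex])
qed

section \<open>Joint law of the three chi-squared variables\<close>

lemma AE_gauss_on_supp:
  fixes J :: "'m :: finite set"
  shows "AE x in gauss_on J. \<forall>i. i \<notin> J \<longrightarrow> x $ i = 0"
  unfolding gauss_on_def by (subst AE_distr_iff) (auto simp: vec_on_def)

text \<open>The vector \<open>b\<close> is a standard Gaussian vector \<open>X\<close> and, after a rotation of the sample, one of
  the summands of the Gram matrix; what remains of its quadratic form at the unit vector along \<open>X\<close>
  is a sum of \<open>n - 1\<close> squares independent of \<open>X\<close>.\<close>
lemma nn_integral_unit_direction: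
  fixes u :: "nat \<Rightarrow> complex" and J :: "'m :: finite set" and G :: "real \<times> real \<Rightarrow> ennreal"
  assumes n: "n \<ge> 1" and u: "(\<Sum>j<n. (cmod (u j))\<^sup>2) = 1"
    and [measurable]: "G \<in> borel_measurable (borel \<Otimes>\<^sub>M borel)"
  defines "F \<equiv> \<lambda>(b :: complex ^ 'm, S). if b = 0 then \<integral>\<^sup>+c. G (0, c) \<partial>chi_squared (2 * n - 2)
      else G ((norm b)\<^sup>2, Re (herm b (S *v b)) / (norm b)\<^sup>2 - (norm b)\<^sup>2)"
  shows "(\<integral>\<^sup>+w. F (\<Sum>j<n. u j *s w j, \<Sum>j<n. self_outer (w j)) \<partial>PiM {..<n} (\<lambda>_. gauss_on J))
    = (\<integral>\<^sup>+x. (\<integral>\<^sup>+c. G (x, c) \<partial>chi_squared (2 * n - 2)) \<partial>chi_squared (2 * card J))"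
proof -
  interpret G: prob_space "gauss_on J" by (rule prob_space_gauss_on)
  interpret P: product_prob_space "\<lambda>_ :: nat. gauss_on J" ..
  interpret chi: prob_space "chi_squared (2 * n - 2)" by (rule prob_space_chi_squared)
  have F [measurable]: "F \<in> borel_measurable (borel \<Otimes>\<^sub>M borel)"
    unfolding F_def by measurable
  let ?I = "{1..<n}"
  have I: "{..<n} = insert 0 ?I" "0 \<notin> ?I" "finite ?I" using n by auto
  have card: "2 * card ?I = 2 * n - 2" by simp
  have mod: "module ((*s) :: complex \<Rightarrow> complex ^ 'm \<Rightarrow> complex ^ 'm)"
    by standard (simp_all add: vector_add_ldistrib vector_sadd_rdistrib vector_smult_assoc)
  have outer: "self_outer (c *s x + s *s y) + self_outer ((- cnj s) *s x + cnj c *s y)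
      = self_outer x + self_outer y" if "(cmod c)\<^sup>2 + (cmod s)\<^sup>2 = 1" for c s and x y :: "complex ^ 'm"
  proof -
    have cs: "c * cnj c + s * cnj s = 1"
      using arg_cong[OF that, of complex_of_real] unfolding of_real_add complex_norm_square by simp
    have "(c * a + s * b) * cnj (c * a' + s * b') + (- cnj s * a + cnj c * b) * cnj (- cnj s * a' + cnj c * b')
        = (c * cnj c + s * cnj s) * (a * cnj a' + b * cnj b')" for a b a' b'
      by (simp add: algebra_simps)
    then show ?thesis unfolding cs by (simp add: self_outer_def vec_eq_iff)
  qed
  have "(\<integral>\<^sup>+w. F (\<Sum>j<n. u j *s w j, \<Sum>j<n. self_outer (w j)) \<partial>PiM {..<n} (\<lambda>_. gauss_on J))
      = (\<integral>\<^sup>+w. F (w 0, \<Sum>j<n. self_outer (w j)) \<partial>PiM {..<n} (\<lambda>_. gauss_on J))"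
    using u unfolding I(1)
    by (intro nn_integral_unit_combination[OF mod _ G.prob_space_axioms sets_gauss_on
          pair_rotation_invariant_gauss_on _ self_outer_scale outer I(3,2) _ F]) measurable
  also have "\<dots> = (\<integral>\<^sup>+x. (\<integral>\<^sup>+w. F (x, self_outer x + (\<Sum>j\<in>?I. self_outer (w j))) \<partial>PiM ?I (\<lambda>_. gauss_on J)) \<partial>gauss_on J)"
    unfolding I(1) using I(2,3)
    by (subst P.product_nn_integral_insert_rev;
        (simp only: fun_upd_same sum_insert_upd[OF I(3,2), where h = "\<lambda>_. self_outer"])?) measurable
  also have "\<dots> = (\<integral>\<^sup>+x. (\<integral>\<^sup>+c. G ((norm x)\<^sup>2, c) \<partial>chi_squared (2 * n - 2)) \<partial>gauss_on J)"
  \<comment> \<open>Almost surely \<open>x\<close> lies in the coordinate subspace of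
    \<open>J\<close>. Only for such directions is the projection of the other draws standard
    Gaussian.\<close>
  proof (rule nn_integral_cong_AE, use AE_gauss_on_supp[of J] in eventually_elim)
    case (elim x)
    show ?case
    proof (cases "x = 0")
      case True
      interpret PI: prob_space "PiM ?I (\<lambda>_. gauss_on J)" by (intro prob_space_PiM G.prob_space_axioms)
      show ?thesis using True PI.emeasure_space_1 by (simp add: F_def)
    next
      case False
      define u where "u = complex_of_real (1 / norm x) *s x"
      have u1: "norm u = 1" using False by (simp add: u_def norm_scale norm_divide)
      have usupp: "u $ i = 0" if "i \<notin> J" for i using elim that by (simp add: u_def)
      have "F (x, self_outer x + (\<Sum>j\<in>?I. self_outer (w j)))
          = G ((norm x)\<^sup>2, \<Sum>j\<in>?I. (cmod (herm u (w j)))\<^sup>2)" for w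
      proof -
        have "herm x ((self_outer x + (\<Sum>j\<in>?I. self_outer (w j))) *v x)
          = herm x x * herm x x + complex_of_real (\<Sum>j\<in>?I. (cmod (herm x (w j)))\<^sup>2)"
          unfolding matrix_vector_mult_add_rdistrib herm_add_right herm_gram self_outer_mult herm_scale_right ..
        then have "Re (herm x ((self_outer x + (\<Sum>j\<in>?I. self_outer (w j))) *v x))
          = (norm x)\<^sup>2 * (norm x)\<^sup>2 + (\<Sum>j\<in>?I. (cmod (herm x (w j)))\<^sup>2)"
          by (simp add: herm_self)
        moreover have "(\<Sum>j\<in>?I. (cmod (herm u (w j)))\<^sup>2) = (\<Sum>j\<in>?I. (cmod (herm x (w j)))\<^sup>2) / (norm x)\<^sup>2"
          by (simp add: u_def herm_scale_left norm_mult norm_divide power_divide sum_divide_distrib)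
        \<comment> \<open>The contribution of \<open>x\<close> to its own quadratic form is removed
          by the subtracted \<open>(norm x)\<^sup>2\<close>, leaving only the other draws.\<close>
        moreover have "((norm x)\<^sup>2 * (norm x)\<^sup>2 + c) / (norm x)\<^sup>2 - (norm x)\<^sup>2 = c / (norm x)\<^sup>2" for c
          using False unfolding add_divide_distrib
          by (subst nonzero_mult_div_cancel_right) auto
        ultimately show ?thesis using False by (simp only: F_def prod.case if_False)
      qed
      then have "(\<integral>\<^sup>+w. F (x, self_outer x + (\<Sum>j\<in>?I. self_outer (w j))) \<partial>PiM ?I (\<lambda>_. gauss_on J))
          = (\<integral>\<^sup>+w. G ((norm x)\<^sup>2, \<Sum>j\<in>?I. (cmod (herm u (w j)))\<^sup>2) \<partial>PiM ?I (\<lambda>_. gauss_on J))"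
        by simp
      also have "\<dots> = (\<integral>\<^sup>+c. G ((norm x)\<^sup>2, c) \<partial>chi_squared (2 * card ?I))"
        by (rule nn_integral_sum_norm_sq[OF _ G.prob_space_axioms])
          (simp_all add: nn_integral_gauss_on_herm[OF u1 usupp])
      finally show ?thesis unfolding card .
    qed
  qed
  also have "\<dots> = (\<integral>\<^sup>+x. (\<integral>\<^sup>+c. G (x, c) \<partial>chi_squared (2 * n - 2)) \<partial>chi_squared (2 * card J))"
    by (rule nn_integral_gauss_on_norm_sq) measurable
  finally show ?thesis .
qed

section \<open>The statistics behind A, B, C and their joint law\<close>

text \<open>The weights of b on the W_j. When all coefficients vanish the first unit weight is used,
  so the weights have norm one for every outcome and no null set has to be excluded from the joint
  law.\<close>

definition unit_dir :: "nat \<Rightarrow> (nat \<Rightarrow> complex) \<Rightarrow> nat \<Rightarrow> complex" where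
  "unit_dir n a j = (if (\<Sum>i<n. (cmod (a i))\<^sup>2) = 0 then if j = 0 then 1 else 0
     else cnj (a j) / complex_of_real (sqrt (\<Sum>i<n. (cmod (a i))\<^sup>2)))"

lemma unit_dir_norm:
  assumes "n \<ge> 1"
  shows "(\<Sum>j<n. (cmod (unit_dir n a j))\<^sup>2) = 1"
proof (cases "(\<Sum>i<n. (cmod (a i))\<^sup>2) = 0")
  case True
  then have "(\<Sum>j<n. (cmod (unit_dir n a j))\<^sup>2) = (\<Sum>j<n. if j = 0 then 1 else 0)"
    by (intro sum.cong) (auto simp: unit_dir_def)
  also have "\<dots> = 1" using assms by (simp add: sum.delta)
  finally show ?thesis .
next
  case False
  have pos: "(\<Sum>i<n. (cmod (a i))\<^sup>2) \<ge> 0" by (intro sum_nonneg) auto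
  have "(\<Sum>j<n. (cmod (unit_dir n a j))\<^sup>2) = (\<Sum>j<n. (cmod (a j))\<^sup>2 / (\<Sum>i<n. (cmod (a i))\<^sup>2))"
    using False pos by (intro sum.cong) (auto simp: unit_dir_def norm_divide power_divide)
  also have "\<dots> = 1" using False by (simp add: sum_divide_distrib[symmetric])
  finally show ?thesis .
qed

definition stat_A :: "nat \<Rightarrow> 'm \<Rightarrow> (nat \<Rightarrow> complex ^ 'm) \<Rightarrow> real" where
  "stat_A n k z = (\<Sum>j<n. (cmod (z j $ k))\<^sup>2)"

text \<open>The vector b in the frame where axis \<open>k\<close> is the signal direction, with
  \<open>drop_coord k (z j)\<close> in the role of W_j. The isometry to the true direction leaves
  all three statistics unchanged and enters only with the eigenvalue.\<close>

definition stat_b :: "nat \<Rightarrow> 'm \<Rightarrow> (nat \<Rightarrow> complex ^ 'm) \<Rightarrow> complex ^ 'm" where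
  "stat_b n k z = (\<Sum>j<n. unit_dir n (\<lambda>i. z i $ k) j *s drop_coord k (z j))"

text \<open>The coordinates \<open>z j\<close> with \<open>j \<ge> n\<close> only serve to give \<open>stat_C\<close> the right law when
  \<open>stat_b\<close> vanishes, which happens almost surely in dimension one.\<close>
definition stat_C :: "nat \<Rightarrow> 'm \<Rightarrow> (nat \<Rightarrow> complex ^ 'm) \<Rightarrow> real" where
  "stat_C n k z = (let b = stat_b n k z in
     if b = 0 then \<Sum>j=n..<2*n-1. (cmod (z j $ k))\<^sup>2
     else (\<Sum>j<n. (cmod (herm b (drop_coord k (z j))))\<^sup>2) / (norm b)\<^sup>2 - (norm b)\<^sup>2)"

text \<open>Used with \<open>2 * n - 1\<close> draws: \<open>n\<close> form the Wishart sample, and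
  the \<open>n - 1\<close> spare ones supply \<open>2 * n - 2\<close> degrees of freedom for
  \<open>stat_C\<close>.\<close>

abbreviation sample_space :: "nat \<Rightarrow> (nat \<Rightarrow> complex ^ 'm) measure" where
  "sample_space n \<equiv> PiM {..<n} (\<lambda>_. gauss_on UNIV)"

lemma measurable_stat [measurable]:
  fixes k :: "'m :: finite"
  assumes n: "n \<ge> 1"
  shows "stat_A n k \<in> borel_measurable (sample_space (2 * n - 1))"
    and "stat_b n k \<in> borel_measurable (sample_space (2 * n - 1))"
    and "stat_C n k \<in> borel_measurable (sample_space (2 * n - 1))"
proof -
  let ?M = "sample_space (2 * n - 1) :: (nat \<Rightarrow> complex ^ 'm) measure"
  have comp: "(\<lambda>z. z j) \<in> borel_measurable ?M" if "j < 2 * n - 1" for j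
    using that measurable_component_singleton[of j "{..<2*n-1}" "\<lambda>_. gauss_on (UNIV :: 'm set)"] by simp
  have comp': "(\<lambda>z. z j) \<in> borel_measurable ?M" if "j < n" for j
    using that by (intro comp) simp
  have sq: "(\<lambda>z. \<Sum>j\<in>J. (cmod (z j $ k))\<^sup>2) \<in> borel_measurable ?M" if "J \<subseteq> {..<2*n-1}" for J
  proof (rule borel_measurable_sum)
    fix j assume "j \<in> J"
    then have [measurable]: "(\<lambda>z. z j) \<in> borel_measurable ?M" using that by (intro comp) auto
    show "(\<lambda>z. (cmod (z j $ k))\<^sup>2) \<in> borel_measurable ?M" by measurable
  qed
  have [measurable]: "(\<lambda>z. \<Sum>j<n. (cmod (z j $ k))\<^sup>2) \<in> borel_measurable ?M"
    using n by (intro sq) auto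
  have E [measurable]: "(\<lambda>z. \<Sum>j=n..<2*n-1. (cmod (z j $ k))\<^sup>2) \<in> borel_measurable ?M"
    by (intro sq) auto
  show "stat_A n k \<in> borel_measurable ?M"
    unfolding stat_A_def by measurable
  show b [measurable]: "stat_b n k \<in> borel_measurable ?M"
    unfolding stat_b_def
  proof (rule borel_measurable_sum)
    fix j assume "j \<in> {..<n}"
    then have [measurable]: "(\<lambda>z. z j) \<in> borel_measurable ?M" by (intro comp') simp
    show "(\<lambda>z. unit_dir n (\<lambda>i. z i $ k) j *s drop_coord k (z j)) \<in> borel_measurable ?M"
      unfolding unit_dir_def by measurable
  qed
  have [measurable]: "(\<lambda>z. \<Sum>j<n. (cmod (herm (stat_b n k z) (drop_coord k (z j))))\<^sup>2) \<in> borel_measurable ?M"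
  proof (rule borel_measurable_sum)
    fix j assume "j \<in> {..<n}"
    then have [measurable]: "(\<lambda>z. z j) \<in> borel_measurable ?M" by (intro comp') simp
    show "(\<lambda>z. (cmod (herm (stat_b n k z) (drop_coord k (z j))))\<^sup>2) \<in> borel_measurable ?M"
      by measurable
  qed
  show "stat_C n k \<in> borel_measurable ?M"
    unfolding stat_C_def Let_def by measurable
qed

text \<open>The right side is integration against a product of three laws, so this identity yields
  the marginals and the independence at once.\<close>

lemma nn_integral_joint_law:
  fixes k :: "'m :: finite" and G :: "real \<times> real \<times> real \<Rightarrow> ennreal"
  assumes n: "n \<ge> 1" and [measurable]: "G \<in> borel_measurable (borel \<Otimes>\<^sub>M borel \<Otimes>\<^sub>M borel)"
  shows "(\<integral>\<^sup>+z. G (stat_A n k z, (norm (stat_b n k z))\<^sup>2, stat_C n k z) \<partial>sample_space (2 * n - 1))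
    = (\<integral>\<^sup>+a. (\<integral>\<^sup>+b. (\<integral>\<^sup>+c. G (a, b, c) \<partial>chi_squared (2 * n - 2))
        \<partial>chi_squared (2 * CARD('m) - 2)) \<partial>chi_squared (2 * n))"
proof -
  interpret N: prob_space "gauss_on (UNIV :: 'm set)" by (rule prob_space_gauss_on)
  interpret P: product_prob_space "\<lambda>_ :: nat. gauss_on (UNIV :: 'm set)" ..
  interpret chi: prob_space "chi_squared (2 * n - 2)" by (rule prob_space_chi_squared)
  interpret chi2: prob_space "chi_squared (2 * CARD('m) - 2)" by (rule prob_space_chi_squared)
  let ?I = "{..<n}" and ?K = "UNIV - {k}"
  \<comment> \<open>Indices of the spare draws.\<close>
  define E where "E = {n..<2*n-1}"
  have finE: "finite E" by (simp add: E_def)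
  have IE: "{..<2*n-1} = ?I \<union> E" "?I \<inter> E = {}" using n by (auto simp: E_def)
  have card: "2 * card ?K = 2 * CARD('m) - 2" by (simp add: card_Diff_singleton diff_mult_distrib2)
  have cardE: "2 * card E = 2 * n - 2" by (simp add: E_def)
  let ?q = "\<lambda>z. \<Sum>j<n. (cmod (herm (stat_b n k z) (drop_coord k (z j))))\<^sup>2"
  let ?al = "\<lambda>a. \<Sum>j<n. (cmod (a j :: complex))\<^sup>2"
  define F where "F = (\<lambda>(a, b :: complex ^ 'm, S). if b = 0 then \<integral>\<^sup>+c. G (a, 0, c) \<partial>chi_squared (2 * n - 2)
      else G (a, (norm b)\<^sup>2, Re (herm b (S *v b)) / (norm b)\<^sup>2 - (norm b)\<^sup>2))"
  have F [measurable]: "F \<in> borel_measurable (borel \<Otimes>\<^sub>M borel \<Otimes>\<^sub>M borel)"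
    unfolding F_def by measurable
  let ?\<Phi> = "\<lambda>(a, w). F (?al a, \<Sum>j<n. unit_dir n a j *s w j, \<Sum>j<n. self_outer (w j))"
  note [measurable] = measurable_stat[OF n]
  have "(\<integral>\<^sup>+z. G (stat_A n k z, (norm (stat_b n k z))\<^sup>2, stat_C n k z) \<partial>sample_space (2 * n - 1))
     = (\<integral>\<^sup>+x. (\<integral>\<^sup>+y. G (stat_A n k (merge ?I E (x, y)), (norm (stat_b n k (merge ?I E (x, y))))\<^sup>2,
         stat_C n k (merge ?I E (x, y))) \<partial>PiM E (\<lambda>_. gauss_on UNIV)) \<partial>PiM ?I (\<lambda>_. gauss_on UNIV))"
    unfolding IE(1)
  proof (rule P.product_nn_integral_fold[OF IE(2)])
    show "(\<lambda>z. G (stat_A n k z, (norm (stat_b n k z))\<^sup>2, stat_C n k z))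
        \<in> borel_measurable (PiM (?I \<union> E) (\<lambda>_. gauss_on UNIV))"
      unfolding IE(1)[symmetric] by measurable
  qed (simp_all add: finE)
  \<comment> \<open>Integrating out the spare draws: where b vanishes they produce the chi-squared
    average written into \<open>F\<close>, elsewhere the integrand is free of them.\<close>
  also have "\<dots> = (\<integral>\<^sup>+x. ?\<Phi> (\<lambda>j\<in>?I. x j $ k, \<lambda>j\<in>?I. drop_coord k (x j)) \<partial>PiM ?I (\<lambda>_. gauss_on UNIV))"
  proof (rule nn_integral_cong)
    fix x :: "nat \<Rightarrow> complex ^ 'm"
    have mI: "merge ?I E (x, y) j = x j" if "j < n" for y j using that by (simp add: merge_def)
    have mE: "merge ?I E (x, y) j = y j" if "j \<in> E" for y j
      using that IE(2) by (auto simp: merge_def)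
    have dir: "unit_dir n a j = unit_dir n a' j" if "\<And>i. i < n \<Longrightarrow> a i = a' i" "j < n" for a a' j
      using that by (simp add: unit_dir_def)
    have A: "stat_A n k (merge ?I E (x, y)) = stat_A n k x" for y
      by (simp add: stat_A_def mI)
    have b: "stat_b n k (merge ?I E (x, y)) = stat_b n k x" for y
      unfolding stat_b_def by (intro sum.cong refl) (simp add: mI dir[of "\<lambda>i. merge ?I E (x, y) i $ k" "\<lambda>i. x i $ k"])
    have b': "stat_b n k x = (\<Sum>j<n. unit_dir n (\<lambda>j\<in>?I. x j $ k) j *s (\<lambda>j\<in>?I. drop_coord k (x j)) j)"
      unfolding stat_b_def by (intro sum.cong refl) (simp add: dir[of "\<lambda>j\<in>?I. x j $ k" "\<lambda>i. x i $ k"])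
    have A': "stat_A n k x = ?al (\<lambda>j\<in>?I. x j $ k)" by (simp add: stat_A_def)
    have S: "Re (herm b ((\<Sum>j<n. self_outer ((\<lambda>j\<in>?I. drop_coord k (x j)) j)) *v b))
        = (\<Sum>j<n. (cmod (herm b (drop_coord k (x j))))\<^sup>2)" for b
      unfolding herm_gram by simp
    show "(\<integral>\<^sup>+y. G (stat_A n k (merge ?I E (x, y)), (norm (stat_b n k (merge ?I E (x, y))))\<^sup>2,
         stat_C n k (merge ?I E (x, y))) \<partial>PiM E (\<lambda>_. gauss_on UNIV))
       = ?\<Phi> (\<lambda>j\<in>?I. x j $ k, \<lambda>j\<in>?I. drop_coord k (x j))"
    proof (cases "stat_b n k x = 0")
      case True
      have C: "stat_C n k (merge ?I E (x, y)) = (\<Sum>j\<in>E. (cmod (y j $ k))\<^sup>2)" for y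
        using True unfolding stat_C_def E_def[symmetric] by (simp add: b mE)
      have "(\<integral>\<^sup>+y. G (stat_A n k x, 0, \<Sum>j\<in>E. (cmod (y j $ k))\<^sup>2) \<partial>PiM E (\<lambda>_. gauss_on UNIV))
          = (\<integral>\<^sup>+c. G (stat_A n k x, 0, c) \<partial>chi_squared (2 * card E))"
        by (rule nn_integral_sum_norm_sq[OF finE N.prob_space_axioms])
          (simp_all add: nn_integral_gauss_on_nth)
      then show ?thesis using True
        unfolding A b C cardE prod.case F_def b'[symmetric] A'[symmetric] by simp
    next
      case False
      have C: "stat_C n k (merge ?I E (x, y)) = ?q x / (norm (stat_b n k x))\<^sup>2 - (norm (stat_b n k x))\<^sup>2" for y
        using False by (simp add: stat_C_def Let_def b mI)
      interpret PE: prob_space "PiM E (\<lambda>_. gauss_on (UNIV :: 'm set))"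
        by (intro prob_space_PiM N.prob_space_axioms)
      show ?thesis using False PE.emeasure_space_1
        unfolding A b C prod.case F_def b'[symmetric] A'[symmetric] S by simp
    qed
  qed
  also have "\<dots> = (\<integral>\<^sup>+a. (\<integral>\<^sup>+w. ?\<Phi> (a, w) \<partial>PiM ?I (\<lambda>_. gauss_on ?K)) \<partial>PiM ?I (\<lambda>_. cgauss))"
  proof (rule nn_integral_PiM_split[where p = "\<lambda>z. z $ k" and q = "drop_coord k"])
    fix H :: "complex \<times> (complex ^ 'm) \<Rightarrow> ennreal"
    assume "H \<in> borel_measurable (cgauss \<Otimes>\<^sub>M gauss_on ?K)"
    then have "H \<in> borel_measurable (borel \<Otimes>\<^sub>M borel)"
      by (simp cong: measurable_cong_sets sets_pair_measure_cong)
    then show "(\<integral>\<^sup>+z. H (z $ k, drop_coord k z) \<partial>gauss_on UNIV) = (\<integral>\<^sup>+a. (\<integral>\<^sup>+w. H (a, w) \<partial>gauss_on ?K) \<partial>cgauss)"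
      by (rule nn_integral_gauss_on_split)
  next
    show "?\<Phi> \<in> borel_measurable (PiM ?I (\<lambda>_. cgauss) \<Otimes>\<^sub>M PiM ?I (\<lambda>_. gauss_on ?K))"
      unfolding unit_dir_def by measurable
  qed (simp_all add: prob_space_gauss_on cgauss.prob_space_axioms)
  also have "\<dots> = (\<integral>\<^sup>+a. (\<integral>\<^sup>+b. (\<integral>\<^sup>+c. G (?al a, b, c) \<partial>chi_squared (2 * n - 2))
        \<partial>chi_squared (2 * CARD('m) - 2)) \<partial>PiM ?I (\<lambda>_. cgauss))"
  \<comment> \<open>For fixed coefficients the inner integral depends on \<open>a\<close> only
    through \<open>?al a\<close>, since every unit direction gives the same law. This is the
    independence of A from B and C.\<close>
  proof (rule nn_integral_cong)
    fix a :: "nat \<Rightarrow> complex"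
    have m: "(\<lambda>(b, c). G (?al a, b, c)) \<in> borel_measurable (borel \<Otimes>\<^sub>M borel)"
      by measurable
    show "(\<integral>\<^sup>+w. ?\<Phi> (a, w) \<partial>PiM ?I (\<lambda>_. gauss_on ?K))
      = (\<integral>\<^sup>+b. (\<integral>\<^sup>+c. G (?al a, b, c) \<partial>chi_squared (2 * n - 2)) \<partial>chi_squared (2 * CARD('m) - 2))"
      using nn_integral_unit_direction[OF n unit_dir_norm[OF n, of a] m, of ?K]
      unfolding card F_def prod.case .
  qed
  also have "\<dots> = (\<integral>\<^sup>+a. (\<integral>\<^sup>+b. (\<integral>\<^sup>+c. G (a, b, c) \<partial>chi_squared (2 * n - 2))
        \<partial>chi_squared (2 * CARD('m) - 2)) \<partial>chi_squared (2 * card ?I))"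
    by (rule nn_integral_sum_norm_sq[where \<phi> = "\<lambda>x. x"]) (simp_all add: cgauss.prob_space_axioms)
  finally show ?thesis by simp
qed

section \<open>From outcomewise limits to convergence in probability\<close>

text \<open>The indicators of the exceptional events tend to 0 almost surely and are bounded by 1,
  so their integrals tend to 0 by dominated convergence.\<close>

lemma tendsto_in_prob_if_AE:
  fixes X :: "real \<Rightarrow> 'a \<Rightarrow> real"
  assumes M: "prob_space M" and X [measurable]: "\<And>s. X s \<in> borel_measurable M"
    and lim: "AE \<omega> in M. ((\<lambda>s. X s \<omega>) \<longlongrightarrow> c) (at_right 0)"
  shows "tendsto_in_prob M X c (at_right 0)"
  unfolding tendsto_in_prob_def
proof (intro conjI allI impI)
  interpret prob_space M by (rule M)
  show "\<forall>\<^sub>F s in at_right 0. X s \<in> borel_measurable M" by (simp add: X)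
  fix e :: real assume e: "e > 0"
  show "((\<lambda>s. measure M {\<omega> \<in> space M. \<bar>X s \<omega> - c\<bar> > e}) \<longlongrightarrow> 0) (at_right 0)"
  \<comment> \<open>Dominated convergence is applied along an arbitrary sequence decreasing the
    parameter to 0 from the right, not necessarily monotonically.\<close>
  proof (unfold tendsto_at_iff_sequentially, intro allI impI)
    fix S :: "nat \<Rightarrow> real" assume S: "\<forall>i. S i \<in> {0<..} - {0}" "S \<longlonglongrightarrow> 0"
    have S': "filterlim S (at_right 0) sequentially"
    proof -
      have pos: "S i > 0" for i using S(1) by auto
      show ?thesis by (simp add: filterlim_at S(2) pos less_imp_neq[OF pos, symmetric])
    qed
    let ?B = "\<lambda>i. {\<omega> \<in> space M. \<bar>X (S i) \<omega> - c\<bar> > e}"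
    have "(\<lambda>i. \<integral>\<omega>. indicator (?B i) \<omega> \<partial>M) \<longlonglongrightarrow> (\<integral>\<omega>. (0 :: real) \<partial>M)"
    proof (rule integral_dominated_convergence[where w = "\<lambda>_. 1"])
      show "AE \<omega> in M. (\<lambda>i. indicator (?B i) \<omega> :: real) \<longlonglongrightarrow> 0"
        using lim
      proof eventually_elim
        case (elim \<omega>)
        have "(\<lambda>i. X (S i) \<omega>) \<longlonglongrightarrow> c" by (rule filterlim_compose[OF elim S'])
        then have "\<forall>\<^sub>F i in sequentially. dist (X (S i) \<omega>) c < e" using e by (rule tendstoD)
        then have "\<forall>\<^sub>F i in sequentially. indicator (?B i) \<omega> = (0 :: real)"
          by eventually_elim (auto simp: dist_real_def indicator_def)
        then show ?case by (rule tendsto_eventually)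
      qed
    qed (auto simp: indicator_def)
    then show "((\<lambda>s. measure M {\<omega> \<in> space M. \<bar>X s \<omega> - c\<bar> > e}) \<circ> S) \<longlonglongrightarrow> 0"
      by (simp add: comp_def)
  qed
qed

lemma AE_stat_A_pos:
  fixes k :: "'m :: finite"
  assumes n: "n \<ge> 1"
  shows "AE z in sample_space (2 * n - 1). stat_A n k z > 0"
proof -
  have "AE a in cgauss. a \<noteq> 0"
    unfolding cgauss_def using AE_lborel_singleton[of "0::complex"] by (subst AE_density) auto
  then have "AE a in distr (gauss_on UNIV) borel (\<lambda>z. z $ k). a \<noteq> 0"
    by (simp only: distr_gauss_on_nth)
  then have "AE z in gauss_on UNIV. z $ k \<noteq> 0"
    by (subst (asm) AE_distr_iff) simp_all
  then have "AE z in sample_space (2 * n - 1). z 0 $ k \<noteq> 0"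
    using n by (intro AE_PiM_component[where P = "\<lambda>x. x $ k \<noteq> 0"] prob_space_gauss_on) auto
  then show ?thesis
  proof eventually_elim
    case (elim z)
    have "0 < (cmod (z 0 $ k))\<^sup>2" using elim by simp
    also have "\<dots> \<le> stat_A n k z"
      unfolding stat_A_def using n by (intro member_le_sum) auto
    finally show ?case .
  qed
qed

section \<open>Wishart realization and assembly\<close>

text \<open>\<open>H\<close> reads only the first \<open>n\<close> draws, so its law is found by
  restricting the product to them and mapping each draw linearly. The spare draws do not affect
  it.\<close>

lemma complex_wishart_sample:
  fixes q :: "'m :: finite \<Rightarrow> complex ^ 'm"
  assumes n: "n \<ge> 1"
  defines "H \<equiv> \<lambda>z. \<Sum>j<n. self_outer (\<Sum>i\<in>UNIV. z j $ i *s q i)"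
  shows "H \<in> sample_space (2 * n - 1) \<rightarrow>\<^sub>M borel"
    and "complex_wishart (distr (sample_space (2 * n - 1)) borel H) n (2 *\<^sub>R (\<Sum>i\<in>UNIV. self_outer (q i)))"
proof -
  let ?N0 = "gauss_on (UNIV :: 'm set)" and ?I = "{..<n}" and ?K = "{..<2*n-1}"
  define X where "X = (\<lambda>z :: complex ^ 'm. \<Sum>i\<in>UNIV. z $ i *s q i)"
  define N where "N = distr ?N0 borel X"
  interpret N0: prob_space ?N0 by (rule prob_space_gauss_on)
  interpret P: product_prob_space "\<lambda>_ :: nat. ?N0" ..
  have [measurable]: "X \<in> borel_measurable borel" unfolding X_def by measurable
  have N: "prob_space N" unfolding N_def by (rule N0.prob_space_distr) simp
  have setsN [measurable_cong]: "sets N = sets borel" by (simp add: N_def)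
  have IK: "?I \<subseteq> ?K" using n by auto
  let ?S = "\<lambda>x :: nat \<Rightarrow> complex ^ 'm. \<Sum>j<n. self_outer (x j)"
  have S [measurable]: "?S \<in> borel_measurable (PiM ?I (\<lambda>_. N))" by measurable
  have HS: "H z = ?S (compose ?I X (restrict z ?I))" for z
    by (simp add: H_def X_def compose_def)
  have "PiM ?I (\<lambda>_. N) = PiM ?I (\<lambda>_. distr ?N0 N X)"
    by (simp add: N_def cong: distr_cong)
  also have "\<dots> = distr (PiM ?I (\<lambda>_. ?N0)) (PiM ?I (\<lambda>_. N)) (compose ?I X)"
    by (rule distr_PiM_finite_prob_space'[symmetric]) (simp_all add: N N0.prob_space_axioms)
  also have "PiM ?I (\<lambda>_. ?N0) = distr (PiM ?K (\<lambda>_. ?N0)) (PiM ?I (\<lambda>_. ?N0)) (\<lambda>z. restrict z ?I)"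
    by (rule P.distr_restrict[OF IK]) simp
  finally have PN: "PiM ?I (\<lambda>_. N) = distr (distr (PiM ?K (\<lambda>_. ?N0)) (PiM ?I (\<lambda>_. ?N0)) (\<lambda>z. restrict z ?I))
      (PiM ?I (\<lambda>_. N)) (compose ?I X)" .
  have [measurable]: "(\<lambda>z. restrict z ?I) \<in> PiM ?K (\<lambda>_. ?N0) \<rightarrow>\<^sub>M PiM ?I (\<lambda>_. ?N0)"
    by (rule measurable_restrict_subset[OF IK])
  have [measurable]: "compose ?I X \<in> PiM ?I (\<lambda>_. ?N0) \<rightarrow>\<^sub>M PiM ?I (\<lambda>_. N)"
    unfolding compose_def by measurable
  show "H \<in> sample_space (2 * n - 1) \<rightarrow>\<^sub>M borel" unfolding HS[abs_def] by measurable
  have "distr (sample_space (2 * n - 1)) borel H = distr (PiM ?I (\<lambda>_. N)) borel ?S"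
    by (subst PN, subst distr_distr, measurable, subst distr_distr, measurable)
      (simp add: HS[abs_def] comp_def)
  moreover have "complex_normal N 0 (2 *\<^sub>R (\<Sum>i\<in>UNIV. self_outer (q i)))"
    unfolding N_def X_def by (rule complex_normal_combination)
  ultimately show "complex_wishart (distr (sample_space (2 * n - 1)) borel H) n (2 *\<^sub>R (\<Sum>i\<in>UNIV. self_outer (q i)))"
    unfolding complex_wishart_def by blast
qed

text \<open>Marginals come from test functions of one variable. Independence comes from indicators
  of boxes, which determine a finite product measure.\<close>

lemma joint_law_consequences:
  fixes k :: "'m :: finite"
  assumes n: "n \<ge> 1"
  defines "M \<equiv> sample_space (2 * n - 1)" and "A \<equiv> stat_A n k" and "B \<equiv> \<lambda>z. (norm (stat_b n k z))\<^sup>2"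
    and "C \<equiv> stat_C n k"
  shows "distr M borel A = chi_squared (2 * n)"
    and "distr M borel B = chi_squared (2 * CARD('m) - 2)"
    and "distr M borel C = chi_squared (2 * n - 2)"
    and "prob_space.indep_vars M (\<lambda>_. borel) (\<lambda>k. [A, B, C] ! k) {..<3}"
proof -
  interpret M: prob_space M unfolding M_def by (intro prob_space_PiM prob_space_gauss_on)
  have meas [measurable]: "A \<in> borel_measurable M" "B \<in> borel_measurable M" "C \<in> borel_measurable M"
    using measurable_stat[OF n, of k] unfolding A_def B_def C_def M_def by measurable
  let ?a = "2 * n" and ?b = "2 * CARD('m) - 2" and ?c = "2 * n - 2"
  interpret a: prob_space "chi_squared ?a" by (rule prob_space_chi_squared)
  interpret b: prob_space "chi_squared ?b" by (rule prob_space_chi_squared)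
  interpret c: prob_space "chi_squared ?c" by (rule prob_space_chi_squared)
  note one = a.emeasure_space_1 b.emeasure_space_1 c.emeasure_space_1
  have joint: "(\<integral>\<^sup>+z. G (A z, B z, C z) \<partial>M)
     = (\<integral>\<^sup>+a. (\<integral>\<^sup>+b. (\<integral>\<^sup>+c. G (a, b, c) \<partial>chi_squared ?c) \<partial>chi_squared ?b) \<partial>chi_squared ?a)"
    if "G \<in> borel_measurable (borel \<Otimes>\<^sub>M borel \<Otimes>\<^sub>M borel)" for G
    unfolding A_def B_def C_def M_def by (rule nn_integral_joint_law[OF n that])
  show A: "distr M borel A = chi_squared ?a"
  proof (rule measure_eqI_nn_integral)
    fix f :: "real \<Rightarrow> ennreal" assume "f \<in> borel_measurable (distr M borel A)"
    then have [measurable]: "f \<in> borel_measurable borel" by simp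
    show "(\<integral>\<^sup>+x. f x \<partial>distr M borel A) = (\<integral>\<^sup>+x. f x \<partial>chi_squared ?a)"
      using joint[of "\<lambda>(a, b, c). f a"] one by (simp add: nn_integral_distr)
  qed simp
  show B: "distr M borel B = chi_squared ?b"
  proof (rule measure_eqI_nn_integral)
    fix f :: "real \<Rightarrow> ennreal" assume "f \<in> borel_measurable (distr M borel B)"
    then have [measurable]: "f \<in> borel_measurable borel" by simp
    show "(\<integral>\<^sup>+x. f x \<partial>distr M borel B) = (\<integral>\<^sup>+x. f x \<partial>chi_squared ?b)"
      using joint[of "\<lambda>(a, b, c). f b"] one by (simp add: nn_integral_distr)
  qed simp
  show C: "distr M borel C = chi_squared ?c"
  proof (rule measure_eqI_nn_integral)
    fix f :: "real \<Rightarrow> ennreal" assume "f \<in> borel_measurable (distr M borel C)"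
    then have [measurable]: "f \<in> borel_measurable borel" by simp
    show "(\<integral>\<^sup>+x. f x \<partial>distr M borel C) = (\<integral>\<^sup>+x. f x \<partial>chi_squared ?c)"
      using joint[of "\<lambda>(a, b, c). f c"] one by (simp add: nn_integral_distr)
  qed simp
  have boxes: "(\<integral>\<^sup>+z. indicator P (A z) * (indicator Q (B z) * indicator T (C z)) \<partial>M)
      = emeasure (chi_squared ?a) P * (emeasure (chi_squared ?b) Q * emeasure (chi_squared ?c) T)"
    if [measurable]: "P \<in> sets borel" "Q \<in> sets borel" "T \<in> sets borel" for P Q T
  proof -
    have "(\<lambda>(a, b, c). indicator P a * (indicator Q b * indicator T c) :: ennreal)
        \<in> borel_measurable (borel \<Otimes>\<^sub>M borel \<Otimes>\<^sub>M borel)" by measurable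
    from joint[OF this] show ?thesis by (simp add: nn_integral_cmult nn_integral_multc)
  qed
  have three: "{..<3::nat} = {0, 1, 2}" by auto
  define L where "L i = (if i = 0 then chi_squared ?a else if i = 1 then chi_squared ?b else chi_squared ?c)"
    for i :: nat
  interpret L: product_sigma_finite L
    by (rule product_sigma_finite.intro) (simp add: L_def a.sigma_finite_measure_axioms
      b.sigma_finite_measure_axioms c.sigma_finite_measure_axioms)
  have rv: "[A, B, C] ! i \<in> borel_measurable M" if "i \<in> {..<3}" for i
    using that meas unfolding three by auto
  have setsL: "sets (PiM {..<3} L) = sets (PiM {..<3} (\<lambda>_. borel :: real measure))"
    by (rule sets_PiM_cong) (simp_all add: L_def)
  have meas3: "(\<lambda>z. \<lambda>i\<in>{..<3}. ([A, B, C] ! i) z) \<in> M \<rightarrow>\<^sub>M PiM {..<3} (\<lambda>_. borel)"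
    by (rule measurable_restrict) (rule rv)
  have "distr M (PiM {..<3} (\<lambda>_. borel)) (\<lambda>z. \<lambda>i\<in>{..<3}. ([A, B, C] ! i) z) = PiM {..<3} L"
  proof (rule L.PiM_eqI)
    fix S assume S: "\<And>i. i \<in> {..<3} \<Longrightarrow> S i \<in> sets (L i)"
    have SL: "S i \<in> sets borel" if "i \<in> {..<3}" for i
      using S[OF that] by (simp add: L_def split: if_splits)
    have [measurable]: "S 0 \<in> sets borel" "S 1 \<in> sets borel" "S 2 \<in> sets borel"
      using SL[of 0] SL[of 1] SL[of 2] by simp_all
    have "(\<lambda>z. \<lambda>i\<in>{..<3}. ([A, B, C] ! i) z) -` Pi\<^sub>E {..<3} S \<inter> space M
        = {z \<in> space M. A z \<in> S 0 \<and> B z \<in> S 1 \<and> C z \<in> S 2}"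
    proof -
      have "(\<lambda>z. \<lambda>i\<in>{..<3}. ([A, B, C] ! i) z) -` Pi\<^sub>E {..<3} S \<inter> space M
          = {z \<in> space M. \<forall>i\<in>{..<3}. ([A, B, C] ! i) z \<in> S i}"
        unfolding vimage_def restrict_PiE_iff by blast
      also have "\<dots> = {z \<in> space M. A z \<in> S 0 \<and> B z \<in> S 1 \<and> C z \<in> S 2}"
        unfolding three by simp
      finally show ?thesis .
    qed
    then have "emeasure (distr M (PiM {..<3} (\<lambda>_. borel)) (\<lambda>z. \<lambda>i\<in>{..<3}. ([A, B, C] ! i) z)) (Pi\<^sub>E {..<3} S)
        = emeasure M {z \<in> space M. A z \<in> S 0 \<and> B z \<in> S 1 \<and> C z \<in> S 2}"
      by (subst emeasure_distr[OF meas3]) (auto intro!: sets_PiM_I_finite SL)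
    also have "\<dots> = (\<integral>\<^sup>+z. indicator (S 0) (A z) * (indicator (S 1) (B z) * indicator (S 2) (C z)) \<partial>M)"
    proof -
      have "indicator {z \<in> space M. A z \<in> S 0 \<and> B z \<in> S 1 \<and> C z \<in> S 2} z
          = indicator (S 0) (A z) * (indicator (S 1) (B z) * indicator (S 2) (C z) :: ennreal)"
        if "z \<in> space M" for z
        using that by (simp add: indicator_def)
      then show ?thesis
        by (subst nn_integral_indicator[symmetric], measurable) (rule nn_integral_cong)
    qed
    also have "\<dots> = emeasure (chi_squared ?a) (S 0) * (emeasure (chi_squared ?b) (S 1) * emeasure (chi_squared ?c) (S 2))"
      by (rule boxes) measurable
    also have "\<dots> = (\<Prod>i\<in>{..<3}. emeasure (L i) (S i))"
      by (simp add: three L_def)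
    finally show "emeasure (distr M (PiM {..<3} (\<lambda>_. borel)) (\<lambda>z. \<lambda>i\<in>{..<3}. ([A, B, C] ! i) z)) (Pi\<^sub>E {..<3} S)
        = (\<Prod>i\<in>{..<3}. emeasure (L i) (S i))" .
  qed (simp_all add: setsL)
  also have "PiM {..<3} L = PiM {..<3} (\<lambda>i. distr M borel ([A, B, C] ! i))"
    by (rule PiM_cong) (auto simp: three L_def A B C)
  finally show "M.indep_vars (\<lambda>_. borel) (\<lambda>k. [A, B, C] ! k) {..<3}"
    using M.indep_vars_iff_distr_eq_PiM'[where I = "{..<3}" and M' = "\<lambda>_. borel"
        and X = "\<lambda>i. [A, B, C] ! i", OF _ rv]
    by (simp add: three)
qed

text \<open>Translates the coefficients: \<open>g\<close> is \<open>sqrt A\<close> times the image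
  of b, hence \<open>(norm g)\<^sup>2 = A * B\<close> and \<open>h = A * B * (C + B)\<close>. The
  combination \<open>h - (A * B)\<^sup>2 / A\<close> then collapses to
  \<open>A * B * C\<close>.\<close>

lemma largest_eigenvalue_stat_expansion:
  fixes v :: "complex ^ 'm :: finite" and Q :: "complex ^ 'm \<Rightarrow> complex ^ 'm"
  assumes lam: "lam > 0" and v: "norm v = 1" and Qk: "Q (axis k 1) = v"
    and Qadd: "\<And>x y. Q (x + y) = Q x + Q y" and Qsc: "\<And>a x. Q (a *s x) = a *s Q x"
    and Qherm: "\<And>x y. herm (Q x) (Q y) = herm x y"
    and A: "stat_A n k z > 0"
  defines "B \<equiv> (norm (stat_b n k z))\<^sup>2"
  shows "((\<lambda>\<sigma>. (largest_eigenvalue (\<Sum>j<n. self_outer ((1 / sqrt 2) *\<^sub>R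
        (complex_of_real (sqrt (lam + \<sigma>\<^sup>2)) *s (z j $ k *s v) + complex_of_real \<sigma> *s Q (drop_coord k (z j)))))
      - ((lam + \<sigma>\<^sup>2) / 2 * stat_A n k z + \<sigma>\<^sup>2 / 2 * B
        + \<sigma>^4 / (2 * (lam + \<sigma>\<^sup>2)) * (B * stat_C n k z / stat_A n k z))) / \<sigma>^4) \<longlongrightarrow> 0) (at_right 0)"
proof -
  let ?a = "\<lambda>j. z j $ k" and ?V = "\<lambda>j. Q (drop_coord k (z j))" and ?b = "stat_b n k z" and ?A = "stat_A n k z"
  let ?C = "stat_C n k z"
  define g where "g = (\<Sum>j<n. cnj (?a j) *s ?V j)"
  define h where "h = (\<Sum>j<n. (cmod (herm g (?V j)))\<^sup>2)"
  have orth: "herm v (?V j) = 0" for j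
    unfolding Qk[symmetric] Qherm herm_axis by (simp add: drop_coord_def)
  have Q0: "Q 0 = 0" using Qsc[of 0 0] by simp
  have Qsum: "Q (\<Sum>j\<in>J. f j) = (\<Sum>j\<in>J. Q (f j))" for f :: "nat \<Rightarrow> complex ^ 'm" and J
    by (induction J rule: infinite_finite_induct) (simp_all add: Qadd Q0)
  have Qnorm: "norm (Q x) = norm x" for x
  proof -
    have "complex_of_real ((norm (Q x))\<^sup>2) = complex_of_real ((norm x)\<^sup>2)"
      using Qherm[of x x] unfolding herm_self .
    then show ?thesis by (simp only: of_real_eq_iff power2_eq_iff_nonneg norm_ge_zero)
  qed
  have g: "g = complex_of_real (sqrt ?A) *s Q ?b"
  proof -
    have "complex_of_real (sqrt ?A) * unit_dir n ?a j = cnj (?a j)" for j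
      using A unfolding stat_A_def by (simp add: unit_dir_def)
    then show ?thesis
      unfolding g_def stat_b_def Qsum Qsc scale_right_sum vector_smult_assoc by simp
  qed
  have gn: "(norm g)\<^sup>2 = ?A * B"
    using A by (simp add: g norm_scale Qnorm B_def power_mult_distrib)
  have h: "h = ?A * (\<Sum>j<n. (cmod (herm ?b (drop_coord k (z j))))\<^sup>2)"
    unfolding h_def g sum_distrib_left herm_scale_left Qherm
    using A by (simp add: norm_mult power_mult_distrib)
  \<comment> \<open>If b vanishes, both sides are zero whatever value the spare draws give to
    \<open>?C\<close>.\<close>
  have hBC: "h = ?A * (B * (?C + B))"
  proof (cases "?b = 0")
    case True
    then show ?thesis by (simp add: h B_def)
  next
    case False
    then have "B \<noteq> 0" by (simp add: B_def)
    then show ?thesis using False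
      by (simp add: h stat_C_def Let_def B_def[symmetric])
  qed
  have p: "(norm g)\<^sup>2 / ?A = B" using A by (simp add: gn)
  have r: "(h - ((norm g)\<^sup>2)\<^sup>2 / ?A) / ?A\<^sup>2 = B * ?C / ?A"
  proof -
    have "h - ((norm g)\<^sup>2)\<^sup>2 / ?A = ?A * (B * ?C)"
      using A unfolding gn hBC by (simp add: power2_eq_square field_simps)
    then show ?thesis using A by (simp add: power2_eq_square)
  qed
  have "((\<lambda>\<sigma>. (2 * largest_eigenvalue (\<Sum>j<n. self_outer ((1 / sqrt 2) *\<^sub>R
        (complex_of_real (sqrt (lam + \<sigma>\<^sup>2)) *s (?a j *s v) + complex_of_real \<sigma> *s ?V j)))
      - ((lam + \<sigma>\<^sup>2) * ?A + \<sigma>\<^sup>2 * B + \<sigma>^4 / (lam + \<sigma>\<^sup>2) * (B * ?C / ?A))) / \<sigma>^4) \<longlongrightarrow> 0) (at_right 0)"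
    using largest_eigenvalue_expansion[where V = ?V and a = ?a, OF v orth lam A[unfolded stat_A_def]]
    unfolding g_def[symmetric] h_def[symmetric] stat_A_def[symmetric] p r .
  note lim = tendsto_mult[OF tendsto_const[of "1 / 2"] this]
  have half: "1 / 2 * ((2 * l - (x * ?A + y * B + w / x * t)) / d)
      = (l - (x / 2 * ?A + y / 2 * B + w / (2 * x) * t)) / d" for l x y w t d :: real
  proof -
    have "l - (x / 2 * ?A + y / 2 * B + w / (2 * x) * t) = (2 * l - (x * ?A + y * B + w / x * t)) / 2"
      by (simp add: add_divide_distrib diff_divide_distrib)
    moreover have "1 / 2 * (r / d) = r / 2 / d" for r :: real by simp
    ultimately show ?thesis by (simp only:)
  qed
  show ?thesis using lim unfolding half mult_zero_right .
qed

text \<open>One probability space and one triple \<open>A\<close>, \<open>B\<close>,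
  \<open>C\<close> serve all \<open>\<sigma>\<close> simultaneously. The remainder \<open>R\<close>
  is the exact difference for each outcome, and its size is controlled in probability.\<close>

theorem proposition1:
  fixes v :: "complex ^ 'm" and n :: nat and lam :: real
  assumes "n \<ge> 1" and "lam > 0" and "norm v = 1"
  shows "\<exists>(M :: (nat \<Rightarrow> complex ^ 'm) measure)
           (H :: real \<Rightarrow> (nat \<Rightarrow> complex ^ 'm) \<Rightarrow> complex ^ 'm ^ 'm) A B C R.
     prob_space M \<and>
     (\<forall>\<sigma>>0. H \<sigma> \<in> M \<rightarrow>\<^sub>M borel \<and>
        complex_wishart (distr M borel (H \<sigma>)) n (lam *\<^sub>R self_outer v + \<sigma>\<^sup>2 *\<^sub>R mat 1)) \<and>
     prob_space.indep_vars M (\<lambda>_. borel) (\<lambda>k. [A, B, C] ! k) {..<3} \<and>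
     distr M borel A = chi_squared (2 * n) \<and>
     distr M borel B = chi_squared (2 * CARD('m) - 2) \<and>
     distr M borel C = chi_squared (2 * n - 2) \<and>
     (\<forall>\<sigma>>0. \<forall>\<omega>\<in>space M.
        largest_eigenvalue (H \<sigma> \<omega>) =
          (lam + \<sigma>\<^sup>2) / 2 * A \<omega> + \<sigma>\<^sup>2 / 2 * B \<omega>
          + \<sigma> ^ 4 / (2 * (lam + \<sigma>\<^sup>2)) * (B \<omega> * C \<omega> / A \<omega>) + R \<sigma> \<omega>) \<and>
     tendsto_in_prob M (\<lambda>\<sigma> \<omega>. R \<sigma> \<omega> / \<sigma> ^ 4) 0 (at_right 0)"
proof -
  note n = assms(1) and lam = assms(2)
  \<comment> \<open>Any coordinate may carry the signal coefficients.\<close>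
  fix k :: 'm
  obtain Q c where c: "cmod c = 1" and Qk: "Q (axis k 1) = c *s v"
    and Qadd: "\<And>x y. Q (x + y) = Q x + Q y" and Qsc: "\<And>a x. Q (a *s x) = a *s Q x"
    and Qherm: "\<And>x y. herm (Q x) (Q y) = herm x y"
    and Qsum: "(\<Sum>i\<in>UNIV. self_outer (Q (axis i 1))) = mat 1"
    by (rule unitary_sending_axis[OF assms(3), of k]) (rule that)
  \<comment> \<open>The unitary map reaches \<open>v\<close> only up to a phase, which is harmless
    because \<open>self_outer\<close> does not see phases.\<close>
  define v' where "v' = c *s v"
  have v': "norm v' = 1" by (simp add: v'_def norm_scale c assms(3))
  note Qk' = Qk[folded v'_def]
  define M :: "(nat \<Rightarrow> complex ^ 'm) measure" where "M = sample_space (2 * n - 1)"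
  define s where "s \<sigma> = sqrt (lam + \<sigma>\<^sup>2)" for \<sigma> :: real
  \<comment> \<open>An orthogonal frame scaled so that its outer products sum to half of the target
    covariance; the other factor 2 comes from \<open>cgauss\<close>.\<close>
  define q where "q \<sigma> i = (if i = k then complex_of_real (s \<sigma> / sqrt 2) *s v'
      else complex_of_real (\<sigma> / sqrt 2) *s Q (axis i 1))" for \<sigma> :: real and i :: 'm
  define H where "H \<sigma> z = (\<Sum>j<n. self_outer (\<Sum>i\<in>UNIV. z j $ i *s q \<sigma> i))"
    for \<sigma> and z :: "nat \<Rightarrow> complex ^ 'm"
  define A where "A = stat_A n k"
  define B where "B z = (norm (stat_b n k z))\<^sup>2" for z
  define C where "C = stat_C n k"
  define main where "main \<sigma> z = (lam + \<sigma>\<^sup>2) / 2 * A z + \<sigma>\<^sup>2 / 2 * B z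
    + \<sigma> ^ 4 / (2 * (lam + \<sigma>\<^sup>2)) * (B z * C z / A z)" for \<sigma> z
  define R where "R \<sigma> z = largest_eigenvalue (H \<sigma> z) - main \<sigma> z" for \<sigma> z
  interpret M: prob_space M unfolding M_def by (intro prob_space_PiM prob_space_gauss_on)
  \<comment> \<open>Rewrites a sample point as signal plus orthogonal noise, the form to which the
    eigenvalue expansion applies.\<close>
  have q_alt: "(\<Sum>i\<in>UNIV. x $ i *s q \<sigma> i) = (1 / sqrt 2) *\<^sub>R
      (complex_of_real (s \<sigma>) *s (x $ k *s v') + complex_of_real \<sigma> *s Q (drop_coord k x))" for x \<sigma>
  proof -
    have Q0: "Q 0 = 0" using Qsc[of 0 0] by simp
    have Qsum': "Q (\<Sum>j\<in>J. f j) = (\<Sum>j\<in>J. Q (f j))" for f :: "'m \<Rightarrow> complex ^ 'm" and J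
      by (induction J rule: infinite_finite_induct) (simp_all add: Qadd Q0)
    have "drop_coord k x = (\<Sum>i\<in>UNIV. drop_coord k x $ i *s axis i 1)"
      by (rule basis_expansion[symmetric])
    also have "\<dots> = (\<Sum>i\<in>UNIV - {k}. x $ i *s axis i 1)"
      by (rule sum.mono_neutral_cong_right) (auto simp: drop_coord_def)
    finally have Qd: "Q (drop_coord k x) = (\<Sum>i\<in>UNIV - {k}. x $ i *s Q (axis i 1))"
      by (simp add: Qsum' Qsc)
    have "(\<Sum>i\<in>UNIV. x $ i *s q \<sigma> i) = x $ k *s q \<sigma> k + (\<Sum>i\<in>UNIV - {k}. x $ i *s q \<sigma> i)"
      by (rule sum.remove) auto
    also have "(\<Sum>i\<in>UNIV - {k}. x $ i *s q \<sigma> i) = complex_of_real (\<sigma> / sqrt 2) *s Q (drop_coord k x)"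
      unfolding Qd scale_right_sum
      by (intro sum.cong) (auto simp: q_def vector_smult_assoc mult.commute)
    finally show ?thesis
      unfolding of_real_scale[symmetric]
      by (simp add: q_def vector_smult_assoc vector_add_ldistrib mult_ac)
  qed
  have cov: "2 *\<^sub>R (\<Sum>i\<in>UNIV. self_outer (q \<sigma> i)) = lam *\<^sub>R self_outer v + \<sigma>\<^sup>2 *\<^sub>R mat 1" for \<sigma>
  proof -
    have s2: "(s \<sigma>)\<^sup>2 = lam + \<sigma>\<^sup>2" using lam by (simp add: s_def)
    have vv: "self_outer v' = self_outer v" unfolding v'_def by (rule self_outer_scale[OF c])
    \<comment> \<open>By completeness of the frame, the directions other than \<open>k\<close> sum
      to the projection orthogonal to \<open>v\<close>. Its \<open>\<sigma>\<^sup>2\<close> share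
      completes that in \<open>(s \<sigma>)\<^sup>2\<close> to the full multiple of the
      identity.\<close>
    have rest: "(\<Sum>i\<in>UNIV - {k}. self_outer (Q (axis i 1))) = mat 1 - self_outer v"
      using sum.remove[of UNIV k "\<lambda>i. self_outer (Q (axis i 1))"] by (simp add: Qsum Qk' vv)
    have "(\<Sum>i\<in>UNIV. self_outer (q \<sigma> i)) = self_outer (q \<sigma> k) + (\<Sum>i\<in>UNIV - {k}. self_outer (q \<sigma> i))"
      by (rule sum.remove) auto
    also have "self_outer (q \<sigma> k) = ((s \<sigma>)\<^sup>2 / 2) *\<^sub>R self_outer v"
      unfolding q_def of_real_scale by (simp add: self_outer_scaleR vv power_divide)
    also have "(\<Sum>i\<in>UNIV - {k}. self_outer (q \<sigma> i)) = (\<sigma>\<^sup>2 / 2) *\<^sub>R (mat 1 - self_outer v)"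
      unfolding rest[symmetric] scaleR_sum_right q_def of_real_scale
      by (intro sum.cong) (auto simp: self_outer_scaleR power_divide)
    finally show ?thesis
      by (simp add: s2 scaleR_add_right scaleR_diff_right scaleR_add_left add_divide_distrib)
  qed
  have meas [measurable]: "A \<in> borel_measurable M" "B \<in> borel_measurable M" "C \<in> borel_measurable M"
    using measurable_stat[OF n, of k] unfolding A_def B_def C_def M_def by measurable
  have H [measurable]: "H \<sigma> \<in> M \<rightarrow>\<^sub>M borel" for \<sigma>
    using complex_wishart_sample(1)[OF n, of "q \<sigma>"] unfolding H_def M_def .
  have W: "complex_wishart (distr M borel (H \<sigma>)) n (lam *\<^sub>R self_outer v + \<sigma>\<^sup>2 *\<^sub>R mat 1)" for \<sigma>
    using complex_wishart_sample(2)[OF n, of "q \<sigma>"] unfolding H_def M_def cov .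
  have [measurable]: "(\<lambda>z. largest_eigenvalue (H \<sigma> z)) \<in> borel_measurable M" for \<sigma>
    by (rule borel_measurable_largest_eigenvalue[OF H]) (simp add: H_def hermitian_gram)
  have "tendsto_in_prob M (\<lambda>\<sigma> z. R \<sigma> z / \<sigma> ^ 4) 0 (at_right 0)"
  proof (rule tendsto_in_prob_if_AE[OF M.prob_space_axioms])
    show "(\<lambda>z. R \<sigma> z / \<sigma> ^ 4) \<in> borel_measurable M" for \<sigma>
      unfolding R_def main_def by measurable
    show "AE z in M. ((\<lambda>\<sigma>. R \<sigma> z / \<sigma> ^ 4) \<longlongrightarrow> 0) (at_right 0)"
      using AE_stat_A_pos[OF n, of k] unfolding M_def[symmetric]
    proof eventually_elim
      case (elim z)
      show ?case
        using largest_eigenvalue_stat_expansion[where Q = Q, OF lam v' Qk' Qadd Qsc Qherm elim]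
        unfolding R_def main_def H_def q_alt s_def A_def B_def C_def .
    qed
  qed
  moreover have "largest_eigenvalue (H \<sigma> z) = main \<sigma> z + R \<sigma> z" for \<sigma> z by (simp add: R_def)
  ultimately show ?thesis
    using joint_law_consequences[OF n, of k, folded M_def A_def B_def[abs_def] C_def] H W M.prob_space_axioms
    unfolding main_def
    by (intro exI[of _ M] exI[of _ H] exI[of _ A] exI[of _ B] exI[of _ C] exI[of _ R] conjI allI impI ballI)
qed

end
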